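(* Let $n\ge3$ and, for $\varepsilon\in(0,\frac{4}{n-2})$, let $u_\varepsilon$ be a radial solution of $-\Delta u_\varepsilon=|u_\varepsilon|^{\frac{4}{n-2}-\varepsilon}u_\varepsilon$ in $B$ with $m-1$ interior zeros ($m$ fixed), and fix $x\in\overline{B}\setminus\{0\}$. If $u_\varepsilon$ satisfies the Dirichlet boundary condition $u_\varepsilon=0$ on $\partial B$ and $m\ge1$, then $$|u_\varepsilon(x)|(\kappa_n\varepsilon)^{-\frac12}=(n(n-2))^{\frac{n-2}{4}}m^{\frac12}(|x|^{2-n}-1)+o(1).$$ If $u_\varepsilon$ satisfies the Neumann boundary condition $\partial_\nu u_\varepsilon=0$ on $\partial B$ and $m\ge2$, then $$|u_\varepsilon(x)|(\kappa_n\varepsilon)^{-\frac{n-2}{2n}}=(n(n-2))^{\frac{n-2}{4}}(m-1)^{\frac{n-2}{2n}}+o(1).$$ Here $o(1)\to0$ as $\varepsilon\to0$, uniformly in compact subsets of $\overline{B}\setminus\{0\}$. In particular, $u_\varepsilon$ converges uniformly to zero in compact subsets of $\overline{B}\setminus\{0\}$.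
   Context: $B\subset\mathbb{R}^n$ is the open unit ball centered at the origin; $\partial_\nu$ is the outer normal derivative; solutions are classical. "Has $k$ interior zeros" means that the radial profile $r\mapsto u(r)$ ($r=|x|$) has exactly $k$ zeros in $(0,1)$. Radial solutions with exactly $m-1$ interior zeros exist and are unique up to a sign (Dirichlet: $m\ge1$; Neumann: $m\ge2$). $\Gamma$ is the Gamma function and $\kappa_n:=\frac{n-2}{4}\frac{\Gamma(n/2)^2}{\Gamma(n)}$. *)

theory Defs
  imports "HOL-Analysis.Analysis"
begin

definition partial_deriv :: "'a::euclidean_space \<Rightarrow> ('a \<Rightarrow> real) \<Rightarrow> 'a \<Rightarrow> real" where
  "partial_deriv b f x = frechet_derivative f (at x) b"

definition laplacian :: "('a::euclidean_space \<Rightarrow> real) \<Rightarrow> 'a \<Rightarrow> real" where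
  "laplacian f x = (\<Sum>b\<in>Basis. partial_deriv b (partial_deriv b f) x)"

text \<open>The next two predicates are meant for open sets \<open>S\<close>.\<close>

definition C1_on :: "'a::euclidean_space set \<Rightarrow> ('a \<Rightarrow> real) \<Rightarrow> bool" where
  "C1_on S f \<longleftrightarrow> (\<forall>x\<in>S. f differentiable (at x)) \<and> (\<forall>b\<in>Basis. continuous_on S (partial_deriv b f))"

definition C2_on :: "'a::euclidean_space set \<Rightarrow> ('a \<Rightarrow> real) \<Rightarrow> bool" where
  "C2_on S f \<longleftrightarrow> C1_on S f \<and> (\<forall>b\<in>Basis. C1_on S (partial_deriv b f))"

text \<open>Classical solutions of \<open>-\<Delta>u = |u|\<^sup>q u\<close> in the unit ball are taken in
  \<open>C\<^sup>2(B) \<inter> C\<^sup>0(cl B)\<close>. The values of \<open>u\<close> outside the closed ball are irrelevant.\<close>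

definition classical_solution :: "real \<Rightarrow> ('a::euclidean_space \<Rightarrow> real) \<Rightarrow> bool" where
  "classical_solution q u \<longleftrightarrow>
     C2_on (ball 0 1) u \<and> continuous_on (cball 0 1) u \<and>
     (\<forall>x\<in>ball 0 1. - laplacian u x = \<bar>u x\<bar> powr q * u x)"

definition radial_profile :: "('a::euclidean_space \<Rightarrow> real) \<Rightarrow> (real \<Rightarrow> real) \<Rightarrow> bool" where
  "radial_profile u U \<longleftrightarrow> (\<forall>x\<in>cball 0 1. u x = U (norm x))"

definition radial :: "('a::euclidean_space \<Rightarrow> real) \<Rightarrow> bool" where
  "radial u \<longleftrightarrow> (\<exists>U. radial_profile u U)"

text \<open>On \<open>{0..1}\<close> the profile of a radial function is unique, so the choice of \<open>U\<close> below does
  not matter; finiteness is stated because \<open>card\<close> of an infinite set is \<open>0\<close>.\<close>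

definition has_interior_zeros :: "('a::euclidean_space \<Rightarrow> real) \<Rightarrow> nat \<Rightarrow> bool" where
  "has_interior_zeros u k \<longleftrightarrow>
     (\<exists>U. radial_profile u U \<and>
          finite {r \<in> {0<..<1}. U r = 0} \<and> card {r \<in> {0<..<1}. U r = 0} = k)"

definition dirichlet_bc :: "('a::euclidean_space \<Rightarrow> real) \<Rightarrow> bool" where
  "dirichlet_bc u \<longleftrightarrow> (\<forall>x\<in>sphere 0 1. u x = 0)"

text \<open>At a boundary point \<open>x\<close> of the unit ball the outer unit normal is \<open>x\<close> itself; since \<open>u\<close>
  lives on the closed ball, the normal derivative is the one-sided derivative from inside.\<close>

definition has_normal_derivative :: "('a::euclidean_space \<Rightarrow> real) \<Rightarrow> real \<Rightarrow> 'a \<Rightarrow> bool" where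
  "has_normal_derivative u d x \<longleftrightarrow>
     ((\<lambda>t. u (x + t *\<^sub>R x)) has_real_derivative d) (at_left 0)"

definition neumann_bc :: "('a::euclidean_space \<Rightarrow> real) \<Rightarrow> bool" where
  "neumann_bc u \<longleftrightarrow> (\<forall>x\<in>sphere 0 1. has_normal_derivative u 0 x)"

definition kappa :: "nat \<Rightarrow> real" where
  "kappa n = (real n - 2) / 4 * ((Gamma (real n / 2))\<^sup>2 / Gamma (real n))"

end

theory Submission
  imports Defs
begin

text \<open>
  With \<open>w = r powr (2 / q) * U\<close> and \<open>z = r w'\<close> (Emden--Fowler variables, \<open>q = 4 / (n - 2) - \<epsilon>\<close>) the radial
  equation becomes an autonomous second-order equation in \<open>log r\<close> with a small anti-damping
  coefficient \<open>c \<sim> \<epsilon> (n - 2)\<^sup>2 / 4\<close>. Its energy \<open>H\<close> starts from \<open>0\<close> at \<open>r = 0\<close> and increases at the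
  rate \<open>c z\<^sup>2\<close>. Writing \<open>z\<^sup>2 = 2 H + w\<^sup>2 (b - 2 |w|\<^sup>q / (q + 2))\<close> and using \<open>w\<close> as the independent variable
  on each monotone piece, one sees that every complete nodal domain raises \<open>H\<close> by
  \<open>2 c G + O(c \<surd>H)\<close>, where \<open>G\<close> is half the area enclosed by the homoclinic orbit of the
  undamped equation, a Beta integral. So no information on the time scales of the bubbles is needed:
  after \<open>k\<close> nodal domains \<open>H = 2 k c G (1 + o(1))\<close>, and this fixes the boundary datum \<open>U'(1)\<close>
  (Dirichlet, \<open>k = m\<close>) or \<open>U(1)\<close> (Neumann, \<open>k = m - 1\<close>). Away from the origin the equation is
  a small perturbation of the Laplace equation and is integrated inwards from \<open>r = 1\<close>.
\<close>

section \<open>The homoclinic area\<close>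

text \<open>The energy starts at \<open>0\<close> and never decreases, so it is nonnegative and the
  orbit stays on or outside the homoclinic loop. Hence every extremum of \<open>w\<close> lies at or
  beyond the peak of the loop, and the lower bound for the gain of a nodal domain carries no error
  term. The upper bound is circular: its error contains the final energy and the supremum of
  \<open>|w|\<close>, which is itself controlled only through the final energy. The estimates are
  arranged so that this dependence is at most linear in \<open>1 + H(1)\<close> and carries a factor
  \<open>c\<close>; for small \<open>c\<close> it can be absorbed. The two exponents come from the
  energy at \<open>r = 1\<close>, where the coefficient of \<open>U(1)^2\<close> is only
  \<open>c / q\<close>. A boundary slope contributes \<open>U'(1)^2 / 2\<close>, a boundary value
  essentially \<open>|U(1)|^(q+2) / (q+2)\<close>. Equating either with an energy of order
  \<epsilon> gives the power \<open>1/2\<close> or \<open>1/(q+2)\<close>, and the latter tends to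
  \<open>(n-2)/(2n)\<close>.\<close>

definition hom_speed :: "real \<Rightarrow> real \<Rightarrow> real \<Rightarrow> real" where
  "hom_speed q b s = s * sqrt (max 0 (b - 2 / (q + 2) * s powr q))"

text \<open>The integrand is \<open>|z|\<close> on the zero level of
  \<open>z^2 / 2 - b * w^2 / 2 + w^(q+2) / (q+2)\<close>, cut off to \<open>0\<close> where that
  level has no point; \<open>hom_peak\<close> is the largest \<open>w\<close> on it.\<close>

definition hom_area :: "real \<Rightarrow> real \<Rightarrow> real \<Rightarrow> real" where
  "hom_area q b s = integral {0..s} (hom_speed q b)"

definition hom_peak :: "real \<Rightarrow> real \<Rightarrow> real" where
  "hom_peak q b = (b * (q + 2) / 2) powr (1 / q)"

lemma hom_speed_nonneg: "0 \<le> s \<Longrightarrow> 0 \<le> hom_speed q b s"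
  by (simp add: hom_speed_def)

lemma continuous_on_hom_speed: "0 < q \<Longrightarrow> continuous_on {0..} (hom_speed q b)"
  unfolding hom_speed_def by (intro continuous_intros continuous_on_powr') auto

lemma hom_speed_eq_0_iff:
  assumes "0 < q" "0 < b" "0 < s"
  shows "hom_speed q b s = 0 \<longleftrightarrow> hom_peak q b \<le> s"
proof -
  have "hom_peak q b \<le> s \<longleftrightarrow> hom_peak q b powr q \<le> s powr q"
    using assms powr_mono2[of q "hom_peak q b" s] powr_less_mono2[of q s "hom_peak q b"]
    by (fastforce simp: hom_peak_def)
  also have "hom_peak q b powr q = b * (q + 2) / 2"
    using assms by (simp add: hom_peak_def powr_powr)
  finally show ?thesis
    using assms by (auto simp: hom_speed_def max_def field_simps)
qed

lemma hom_peak_pos: "0 < q \<Longrightarrow> 0 < b \<Longrightarrow> 0 < hom_peak q b"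
  by (simp add: hom_peak_def)

lemma hom_area_has_real_derivative_within:
  assumes "0 < q" "0 \<le> s" "s \<le> S"
  shows "(hom_area q b has_real_derivative hom_speed q b s) (at s within {0..S})"
  unfolding hom_area_def
  using assms continuous_on_subset[OF continuous_on_hom_speed[of q b], of "{0..S}"]
  by (intro integral_has_real_derivative) auto

lemma hom_area_has_real_derivative:
  assumes "0 < q" "0 < s"
  shows "(hom_area q b has_real_derivative hom_speed q b s) (at s)"
  using hom_area_has_real_derivative_within[of q s "s + 1" b] assms
  by (simp add: at_within_Icc_at)

lemma continuous_on_hom_area:
  assumes "0 < q"
  shows "continuous_on {0..} (hom_area q b)"
proof (rule continuous_on_eq_continuous_within[THEN iffD2], rule ballI)
  fix s :: real assume "s \<in> {0..}"
  then have "continuous (at s within {0..s + 1}) (hom_area q b)"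
    using assms by (intro DERIV_continuous[OF hom_area_has_real_derivative_within]) auto
  moreover have "at s within {0..s + 1} = at s within {0..}"
    using \<open>s \<in> {0..}\<close> by (intro at_within_nhd[of s "{..<s + 1}"]) auto
  ultimately show "continuous (at s within {0..}) (hom_area q b)"
    by simp
qed

lemma hom_area_0 [simp]: "hom_area q b 0 = 0"
  by (simp add: hom_area_def)

text \<open>The cutoff in \<open>hom_speed\<close> makes the area constant past the peak. An
  extremum known only to lie at or beyond the peak therefore contributes exactly the full
  value.\<close>

lemma hom_area_ge_peak:
  assumes "0 < q" "0 < b" "hom_peak q b \<le> s"
  shows "hom_area q b s = hom_area q b (hom_peak q b)"
proof (cases "hom_peak q b = s")
  case False
  then have less: "hom_peak q b < s" using assms by simp
  have "hom_area q b s = hom_area q b (hom_peak q b)"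
    using less hom_peak_pos[OF assms(1,2)]
  proof (intro DERIV_isconst2[of "hom_peak q b" s])
    show "continuous_on {hom_peak q b..s} (hom_area q b)"
      using hom_peak_pos[OF assms(1,2)]
      by (intro continuous_on_subset[OF continuous_on_hom_area[OF assms(1)]]) auto
    fix x assume x: "hom_peak q b < x" "x < s"
    then have "0 < x" using hom_peak_pos[OF assms(1,2)] by simp
    then show "DERIV (hom_area q b) x :> 0"
      using hom_area_has_real_derivative[of q x b] hom_speed_eq_0_iff[of q b x] assms x by simp
  qed auto
  then show ?thesis .
qed simp

lemma hom_area_mono:
  assumes "0 < q" "0 \<le> s" "s \<le> t"
  shows "hom_area q b s \<le> hom_area q b t"
proof (cases "s = t")
  case False
  show ?thesis
  proof (rule DERIV_nonneg_imp_increasing_open[of s t])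
    fix x assume "s < x" "x < t"
    then show "\<exists>y. (hom_area q b has_real_derivative y) (at x) \<and> 0 \<le> y"
      using assms by (intro exI[of _ "hom_speed q b x"] conjI hom_area_has_real_derivative hom_speed_nonneg) auto
  next
    show "continuous_on {s..t} (hom_area q b)"
      using assms by (intro continuous_on_subset[OF continuous_on_hom_area[OF assms(1)]]) auto
  qed (use assms in simp)
qed simp

text \<open>Dropping the power under the root leaves the linear integrand \<open>sqrt b * s\<close>.
  This serves for an incomplete last piece, where a quadratic bound in the end value is
  enough.\<close>

lemma hom_area_le_square:
  assumes "0 < q" "0 \<le> b" "0 \<le> s"
  shows "hom_area q b s \<le> sqrt b * s\<^sup>2 / 2"
proof (cases "s = 0")
  case False
  have "sqrt b * 0\<^sup>2 / 2 - hom_area q b 0 \<le> sqrt b * s\<^sup>2 / 2 - hom_area q b s"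
  proof (rule DERIV_nonneg_imp_increasing_open[where f = "\<lambda>s. sqrt b * s\<^sup>2 / 2 - hom_area q b s"])
    show "continuous_on {0..s} (\<lambda>s. sqrt b * s\<^sup>2 / 2 - hom_area q b s)"
      by (intro continuous_intros continuous_on_subset[OF continuous_on_hom_area[OF assms(1)]]) auto
    fix x assume x: "0 < x" "x < s"
    have "((\<lambda>s. sqrt b * s\<^sup>2 / 2 - hom_area q b s) has_real_derivative sqrt b * x - hom_speed q b x) (at x)"
      by (rule derivative_eq_intros hom_area_has_real_derivative refl assms x | simp)+
    moreover have "hom_speed q b x \<le> sqrt b * x"
      using x assms by (simp add: hom_speed_def)
    ultimately show "\<exists>y. ((\<lambda>s. sqrt b * s\<^sup>2 / 2 - hom_area q b s) has_real_derivative y) (at x) \<and> 0 \<le> y"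
      by (metis diff_ge_0_iff_ge)
  qed (use assms in simp)
  then show ?thesis by simp
qed simp

text \<open>The substitution \<open>s = hom_peak q b * y powr (1 / q)\<close> makes the power linear
  in \<open>y\<close>: the radicand becomes \<open>b * (1 - y)\<close> and the integrand a Beta
  density.\<close>

lemma hom_area_peak_eq_Beta:
  assumes q: "0 < q" and b: "0 < b"
  shows "hom_area q b (hom_peak q b) = (hom_peak q b)\<^sup>2 * sqrt b / q * Beta (2 / q) (3 / 2)"
proof -
  define s where "s = hom_peak q b"
  have s: "0 < s" unfolding s_def by (rule hom_peak_pos[OF q b])
  have s_powr: "s powr q = b * (q + 2) / 2"
    using q b by (simp add: s_def hom_peak_def powr_powr)
  let ?g = "\<lambda>y. s * y powr (1 / q)" and ?g' = "\<lambda>y. s * (1 / q * y powr (1 / q - 1))"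
  have "((\<lambda>y. ?g' y *\<^sub>R hom_speed q b (?g y)) has_integral integral {?g 0..?g 1} (hom_speed q b)) {0..1}"
  \<comment> \<open>\<open>y powr (1 / q)\<close> need not be differentiable at \<open>0\<close>,
    hence the exceptional point.\<close>
  proof (rule has_integral_substitution_strong[where s = "{0}" and c = 0 and d = s])
    show "?g ` {0..1} \<subseteq> {0..s}"
      using s q by (auto intro!: mult_right_le_one_le powr_le1)
    show "continuous_on {0..s} (hom_speed q b)"
      by (rule continuous_on_subset[OF continuous_on_hom_speed[OF q]]) auto
    show "continuous_on {0..1} ?g"
      using q by (intro continuous_intros continuous_on_powr') auto
    show "(?g has_real_derivative ?g' x) (at x within {0..1})" if "x \<in> {0..1} - {0}" for x
      using that by (intro DERIV_cmult has_real_derivative_powr[THEN has_field_derivative_at_within]) auto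
  qed (use s in auto)
  moreover have "?g' y *\<^sub>R hom_speed q b (?g y) = s\<^sup>2 * sqrt b / q * (y powr (2 / q - 1) * (1 - y) powr (3 / 2 - 1))"
    if "y \<in> {0..1}" for y
  \<comment> \<open>At \<open>y = 0\<close> both sides vanish, because \<open>0 powr p = 0\<close>
    for every exponent, negative ones included.\<close>
  proof (cases "y = 0")
    case False
    then have y: "0 < y" "y \<le> 1" using that by auto
    have "(?g y) powr q = b * (q + 2) / 2 * y"
      using s y q by (simp add: powr_mult powr_powr s_powr)
    then have "b - 2 / (q + 2) * (?g y) powr q = b * (1 - y)"
      using q by (simp add: field_simps)
    then have "hom_speed q b (?g y) = ?g y * sqrt (b * (1 - y))"
      using y b by (simp add: hom_speed_def)
    also have "\<dots> = ?g y * (sqrt b * (1 - y) powr (3 / 2 - 1))"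
      using y by (simp add: real_sqrt_mult powr_half_sqrt)
    finally have "?g' y *\<^sub>R hom_speed q b (?g y)
        = s\<^sup>2 * sqrt b / q * ((y powr (1 / q - 1) * y powr (1 / q)) * (1 - y) powr (3 / 2 - 1))"
      by (simp add: power2_eq_square mult_ac)
    also have "y powr (1 / q - 1) * y powr (1 / q) = y powr (2 / q - 1)"
      by (simp flip: powr_add add: algebra_simps)
    finally show ?thesis .
  qed (simp add: powr_0)
  ultimately have "((\<lambda>y. s\<^sup>2 * sqrt b / q * (y powr (2 / q - 1) * (1 - y) powr (3 / 2 - 1)))
      has_integral integral {?g 0..?g 1} (hom_speed q b)) {0..1}"
    by (subst (asm) has_integral_cong)
  moreover have "((\<lambda>y. s\<^sup>2 * sqrt b / q * (y powr (2 / q - 1) * (1 - y) powr (3 / 2 - 1)))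
      has_integral s\<^sup>2 * sqrt b / q * Beta (2 / q) (3 / 2)) {0..1}"
    using q by (intro has_integral_mult_right has_integral_Beta_real) auto
  ultimately have "integral {?g 0..?g 1} (hom_speed q b) = s\<^sup>2 * sqrt b / q * Beta (2 / q) (3 / 2)"
    by (rule has_integral_unique)
  then show ?thesis
    using q by (simp add: hom_area_def s_def)
qed

section \<open>Gamma function evaluation of the area at the critical exponent\<close>

lemma pos_not_nonpos_Int: "0 < y \<Longrightarrow> y \<notin> \<int>\<^sub>\<le>\<^sub>0" for y :: real
  by (auto simp: nonpos_Ints_def)

lemma Gamma_legendre_duplication_real:
  fixes x :: real
  assumes "0 < x"
  shows "Gamma x * Gamma (x + 1 / 2) = 2 powr (1 - 2 * x) * sqrt pi * Gamma (2 * x)"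
proof -
  have notin: "complex_of_real y \<notin> \<int>\<^sub>\<le>\<^sub>0" if "0 < y" for y
    using that by (auto simp: nonpos_Ints_def complex_eq_iff)
  have "complex_of_real (Gamma x * Gamma (x + 1 / 2)) = Gamma (complex_of_real x) * Gamma (complex_of_real x + 1 / 2)"
    using Gamma_complex_of_real[of "x + 1 / 2"] by (simp add: Gamma_complex_of_real)
  also have "\<dots> = exp ((1 - 2 * complex_of_real x) * of_real (ln 2)) * of_real (sqrt pi) * Gamma (2 * complex_of_real x)"
    using notin[of x] notin[of "x + 1 / 2"] assms by (intro Gamma_legendre_duplication) auto
  also have "exp ((1 - 2 * complex_of_real x) * of_real (ln 2)) = of_real (2 powr (1 - 2 * x))"
    by (simp add: powr_def flip: exp_of_real)
  also have "Gamma (2 * complex_of_real x) = of_real (Gamma (2 * x))"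
    using Gamma_complex_of_real[of "2 * x"] by simp
  finally show ?thesis
    by (simp flip: of_real_mult)
qed

text \<open>The source of \<open>kappa n\<close>. With \<open>a = (n - 2) / 2\<close> the critical
  parameters are \<open>q = 2 / a\<close> and \<open>b = a^2\<close>. The duplication formula at
  \<open>a + 1\<close> removes \<open>Gamma (a + 3 / 2)\<close> from the denominator of the Beta
  function and leaves \<open>Gamma (n / 2)^2 / Gamma n\<close>.\<close>

lemma hom_area_critical:
  assumes n: "n \<ge> 3"
  shows "hom_area (4 / (real n - 2)) (((real n - 2) / 2)\<^sup>2) (hom_peak (4 / (real n - 2)) (((real n - 2) / 2)\<^sup>2))
    = (real n * (real n - 2)) powr ((real n - 2) / 2) * kappa n"
proof -
  define a where "a = (real n - 2) / 2"
  have a: "0 < a" using n by (simp add: a_def)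
  have n_eq: "real n = 2 * (a + 1)" by (simp add: a_def field_simps)
  have q: "4 / (real n - 2) = 2 / a" using a by (simp add: a_def field_simps)
  have "Gamma (a + 1) * Gamma (a + 3 / 2) = 2 powr (- 1 - 2 * a) * sqrt pi * Gamma (2 * (a + 1))"
    using Gamma_legendre_duplication_real[of "a + 1"] a by (simp add: algebra_simps)
  moreover have "Gamma (a + 1) > 0" "Gamma (a + 3 / 2) > 0" "Gamma (2 * (a + 1)) > 0"
    using a by (auto intro!: Gamma_real_pos)
  moreover have "Gamma (a + 1) = a * Gamma a"
    by (intro Gamma_plus1 pos_not_nonpos_Int a)
  moreover have "Gamma (3 / 2 :: real) = sqrt pi / 2"
    using Gamma_plus1[OF pos_not_nonpos_Int[of "1 / 2"]] by (simp add: Gamma_one_half_real)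
  ultimately have "a * Beta a (3 / 2) = (Gamma (a + 1))\<^sup>2 / (2 * 2 powr (- 1 - 2 * a) * Gamma (2 * (a + 1)))"
    by (simp add: Beta_def power2_eq_square field_simps)
  also have "2 * 2 powr (- 1 - 2 * a) = 1 / 4 powr a"
    using powr_powr[of 2 2 a] by (simp add: powr_diff powr_minus field_simps)
  finally have B: "a * Beta a (3 / 2) = 4 powr a * (Gamma (a + 1))\<^sup>2 / Gamma (2 * (a + 1))"
    by simp
  have base: "a\<^sup>2 * (2 / a + 2) / 2 = a * (a + 1)"
    using a by (simp add: field_simps power2_eq_square)
  have "(hom_peak (2 / a) (a\<^sup>2))\<^sup>2 = (a * (a + 1)) powr a"
    using a unfolding hom_peak_def base by (simp add: powr_power)
  then have "hom_area (2 / a) (a\<^sup>2) (hom_peak (2 / a) (a\<^sup>2)) = (a * (a + 1)) powr a * a / 2 * (a * Beta a (3 / 2))"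
    using hom_area_peak_eq_Beta[of "2 / a" "a\<^sup>2"] a by simp
  also have "\<dots> = (4 * (a * (a + 1))) powr a * (a / 2 * ((Gamma (a + 1))\<^sup>2 / Gamma (2 * (a + 1))))"
    using a unfolding B by (simp add: powr_mult)
  also have "4 * (a * (a + 1)) = real n * (real n - 2)"
    by (simp add: n_eq algebra_simps)
  also have "a / 2 * ((Gamma (a + 1))\<^sup>2 / Gamma (2 * (a + 1))) = kappa n"
    by (simp add: kappa_def n_eq add_divide_distrib)
  finally show ?thesis
    unfolding q a_def by simp
qed

text \<open>Continuity in the parameters is read off from the Beta form, so no limit has to be
  passed under an integral with a moving end point.\<close>

lemma tendsto_hom_area_peak:
  fixes q b :: "'a \<Rightarrow> real"
  assumes q: "(q \<longlongrightarrow> q0) F" and b: "(b \<longlongrightarrow> b0) F" and "0 < q0" "0 < b0"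
  shows "((\<lambda>x. hom_area (q x) (b x) (hom_peak (q x) (b x))) \<longlongrightarrow> hom_area q0 b0 (hom_peak q0 b0)) F"
proof -
  have "((\<lambda>x. (hom_peak (q x) (b x))\<^sup>2 * sqrt (b x) / q x * Beta (2 / q x) (3 / 2))
     \<longlongrightarrow> (hom_peak q0 b0)\<^sup>2 * sqrt b0 / q0 * Beta (2 / q0) (3 / 2)) F"
    unfolding hom_peak_def Beta_def using assms(3,4)
    by (intro tendsto_intros q b) (auto intro!: pos_not_nonpos_Int simp: add_pos_pos Gamma_eq_zero_iff)
  moreover have "\<forall>\<^sub>F x in F. 0 < q x" "\<forall>\<^sub>F x in F. 0 < b x"
    using order_tendstoD(1)[OF q] order_tendstoD(1)[OF b] assms(3,4) by auto
  then have "\<forall>\<^sub>F x in F. (hom_peak (q x) (b x))\<^sup>2 * sqrt (b x) / q x * Beta (2 / q x) (3 / 2)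
      = hom_area (q x) (b x) (hom_peak (q x) (b x))"
    by eventually_elim (simp add: hom_area_peak_eq_Beta)
  ultimately show ?thesis
    using assms(3,4) by (simp add: hom_area_peak_eq_Beta tendsto_cong)
qed

section \<open>Energy gain over nodal domains\<close>

lemma abs_powr_has_real_derivative:
  fixes x p :: real
  assumes "1 < p"
  shows "((\<lambda>x. \<bar>x\<bar> powr p) has_real_derivative p * (\<bar>x\<bar> powr (p - 2) * x)) (at x)"
proof -
  consider "x > 0" | "x < 0" | "x = 0" by linarith
  then show ?thesis
  proof cases
    case 1
    have "((\<lambda>x. x powr p) has_real_derivative p * (\<bar>x\<bar> powr (p - 2) * x)) (at x)"
      using 1 by (auto intro!: derivative_eq_intros simp: powr_diff field_simps power2_eq_square)
    moreover have "\<forall>\<^sub>F y in nhds x. \<bar>y\<bar> powr p = y powr p"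
      using eventually_nhds_in_open[of "{0<..}" x] 1 by (auto elim!: eventually_mono)
    ultimately show ?thesis
      by (subst DERIV_cong_ev[OF refl _ refl])
  next
    case 2
    have "((\<lambda>x. (- x) powr p) has_real_derivative p * (\<bar>x\<bar> powr (p - 2) * x)) (at x)"
      using 2 by (auto intro!: derivative_eq_intros simp: powr_diff field_simps power2_eq_square)
    moreover have "\<forall>\<^sub>F y in nhds x. \<bar>y\<bar> powr p = (- y) powr p"
      using eventually_nhds_in_open[of "{..<0}" x] 2 by (auto elim!: eventually_mono)
    ultimately show ?thesis
      by (subst DERIV_cong_ev[OF refl _ refl])
  next
    case 3
    \<comment> \<open>The difference quotient at \<open>0\<close> has absolute value
      \<open>|h| powr (p - 1)\<close>, which vanishes in the limit since
      \<open>1 < p\<close>.\<close>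
    have "((\<lambda>h. \<bar>h\<bar> powr (p - 1)) \<longlongrightarrow> \<bar>0\<bar> powr (p - 1)) (at (0::real))"
      using assms by (intro tendsto_powr' tendsto_intros) auto
    then have "((\<lambda>h. \<bar>h\<bar> powr p / h) \<longlongrightarrow> 0) (at (0::real))"
      by (rule Lim_null_comparison[rotated, OF tendsto_eq_rhs])
         (auto simp: eventually_at_filter powr_diff intro!: always_eventually)
    then show ?thesis
      using 3 by (simp add: DERIV_def)
  qed
qed

text \<open>In the variable \<open>t = log r\<close> this reads \<open>dw/dt = z\<close>,
  \<open>dz/dt = c z + b w - |w|^q w\<close>. The values at \<open>r = 0\<close> encode the limit as
  \<open>t\<close> tends to minus infinity: the orbit leaves the saddle at the origin.\<close>

locale emden_system =
  fixes q c b :: real and w z :: "real \<Rightarrow> real"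
  assumes q_pos: "0 < q" and c_pos: "0 < c" and b_pos: "0 < b"
    and w_cont: "continuous_on {0..1} w" and z_cont: "continuous_on {0..1} z"
    and w_0: "w 0 = 0" and z_0: "z 0 = 0"
    and w_deriv: "\<And>r. 0 < r \<Longrightarrow> r < 1 \<Longrightarrow> (w has_real_derivative z r / r) (at r)"
    and z_deriv: "\<And>r. 0 < r \<Longrightarrow> r < 1 \<Longrightarrow>
      (z has_real_derivative (c * z r + b * w r - \<bar>w r\<bar> powr q * w r) / r) (at r)"
begin

definition energy :: "real \<Rightarrow> real" where
  "energy r = (z r)\<^sup>2 / 2 - b / 2 * (w r)\<^sup>2 + \<bar>w r\<bar> powr (q + 2) / (q + 2)"

abbreviation "G \<equiv> hom_area q b"
abbreviation "G_max \<equiv> hom_area q b (hom_peak q b)"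

lemma energy_cont: "continuous_on {0..1} energy"
  unfolding energy_def using q_pos
  by (intro continuous_intros w_cont z_cont continuous_on_powr') auto

lemma energy_deriv:
  assumes "0 < r" "r < 1"
  shows "(energy has_real_derivative c * (z r)\<^sup>2 / r) (at r)"
proof -
  have "((\<lambda>r. \<bar>w r\<bar> powr (q + 2) / (q + 2)) has_real_derivative
      ((q + 2) * (\<bar>w r\<bar> powr (q + 2 - 2) * w r)) * (z r / r) / (q + 2)) (at r)"
    using q_pos by (intro DERIV_cdivide DERIV_chain2[OF abs_powr_has_real_derivative w_deriv] assms) auto
  then have 1: "((\<lambda>r. \<bar>w r\<bar> powr (q + 2) / (q + 2)) has_real_derivative \<bar>w r\<bar> powr q * w r * (z r / r)) (at r)"
    using q_pos by (simp add: mult.assoc)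
  have "(energy has_real_derivative
      (2 * z r * ((c * z r + b * w r - \<bar>w r\<bar> powr q * w r) / r)) / 2 - b / 2 * (2 * w r * (z r / r))
       + \<bar>w r\<bar> powr q * w r * (z r / r)) (at r)"
    unfolding energy_def
    by (intro DERIV_add DERIV_diff DERIV_cdivide DERIV_cmult 1
          DERIV_cong[OF DERIV_power[OF w_deriv]] DERIV_cong[OF DERIV_power[OF z_deriv]] assms) auto
  moreover have "(2 * z r * ((c * z r + b * w r - \<bar>w r\<bar> powr q * w r) / r)) / 2 - b / 2 * (2 * w r * (z r / r))
       + \<bar>w r\<bar> powr q * w r * (z r / r) = c * (z r)\<^sup>2 / r"
    using assms by (simp add: field_simps power2_eq_square)
  ultimately show ?thesis by simp
qed

lemma energy_mono:
  assumes "0 \<le> x" "x \<le> y" "y \<le> 1"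
  shows "energy x \<le> energy y"
proof (cases "x = y")
  case False
  show ?thesis
  proof (rule DERIV_nonneg_imp_increasing_open[of x y])
    fix r assume "x < r" "r < y"
    then show "\<exists>d. (energy has_real_derivative d) (at r) \<and> 0 \<le> d"
      using energy_deriv[of r] assms c_pos by (auto intro!: exI[of _ "c * (z r)\<^sup>2 / r"])
  qed (use assms False in \<open>auto intro: continuous_on_subset[OF energy_cont]\<close>)
qed simp

lemma energy_0: "energy 0 = 0"
  by (simp add: energy_def w_0 z_0)

lemma energy_nonneg: "0 \<le> x \<Longrightarrow> x \<le> 1 \<Longrightarrow> 0 \<le> energy x"
  using energy_mono[of 0 x] by (simp add: energy_0)

lemma energy_eq_speed:
  assumes "0 \<le> w r"
  shows "(z r)\<^sup>2 = 2 * energy r + (w r)\<^sup>2 * (b - 2 / (q + 2) * w r powr q)"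
proof -
  have "\<bar>w r\<bar> powr (q + 2) = w r powr q * (w r)\<^sup>2"
    using assms q_pos by (cases "w r = 0") (auto simp: powr_add)
  then show ?thesis
    by (simp add: energy_def algebra_simps)
qed

text \<open>Where the radicand is nonnegative, \<open>z^2\<close> exceeds the square of the
  homoclinic speed by \<open>2 * energy r\<close>, which lies between \<open>0\<close> and
  \<open>2 * energy 1\<close>. Where it is negative, the cut-off speed is \<open>0\<close> and
  \<open>z^2\<close> is below \<open>2 * energy 1\<close>.\<close>

lemma speed_bounds:
  assumes "0 \<le> r" "r \<le> 1" "0 \<le> w r"
  shows "hom_speed q b (w r) \<le> \<bar>z r\<bar>" "\<bar>z r\<bar> \<le> hom_speed q b (w r) + sqrt (2 * energy 1)"
proof -
  define h where "h = hom_speed q b (w r)"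
  have h: "h \<ge> 0" "h\<^sup>2 = max 0 ((w r)\<^sup>2 * (b - 2 / (q + 2) * w r powr q))"
    using assms(3) by (auto simp: h_def hom_speed_def power_mult_distrib max_def mult_le_0_iff zero_le_mult_iff)
  have e: "0 \<le> energy r" "energy r \<le> energy 1"
    using energy_nonneg energy_mono assms by auto
  have "h\<^sup>2 \<le> \<bar>z r\<bar>\<^sup>2"
    using energy_eq_speed[OF assms(3)] e h by (metis add_increasing max.bounded_iff mult_nonneg_nonneg power2_abs zero_le_numeral zero_le_power2 order_refl)
  then show "hom_speed q b (w r) \<le> \<bar>z r\<bar>"
    unfolding h_def by (rule power2_le_imp_le) simp
  have "\<bar>z r\<bar>\<^sup>2 \<le> 2 * energy 1 + h\<^sup>2"
    using energy_eq_speed[OF assms(3)] e h by simp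
  also have "\<dots> \<le> (h + sqrt (2 * energy 1))\<^sup>2"
    using h e by (simp add: power2_sum)
  finally show "\<bar>z r\<bar> \<le> hom_speed q b (w r) + sqrt (2 * energy 1)"
    unfolding h_def[symmetric] by (rule power2_le_imp_le) (use h(1) e in simp)
qed

text \<open>Nonnegative energy puts a critical point at or beyond the peak, where
  \<open>w r powr q\<close> is at least \<open>b * (q + 2) / 2\<close>. This exceeds
  \<open>b\<close>, so the nonlinear term outweighs the linear one. Inside the loop, where the
  energy is negative, minima of a positive \<open>w\<close> would be possible.\<close>

lemma z_deriv_neg_at_critical:
  assumes "0 < r" "r < 1" "z r = 0" "0 < w r"
  obtains d where "(z has_real_derivative d) (at r)" "d < 0"
proof
  show "(z has_real_derivative (c * z r + b * w r - \<bar>w r\<bar> powr q * w r) / r) (at r)"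
    by (rule z_deriv) (use assms in auto)
  have "0 \<le> (w r)\<^sup>2 * (2 / (q + 2) * w r powr q - b)"
    using energy_eq_speed[of r] energy_nonneg[of r] assms by (simp add: algebra_simps)
  then have "b \<le> 2 / (q + 2) * w r powr q"
    using assms by (simp add: zero_le_mult_iff)
  then have "b + b * q / 2 \<le> w r powr q"
    using q_pos by (simp add: field_simps)
  moreover have "0 < b * q / 2"
    using q_pos b_pos by simp
  ultimately have "b < w r powr q"
    by linarith
  then show "(c * z r + b * w r - \<bar>w r\<bar> powr q * w r) / r < 0"
    using assms by (intro divide_neg_pos) auto
qed

text \<open>Critical points of a positive \<open>w\<close> are strict maxima, so \<open>w\<close> cannot turn upwards again.\<close>

lemma z_stays_nonpos:
  assumes "0 < x" "x < y" "y < 1" "\<And>r. r \<in> {x..y} \<Longrightarrow> 0 < w r" "z x < 0"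
  shows "z y \<le> 0"
proof (rule ccontr)
  assume "\<not> z y \<le> 0"
  then have zy: "z y > 0" by simp
  have cont: "continuous_on {x..y} w"
    using assms by (intro continuous_on_subset[OF w_cont]) auto
  \<comment> \<open>\<open>w\<close> falls at \<open>x\<close> and rises at \<open>y\<close>, so its
    minimum over \<open>{x..y}\<close> is an interior critical point, at which \<open>w\<close>
    would have to decrease afterwards.\<close>
  obtain p where p: "p \<in> {x..y}" and min: "\<And>r. r \<in> {x..y} \<Longrightarrow> w p \<le> w r"
    using continuous_attains_inf[OF _ _ cont] assms by auto
  have "p \<noteq> x"
  proof
    assume "p = x"
    obtain d where d: "0 < d" "\<And>h. 0 < h \<Longrightarrow> h < d \<Longrightarrow> w (x + h) < w x"
      using DERIV_neg_dec_right[OF w_deriv[of x]] assms by (auto simp: divide_neg_pos)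
    then have "w (x + min (d / 2) (y - x)) < w x"
      using assms by (intro d) auto
    moreover have "w p \<le> w (x + min (d / 2) (y - x))"
      using assms d by (intro min) auto
    ultimately show False using \<open>p = x\<close> by simp
  qed
  have "p \<noteq> y"
  proof
    assume "p = y"
    obtain d where d: "0 < d" "\<And>h. 0 < h \<Longrightarrow> h < d \<Longrightarrow> w (y - h) < w y"
      using DERIV_pos_inc_left[OF w_deriv[of y]] assms zy by auto
    then have "w (y - min (d / 2) (y - x)) < w y"
      using assms by (intro d) auto
    moreover have "w p \<le> w (y - min (d / 2) (y - x))"
      using assms d by (intro min) auto
    ultimately show False using \<open>p = y\<close> by simp
  qed
  with \<open>p \<noteq> x\<close> p have p': "x < p" "p < y" by auto
  then have p01: "0 < p" "p < 1" using assms by auto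
  have "z p / p = 0"
    by (rule DERIV_local_min[OF w_deriv[OF p01], of "min (p - x) (y - p)"])
       (use p' in \<open>auto intro!: min\<close>)
  then have "z p = 0" using p01 by simp
  then obtain d where d: "(z has_real_derivative d) (at p)" "d < 0"
    using z_deriv_neg_at_critical[OF p01] assms(4) p by auto
  then obtain e where e: "0 < e" "\<And>h. 0 < h \<Longrightarrow> h < e \<Longrightarrow> z (p + h) < z p"
    using DERIV_neg_dec_right by metis
  define t where "t = p + min (e / 2) (y - p)"
  have t: "p < t" "t < p + e" "t \<le> y" using e p' by (auto simp: t_def)
  have "w t < w p"
  proof (rule DERIV_neg_imp_decreasing_open[OF t(1)])
    fix s assume s: "p < s" "s < t"
    then have "z s < 0" using e(2)[of "s - p"] t \<open>z p = 0\<close> by simp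
    then show "\<exists>d. (w has_real_derivative d) (at s) \<and> d < 0"
      using s t p01 assms by (intro exI[of _ "z s / s"]) (auto intro!: w_deriv divide_neg_pos)
    next
    show "continuous_on {p..t} w"
      using p' t by (intro continuous_on_subset[OF cont]) auto
  qed
  moreover have "w p \<le> w t" using t p' by (intro min) auto
  ultimately show False by simp
qed

text \<open>At an interior maximum \<open>z\<close> passes strictly from positive to negative. A
  negative \<open>z\<close> earlier on would contradict \<open>z_stays_nonpos\<close> at a point
  just before \<open>\<mu>\<close>; started just after \<open>\<mu>\<close>, the same lemma keeps
  \<open>z\<close> nonpositive.\<close>

lemma unimodal:
  assumes "0 \<le> \<alpha>" "\<alpha> < \<rho>" "\<rho> \<le> 1" "w \<alpha> = 0" "w \<rho> = 0" "\<And>r. r \<in> {\<alpha><..<\<rho>} \<Longrightarrow> 0 < w r"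
  obtains \<mu> where "\<mu> \<in> {\<alpha><..<\<rho>}" "z \<mu> = 0"
    "\<And>r. r \<in> {\<alpha><..<\<mu>} \<Longrightarrow> 0 \<le> z r" "\<And>r. r \<in> {\<mu><..<\<rho>} \<Longrightarrow> z r \<le> 0"
proof -
  have cont: "continuous_on {\<alpha>..\<rho>} w"
    using assms by (intro continuous_on_subset[OF w_cont]) auto
  obtain \<mu> where \<mu>: "\<mu> \<in> {\<alpha>..\<rho>}" and max: "\<And>r. r \<in> {\<alpha>..\<rho>} \<Longrightarrow> w r \<le> w \<mu>"
    using continuous_attains_sup[OF _ _ cont] assms by auto
  have "0 < w \<mu>"
    using max[of "(\<alpha> + \<rho>) / 2"] assms(6)[of "(\<alpha> + \<rho>) / 2"] assms(2) by (simp add: field_simps)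
  then have \<mu>': "\<alpha> < \<mu>" "\<mu> < \<rho>"
    using \<mu> assms by (auto simp: less_le)
  then have \<mu>01: "0 < \<mu>" "\<mu> < 1" using assms by auto
  have "z \<mu> / \<mu> = 0"
    by (rule DERIV_local_max[OF w_deriv[OF \<mu>01], of "min (\<mu> - \<alpha>) (\<rho> - \<mu>)"])
       (use \<mu>' in \<open>auto intro!: max\<close>)
  then have "z \<mu> = 0" using \<mu>01 by simp
  then obtain d where d: "(z has_real_derivative d) (at \<mu>)" "d < 0"
    using z_deriv_neg_at_critical[OF \<mu>01] \<open>0 < w \<mu>\<close> by auto
  obtain e where e: "0 < e" "\<And>h. 0 < h \<Longrightarrow> h < e \<Longrightarrow> z (\<mu> + h) < z \<mu>"
    using DERIV_neg_dec_right[OF d] by metis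
  obtain e' where e': "0 < e'" "\<And>h. 0 < h \<Longrightarrow> h < e' \<Longrightarrow> z (\<mu> - h) > z \<mu>"
    using DERIV_neg_dec_left[OF d] by metis
  show thesis
  proof
    show "\<mu> \<in> {\<alpha><..<\<rho>}" "z \<mu> = 0" using \<mu>' \<open>z \<mu> = 0\<close> by auto
    show "0 \<le> z r" if r: "r \<in> {\<alpha><..<\<mu>}" for r
    proof (rule ccontr)
      define y where "y = \<mu> - min (e' / 2) ((\<mu> - r) / 2)"
      assume "\<not> 0 \<le> z r"
      moreover have "z y > 0"
        unfolding y_def using e'(2)[of "min (e' / 2) ((\<mu> - r) / 2)"] e'(1) r \<open>z \<mu> = 0\<close> by auto
      moreover have "r < y" "y < \<mu>" using r e' by (auto simp: y_def min_def field_simps)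
      ultimately show False
        using z_stays_nonpos[of r y] r \<mu>' assms by fastforce
    qed
    show "z r \<le> 0" if r: "r \<in> {\<mu><..<\<rho>}" for r
    proof -
      define y where "y = \<mu> + min (e / 2) ((r - \<mu>) / 2)"
      have "z y < 0"
        unfolding y_def using e(2)[of "min (e / 2) ((r - \<mu>) / 2)"] e(1) r \<open>z \<mu> = 0\<close> by auto
      moreover have "\<mu> < y" "y < r" using r e by (auto simp: y_def min_def field_simps)
      ultimately show "z r \<le> 0"
        using z_stays_nonpos[of y r] r \<mu>' assms by fastforce
    qed
  qed
qed

text \<open>Per unit of variation of \<open>w\<close> the energy grows by \<open>c * |z|\<close> and
  \<open>G (w r)\<close> varies by the homoclinic speed; \<open>speed_bounds\<close> compares the
  two. Both estimates follow from the sign of the derivative of a difference, so \<open>w\<close> is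
  never inverted. The sign \<open>s\<close> treats rising and falling pieces at once.\<close>

lemma energy_piece:
  assumes "0 \<le> \<alpha>" "\<alpha> < \<mu>" "\<mu> \<le> 1" and s: "s \<in> {-1, 1}"
    and pos: "\<And>r. r \<in> {\<alpha><..<\<mu>} \<Longrightarrow> 0 < w r" and z: "\<And>r. r \<in> {\<alpha><..<\<mu>} \<Longrightarrow> 0 \<le> s * z r"
    and ends: "0 \<le> w \<alpha>" "0 \<le> w \<mu>"
  shows "c * (s * (G (w \<mu>) - G (w \<alpha>))) \<le> energy \<mu> - energy \<alpha>"
    and "energy \<mu> - energy \<alpha> \<le> c * (s * (G (w \<mu>) - G (w \<alpha>))) + c * (sqrt (2 * energy 1) * (s * (w \<mu> - w \<alpha>)))"
proof -
  have nonneg: "0 \<le> w r" if "r \<in> {\<alpha>..\<mu>}" for r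
    using pos[of r] ends that by (cases "r = \<alpha> \<or> r = \<mu>") auto
  have contw: "continuous_on {\<alpha>..\<mu>} w"
    using assms by (intro continuous_on_subset[OF w_cont]) auto
  have conte: "continuous_on {\<alpha>..\<mu>} energy"
    using assms by (intro continuous_on_subset[OF energy_cont]) auto
  have contG: "continuous_on {\<alpha>..\<mu>} (\<lambda>r. G (w r))"
    using nonneg by (intro continuous_on_compose2[OF continuous_on_hom_area[OF q_pos] contw]) auto
  have dG: "((\<lambda>r. G (w r)) has_real_derivative hom_speed q b (w r) * (z r / r)) (at r)"
    if "\<alpha> < r" "r < \<mu>" for r
    using that assms by (intro DERIV_chain2[OF hom_area_has_real_derivative w_deriv] q_pos pos) auto
  have ss: "s * s = 1"
    using s by auto
  have sz: "\<bar>z r\<bar> = s * z r" if "\<alpha> < r" "r < \<mu>" for r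
    using z[of r] s that by auto
  have "energy \<alpha> - c * (s * G (w \<alpha>)) \<le> energy \<mu> - c * (s * G (w \<mu>))"
  proof (rule DERIV_nonneg_imp_increasing_open[where f = "\<lambda>r. energy r - c * (s * G (w r))"])
    show "continuous_on {\<alpha>..\<mu>} (\<lambda>r. energy r - c * (s * G (w r)))"
      by (intro continuous_intros conte contG)
    fix r assume r: "\<alpha> < r" "r < \<mu>"
    then have "((\<lambda>r. energy r - c * (s * G (w r))) has_real_derivative
        c * (z r)\<^sup>2 / r - c * (s * (hom_speed q b (w r) * (z r / r)))) (at r)"
      using assms by (intro DERIV_diff DERIV_cmult energy_deriv dG) auto
    moreover have "c * (z r)\<^sup>2 / r - c * (s * (hom_speed q b (w r) * (z r / r)))
        = c / r * (\<bar>z r\<bar> * (\<bar>z r\<bar> - hom_speed q b (w r)))"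
      using ss unfolding sz[OF r] divide_inverse power2_eq_square by algebra
    moreover have "0 \<le> c / r * (\<bar>z r\<bar> * (\<bar>z r\<bar> - hom_speed q b (w r)))"
      using speed_bounds(1)[of r] nonneg[of r] r assms c_pos by auto
    ultimately show "\<exists>y. ((\<lambda>r. energy r - c * (s * G (w r))) has_real_derivative y) (at r) \<and> 0 \<le> y"
      by auto
  qed (use assms in auto)
  then show "c * (s * (G (w \<mu>) - G (w \<alpha>))) \<le> energy \<mu> - energy \<alpha>"
    by (simp add: algebra_simps)
  let ?E = "sqrt (2 * energy 1)"
  have "c * (s * G (w \<alpha>)) + c * (?E * (s * w \<alpha>)) - energy \<alpha> \<le> c * (s * G (w \<mu>)) + c * (?E * (s * w \<mu>)) - energy \<mu>"
  proof (rule DERIV_nonneg_imp_increasing_open[where f = "\<lambda>r. c * (s * G (w r)) + c * (?E * (s * w r)) - energy r"])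
    show "continuous_on {\<alpha>..\<mu>} (\<lambda>r. c * (s * G (w r)) + c * (?E * (s * w r)) - energy r)"
      by (intro continuous_intros conte contG contw)
    fix r assume r: "\<alpha> < r" "r < \<mu>"
    then have "((\<lambda>r. c * (s * G (w r)) + c * (?E * (s * w r)) - energy r) has_real_derivative
        c * (s * (hom_speed q b (w r) * (z r / r))) + c * (?E * (s * (z r / r))) - c * (z r)\<^sup>2 / r) (at r)"
      using assms by (intro DERIV_diff DERIV_add DERIV_cmult energy_deriv dG w_deriv) auto
    moreover have "c * (s * (hom_speed q b (w r) * (z r / r))) + c * (?E * (s * (z r / r))) - c * (z r)\<^sup>2 / r
        = c / r * (\<bar>z r\<bar> * (hom_speed q b (w r) + ?E - \<bar>z r\<bar>))"
      using ss unfolding sz[OF r] divide_inverse power2_eq_square by algebra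
    moreover have "0 \<le> c / r * (\<bar>z r\<bar> * (hom_speed q b (w r) + ?E - \<bar>z r\<bar>))"
      using speed_bounds(2)[of r] nonneg[of r] r assms c_pos by auto
    ultimately show "\<exists>y. ((\<lambda>r. c * (s * G (w r)) + c * (?E * (s * w r)) - energy r) has_real_derivative y) (at r) \<and> 0 \<le> y"
      by auto
  qed (use assms in auto)
  then show "energy \<mu> - energy \<alpha> \<le> c * (s * (G (w \<mu>) - G (w \<alpha>))) + c * (?E * (s * (w \<mu> - w \<alpha>)))"
    by (simp add: algebra_simps)
qed

text \<open>At the turning point \<open>z = 0\<close> forces the homoclinic speed to vanish, so
  \<open>w\<close> has reached the peak and each of the two halves contributes exactly
  \<open>G_max\<close>, however high the bubble is.\<close>

lemma energy_nodal_pos: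
  assumes "0 \<le> \<alpha>" "\<alpha> < \<rho>" "\<rho> \<le> 1" "w \<alpha> = 0" "w \<rho> = 0" "\<And>r. r \<in> {\<alpha><..<\<rho>} \<Longrightarrow> 0 < w r"
    and M: "\<And>r. r \<in> {0..1} \<Longrightarrow> \<bar>w r\<bar> \<le> M"
  shows "2 * c * G_max \<le> energy \<rho> - energy \<alpha>"
    and "energy \<rho> - energy \<alpha> \<le> 2 * c * (G_max + sqrt (2 * energy 1) * M)"
proof -
  obtain \<mu> where \<mu>: "\<mu> \<in> {\<alpha><..<\<rho>}" "z \<mu> = 0"
    "\<And>r. r \<in> {\<alpha><..<\<mu>} \<Longrightarrow> 0 \<le> z r" "\<And>r. r \<in> {\<mu><..<\<rho>} \<Longrightarrow> z r \<le> 0"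
    using unimodal[OF assms(1-6)] by blast
  have w\<mu>: "0 < w \<mu>" using \<mu> assms by auto
  have "hom_speed q b (w \<mu>) = 0"
    using speed_bounds(1)[of \<mu>] hom_speed_nonneg[of "w \<mu>" q b] w\<mu> \<mu> assms by auto
  then have G: "G (w \<mu>) = G_max"
    by (intro hom_area_ge_peak q_pos b_pos) (simp add: hom_speed_eq_0_iff[OF q_pos b_pos w\<mu>])
  have up: "c * (G (w \<mu>) - G (w \<alpha>)) \<le> energy \<mu> - energy \<alpha>"
    "energy \<mu> - energy \<alpha> \<le> c * (G (w \<mu>) - G (w \<alpha>)) + c * (sqrt (2 * energy 1) * (w \<mu> - w \<alpha>))"
    using energy_piece[of \<alpha> \<mu> 1] assms \<mu> w\<mu> by auto
  have down: "c * (G (w \<mu>) - G (w \<rho>)) \<le> energy \<rho> - energy \<mu>"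
    "energy \<rho> - energy \<mu> \<le> c * (G (w \<mu>) - G (w \<rho>)) + c * (sqrt (2 * energy 1) * (w \<mu> - w \<rho>))"
    using energy_piece[of \<mu> \<rho> "-1"] assms \<mu> w\<mu> by auto
  show "2 * c * G_max \<le> energy \<rho> - energy \<alpha>"
    using up(1) down(1) assms(4,5) G by (simp add: algebra_simps)
  have "c * (sqrt (2 * energy 1) * w \<mu>) \<le> c * (sqrt (2 * energy 1) * M)"
    using M[of \<mu>] \<mu> assms w\<mu> c_pos energy_nonneg[of 1] by (intro mult_left_mono) auto
  then show "energy \<rho> - energy \<alpha> \<le> 2 * c * (G_max + sqrt (2 * energy 1) * M)"
    using up(2) down(2) assms(4,5) G by (simp add: algebra_simps)
qed

section \<open>Odd symmetry and the counting of nodal domains\<close>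

lemma emden_system_uminus: "emden_system q c b (\<lambda>r. - w r) (\<lambda>r. - z r)"
proof
  fix r :: real assume r: "0 < r" "r < 1"
  show "((\<lambda>r. - w r) has_real_derivative - z r / r) (at r)"
    using DERIV_minus[OF w_deriv[OF r]] by simp
  have e: "(c * - z r + b * - w r - \<bar>- w r\<bar> powr q * - w r) / r = - ((c * z r + b * w r - \<bar>w r\<bar> powr q * w r) / r)"
    by (simp add: diff_divide_distrib add_divide_distrib)
  show "((\<lambda>r. - z r) has_real_derivative (c * - z r + b * - w r - \<bar>- w r\<bar> powr q * - w r) / r) (at r)"
    unfolding e by (rule DERIV_minus[OF z_deriv[OF r]])
qed (auto intro!: q_pos c_pos b_pos continuous_intros w_cont z_cont simp: w_0 z_0)

lemma energy_uminus: "emden_system.energy q b (\<lambda>r. - w r) (\<lambda>r. - z r) = energy"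
  by (intro ext, subst emden_system.energy_def[OF emden_system_uminus]) (simp add: energy_def)

lemma constant_sign:
  assumes "0 \<le> \<alpha>" "\<rho> \<le> 1" "\<And>r. r \<in> {\<alpha><..<\<rho>} \<Longrightarrow> w r \<noteq> 0"
  shows "(\<forall>r\<in>{\<alpha><..<\<rho>}. 0 < w r) \<or> (\<forall>r\<in>{\<alpha><..<\<rho>}. w r < 0)"
proof (rule ccontr)
  assume "\<not> ?thesis"
  then obtain x y where xy: "x \<in> {\<alpha><..<\<rho>}" "y \<in> {\<alpha><..<\<rho>}" "w x \<le> 0" "0 \<le> w y"
    by (auto simp: not_less)
  have "connected (w ` {\<alpha><..<\<rho>})"
    using assms by (intro connected_continuous_image continuous_on_subset[OF w_cont]) auto
  then have "0 \<in> w ` {\<alpha><..<\<rho>}"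
    using xy by (auto simp: connected_iff_interval)
  with assms(3) show False by auto
qed

lemma energy_nodal:
  assumes "0 \<le> \<alpha>" "\<alpha> < \<rho>" "\<rho> \<le> 1" "w \<alpha> = 0" "w \<rho> = 0" "\<And>r. r \<in> {\<alpha><..<\<rho>} \<Longrightarrow> w r \<noteq> 0"
    and M: "\<And>r. r \<in> {0..1} \<Longrightarrow> \<bar>w r\<bar> \<le> M"
  shows "2 * c * G_max \<le> energy \<rho> - energy \<alpha>"
    and "energy \<rho> - energy \<alpha> \<le> 2 * c * (G_max + sqrt (2 * energy 1) * M)"
proof -
  interpret neg: emden_system q c b "\<lambda>r. - w r" "\<lambda>r. - z r"
    by (rule emden_system_uminus)
  have "2 * c * G_max \<le> energy \<rho> - energy \<alpha> \<and> energy \<rho> - energy \<alpha> \<le> 2 * c * (G_max + sqrt (2 * energy 1) * M)"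
    using constant_sign[OF assms(1,3,6)]
  proof
    assume "\<forall>r\<in>{\<alpha><..<\<rho>}. 0 < w r"
    then show ?thesis using energy_nodal_pos[of \<alpha> \<rho> M] assms by auto
  next
    assume "\<forall>r\<in>{\<alpha><..<\<rho>}. w r < 0"
    then show ?thesis using neg.energy_nodal_pos[of \<alpha> \<rho> M] assms unfolding energy_uminus by auto
  qed
  then show "2 * c * G_max \<le> energy \<rho> - energy \<alpha>"
    and "energy \<rho> - energy \<alpha> \<le> 2 * c * (G_max + sqrt (2 * energy 1) * M)"
    by auto
qed

text \<open>The induction splits off the last zero before \<open>t\<close>. As \<open>0\<close> and
  \<open>t\<close> are zeros too, \<open>k\<close> zeros in between bound \<open>k + 1\<close> nodal
  domains.\<close>

lemma energy_at_zero:
  assumes M: "\<And>r. r \<in> {0..1} \<Longrightarrow> \<bar>w r\<bar> \<le> M"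
    and "0 < t" "t \<le> 1" "w t = 0" "finite {r \<in> {0<..<t}. w r = 0}" "card {r \<in> {0<..<t}. w r = 0} = k"
  shows "2 * (real k + 1) * c * G_max \<le> energy t
    \<and> energy t \<le> 2 * (real k + 1) * c * (G_max + sqrt (2 * energy 1) * M)"
  using assms(2-)
proof (induction k arbitrary: t)
  case 0
  then have "{r \<in> {0<..<t}. w r = 0} = {}" by simp
  then have "w r \<noteq> 0" if "r \<in> {0<..<t}" for r
    using that by blast
  from energy_nodal[of 0 t M, OF _ _ _ _ _ this M] show ?case
    using "0.prems"(1-3) w_0 energy_0 by simp
next
  case (Suc k)
  let ?Z = "{r \<in> {0<..<t}. w r = 0}"
  define s where "s = Max ?Z"
  have ne: "?Z \<noteq> {}" using Suc.prems by (metis card.empty nat.distinct(1))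
  have s: "s \<in> ?Z" unfolding s_def by (rule Max_in[OF Suc.prems(4) ne])
  have s_max: "r \<le> s" if "r \<in> ?Z" for r
    unfolding s_def by (rule Max_ge[OF Suc.prems(4) that])
  have Z: "{r \<in> {0<..<s}. w r = 0} = ?Z - {s}"
  proof (intro equalityI subsetI)
    fix r assume r: "r \<in> ?Z - {s}"
    then have "r \<in> ?Z" by blast
    from s_max[OF this] r show "r \<in> {r \<in> {0<..<s}. w r = 0}" by simp
  qed (use s in auto)
  have card: "card (?Z - {s}) = k"
    using card_Diff_singleton[OF s] Suc.prems(5) by simp
  have IH: "2 * (real k + 1) * c * G_max \<le> energy s
    \<and> energy s \<le> 2 * (real k + 1) * c * (G_max + sqrt (2 * energy 1) * M)"
  proof (rule Suc.IH)
    show "finite {r \<in> {0<..<s}. w r = 0}"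
      unfolding Z by (rule finite_Diff[OF Suc.prems(4)])
    show "card {r \<in> {0<..<s}. w r = 0} = k"
      unfolding Z by (rule card)
  qed (use s Suc.prems(2) in simp_all)
  have "w r \<noteq> 0" if "r \<in> {s<..<t}" for r
    using s_max[of r] that s by fastforce
  then have "2 * c * G_max \<le> energy t - energy s"
    "energy t - energy s \<le> 2 * c * (G_max + sqrt (2 * energy 1) * M)"
    using energy_nodal[of s t M, OF _ _ _ _ _ _ M] s Suc.prems(2,3) by simp_all
  then show ?case
    using IH by (simp add: algebra_simps)
qed

text \<open>\<open>N\<close> stands for the number of complete nodal domains. The upper bound is
  kept for every bound \<open>M\<close> of \<open>|w|\<close>, because a usable \<open>M\<close> is
  found only later and from the energy itself. The last summand pays for an incomplete final domain;
  it vanishes when \<open>w 1 = 0\<close>.\<close>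

definition energy_count :: "nat \<Rightarrow> bool" where
  "energy_count N \<longleftrightarrow> 2 * real N * c * G_max \<le> energy 1 \<and>
     (\<forall>M. (\<forall>r\<in>{0..1}. \<bar>w r\<bar> \<le> M) \<longrightarrow>
        energy 1 \<le> 2 * real N * c * (G_max + sqrt (2 * energy 1) * M)
          + c * (sqrt b * (w 1)\<^sup>2 / 2 + sqrt (2 * energy 1) * \<bar>w 1\<bar>))"

lemma energy_count_dirichlet:
  assumes "w 1 = 0" "finite {r \<in> {0<..<1}. w r = 0}" "card {r \<in> {0<..<1}. w r = 0} = k"
  shows "energy_count (Suc k)"
  unfolding energy_count_def
proof (intro conjI allI impI)
  have "continuous_on {0..1} (\<lambda>r. \<bar>w r\<bar>)" by (intro continuous_intros w_cont)
  then obtain M where "\<forall>r\<in>{0..1}. \<bar>w r\<bar> \<le> M"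
    using continuous_attains_sup[of "{0..1::real}" "\<lambda>r. \<bar>w r\<bar>"] by auto
  then show "2 * real (Suc k) * c * G_max \<le> energy 1"
    using energy_at_zero[of M 1 k] assms by (simp add: algebra_simps)
  fix M assume "\<forall>r\<in>{0..1}. \<bar>w r\<bar> \<le> M"
  then show "energy 1 \<le> 2 * real (Suc k) * c * (G_max + sqrt (2 * energy 1) * M)
          + c * (sqrt b * (w 1)\<^sup>2 / 2 + sqrt (2 * energy 1) * \<bar>w 1\<bar>)"
    using energy_at_zero[of M 1 k] assms by (simp add: algebra_simps)
qed

text \<open>A positive \<open>w\<close> that has started to fall cannot rise again, so
  \<open>z 1 > 0\<close> means that \<open>w\<close> has been rising since its last zero. Only one
  rising piece contributes, and its area is at most quadratic in \<open>w 1\<close>.\<close>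

lemma energy_last_piece_pos:
  assumes "0 \<le> \<alpha>" "\<alpha> < 1" "w \<alpha> = 0" and pos: "\<And>r. r \<in> {\<alpha><..1} \<Longrightarrow> 0 < w r" and z1: "0 < z 1"
  shows "energy 1 - energy \<alpha> \<le> c * (sqrt b * (w 1)\<^sup>2 / 2 + sqrt (2 * energy 1) * w 1)"
proof -
  have z: "0 \<le> z x" if x: "x \<in> {\<alpha><..<1}" for x
  proof (rule ccontr)
    assume "\<not> 0 \<le> z x"
    \<comment> \<open>\<open>z_stays_nonpos\<close> wants an end point below \<open>1\<close>, where
      the equations hold, so the sign of \<open>z 1\<close> is first moved to the left by
      continuity.\<close>
    have "continuous (at 1 within {0..1}) z"
      using z_cont by (simp add: continuous_on_eq_continuous_within)
    then have "(z \<longlongrightarrow> z 1) (at_left 1)"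
      by (simp add: continuous_within at_within_Icc_at_left)
    then have "\<forall>\<^sub>F y in at_left 1. 0 < z y"
      using z1 by (rule order_tendstoD)
    moreover have "\<forall>\<^sub>F y in at_left 1. y \<in> {x<..<1}"
      using x by (intro eventually_at_left_real) auto
    ultimately have "\<forall>\<^sub>F y in at_left 1. 0 < z y \<and> y \<in> {x<..<1}"
      by eventually_elim simp
    then obtain y where "0 < z y" "y \<in> {x<..<1}"
      using eventually_happens'[of "at_left (1::real)"] by auto
    then show False
      using z_stays_nonpos[of x y] \<open>\<not> 0 \<le> z x\<close> x assms(1) pos by force
  qed
  have "energy 1 - energy \<alpha> \<le> c * (G (w 1) - G (w \<alpha>)) + c * (sqrt (2 * energy 1) * (w 1 - w \<alpha>))"
    using energy_piece(2)[of \<alpha> 1 1] assms(1-3) pos less_imp_le[OF pos[of 1]] z by auto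
  also have "\<dots> = c * (G (w 1) + sqrt (2 * energy 1) * w 1)"
    using assms(3) by (simp add: algebra_simps)
  also have "\<dots> \<le> c * (sqrt b * (w 1)\<^sup>2 / 2 + sqrt (2 * energy 1) * w 1)"
    using hom_area_le_square[of q b "w 1"] q_pos b_pos c_pos pos[of 1] assms(2) energy_nonneg[of 1]
    by (intro mult_left_mono add_mono) auto
  finally show ?thesis .
qed

lemma energy_last_piece:
  assumes "0 \<le> \<alpha>" "\<alpha> < 1" "w \<alpha> = 0" and ne: "\<And>r. r \<in> {\<alpha><..1} \<Longrightarrow> w r \<noteq> 0" and z1: "0 < w 1 * z 1"
  shows "energy 1 - energy \<alpha> \<le> c * (sqrt b * (w 1)\<^sup>2 / 2 + sqrt (2 * energy 1) * \<bar>w 1\<bar>)"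
proof -
  interpret neg: emden_system q c b "\<lambda>r. - w r" "\<lambda>r. - z r"
    by (rule emden_system_uminus)
  have "1 \<in> closure {\<alpha><..<1}"
    using assms(2) by simp
  have cont: "continuous_on (closure {\<alpha><..<1}) w"
    using assms(1,2) by (intro continuous_on_subset[OF w_cont]) auto
  have "w r \<noteq> 0" if "r \<in> {\<alpha><..<1}" for r
    using ne that by simp
  from constant_sign[OF assms(1) order_refl this] show ?thesis
  proof
    assume *: "\<forall>r\<in>{\<alpha><..<1}. 0 < w r"
    have "0 \<le> w 1"
      using * by (intro continuous_ge_on_closure[OF cont \<open>1 \<in> closure {\<alpha><..<1}\<close>]) (auto intro: less_imp_le)
    then have "0 < w 1" using ne[of 1] assms(2) by auto
    then have pos: "0 < w r" if "r \<in> {\<alpha><..1}" for r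
      using * that by (cases "r = 1") auto
    have "0 < z 1" using z1 \<open>0 < w 1\<close> by (simp add: zero_less_mult_iff)
    from energy_last_piece_pos[OF assms(1-3) pos this] show ?thesis
      using \<open>0 < w 1\<close> by simp
  next
    assume *: "\<forall>r\<in>{\<alpha><..<1}. w r < 0"
    have "w 1 \<le> 0"
      using * by (intro continuous_le_on_closure[OF cont \<open>1 \<in> closure {\<alpha><..<1}\<close>]) (auto intro: less_imp_le)
    then have "w 1 < 0" using ne[of 1] assms(2) by auto
    then have pos: "0 < - w r" if "r \<in> {\<alpha><..1}" for r
      using * that by (cases "r = 1") auto
    have "0 < - z 1" using z1 \<open>w 1 < 0\<close> by (simp add: zero_less_mult_iff)
    from neg.energy_last_piece_pos[OF assms(1,2) _ pos this] show ?thesis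
      using \<open>w 1 < 0\<close> assms(3) unfolding energy_uminus by simp
  qed
qed

text \<open>The \<open>Suc k\<close> complete domains fill the interval from \<open>0\<close> to the
  last zero \<open>s\<close>, below which only \<open>k\<close> zeros remain. Beyond
  \<open>s\<close> the orbit is still moving away from \<open>w = 0\<close>, which is the incomplete
  piece.\<close>

lemma energy_count_neumann:
  assumes "w 1 * z 1 > 0" and fin: "finite {r \<in> {0<..<1}. w r = 0}"
    and card: "card {r \<in> {0<..<1}. w r = 0} = Suc k"
  shows "energy_count (Suc k)"
proof -
  let ?Z = "{r \<in> {0<..<1}. w r = 0}"
  define s where "s = Max ?Z"
  have ne: "?Z \<noteq> {}" using card by (metis card.empty nat.distinct(1))
  have s: "s \<in> ?Z" unfolding s_def by (rule Max_in[OF fin ne])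
  have s_max: "r \<le> s" if "r \<in> ?Z" for r
    unfolding s_def by (rule Max_ge[OF fin that])
  have Z: "{r \<in> {0<..<s}. w r = 0} = ?Z - {s}"
  proof (intro equalityI subsetI)
    fix r assume r: "r \<in> ?Z - {s}"
    then have "r \<in> ?Z" by blast
    from s_max[OF this] r show "r \<in> {r \<in> {0<..<s}. w r = 0}" by simp
  qed (use s in auto)
  have cards: "card {r \<in> {0<..<s}. w r = 0} = k"
    unfolding Z using card_Diff_singleton[OF s] card by simp
  have fins: "finite {r \<in> {0<..<s}. w r = 0}"
    unfolding Z by (rule finite_Diff[OF fin])
  have w1: "w 1 \<noteq> 0" using assms(1) by auto
  have "w r \<noteq> 0" if "r \<in> {s<..1}" for r
  proof
    assume "w r = 0"
    then have "r \<in> ?Z" using that s w1 by (cases "r = 1") auto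
    from s_max[OF this] that show False by simp
  qed
  then have last: "energy 1 - energy s \<le> c * (sqrt b * (w 1)\<^sup>2 / 2 + sqrt (2 * energy 1) * \<bar>w 1\<bar>)"
    using energy_last_piece[of s] s assms(1) by simp
  have mono: "energy s \<le> energy 1" using energy_mono[of s 1] s by simp
  have main: "2 * (real k + 1) * c * G_max \<le> energy s
    \<and> energy s \<le> 2 * (real k + 1) * c * (G_max + sqrt (2 * energy 1) * M)"
    if "\<forall>r\<in>{0..1}. \<bar>w r\<bar> \<le> M" for M
    using that s fins cards by (intro energy_at_zero) auto
  have "continuous_on {0..1} (\<lambda>r. \<bar>w r\<bar>)" by (intro continuous_intros w_cont)
  then obtain M0 where "\<forall>r\<in>{0..1}. \<bar>w r\<bar> \<le> M0"
    using continuous_attains_sup[of "{0..1::real}" "\<lambda>r. \<bar>w r\<bar>"] by auto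
  from main[OF this] have "2 * (real k + 1) * c * G_max \<le> energy 1" using mono by simp
  then show ?thesis
    unfolding energy_count_def
  proof (intro conjI allI impI)
    fix M assume "\<forall>r\<in>{0..1}. \<bar>w r\<bar> \<le> M"
    from main[OF this] last show "energy 1 \<le> 2 * real (Suc k) * c * (G_max + sqrt (2 * energy 1) * M)
          + c * (sqrt b * (w 1)\<^sup>2 / 2 + sqrt (2 * energy 1) * \<bar>w 1\<bar>)"
      by (simp add: add.commute)
  qed (simp add: add.commute)
qed

section \<open>A priori bounds in terms of the final energy\<close>

lemma amplitude_bound:
  assumes "0 < q\<^sub>0" "q\<^sub>0 \<le> q" "q \<le> q\<^sub>1" "b \<le> B" and r: "0 \<le> r" "r \<le> 1"
  shows "(w r)\<^sup>2 \<le> (2 * (q\<^sub>1 + 2) + 1 + ((q\<^sub>1 + 2) * B) powr (2 / q\<^sub>0)) * (1 + energy 1)"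
    (is "_ \<le> ?K * _")
proof -
  define x where "x = \<bar>w r\<bar>"
  define Q where "Q = q\<^sub>1 + 2"
  have Q: "0 < Q" "q + 2 \<le> Q" using assms by (auto simp: Q_def)
  have E: "0 \<le> energy 1" "energy r \<le> energy 1"
    using energy_nonneg[of 1] energy_mono[of r 1] r by auto
  have QB: "0 < Q * B" using Q b_pos assms by (intro mult_pos_pos) auto
  have "x\<^sup>2 \<le> (2 * Q + 1 + (Q * B) powr (2 / q\<^sub>0)) * (1 + energy 1)"
  \<comment> \<open>In the first case \<open>Q * B * x^2\<close> is at most
    \<open>x powr (q + 2)\<close>, so half of that power absorbs the quadratic term of the energy.
    Otherwise \<open>x^2\<close> is bounded outright, which accounts for the last two summands of
    the constant.\<close>
  proof (cases "1 \<le> x \<and> Q * B \<le> x powr q\<^sub>0")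
    case True
    have "x powr (q + 2) = (q + 2) * (energy r - (z r)\<^sup>2 / 2 + b / 2 * x\<^sup>2)"
      using q_pos by (simp add: energy_def x_def field_simps)
    also have "energy r - (z r)\<^sup>2 / 2 \<le> energy 1"
      using E zero_le_power2[of "z r"] by linarith
    also have "b / 2 * x\<^sup>2 \<le> B / 2 * x\<^sup>2"
      using assms by (intro mult_right_mono) auto
    finally have "x powr (q + 2) \<le> (q + 2) * (energy 1 + B / 2 * x\<^sup>2)"
      using q_pos by simp
    also have "\<dots> \<le> Q * (energy 1 + B / 2 * x\<^sup>2)"
      using E assms b_pos Q by (intro mult_right_mono add_nonneg_nonneg) auto
    also have "\<dots> = Q * energy 1 + Q * B * x\<^sup>2 / 2"
      by (simp add: algebra_simps)
    finally have "x powr (q + 2) \<le> Q * energy 1 + Q * B * x\<^sup>2 / 2" .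
    moreover have "Q * B * x\<^sup>2 \<le> x powr (q + 2)"
    proof -
      have "Q * B \<le> x powr q"
        using True assms powr_mono[of q\<^sub>0 q x] by linarith
      then have "Q * B * x\<^sup>2 \<le> x powr q * x\<^sup>2"
        by (rule mult_right_mono) simp
      then show ?thesis using True by (simp add: powr_add)
    qed
    ultimately have "x powr (q + 2) \<le> 2 * Q * energy 1" by simp
    moreover have "x\<^sup>2 \<le> x powr (q + 2)"
      using True q_pos powr_mono[of 2 "q + 2" x] by simp
    ultimately have "x\<^sup>2 \<le> 2 * Q * energy 1" by simp
    also have "\<dots> \<le> (2 * Q + 1 + (Q * B) powr (2 / q\<^sub>0)) * (1 + energy 1)"
      using E Q by (intro mult_mono) auto
    finally show ?thesis .
  next
    case False
    have "x\<^sup>2 \<le> 1 + (Q * B) powr (2 / q\<^sub>0)"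
    proof (cases "1 \<le> x")
      case True
      then have "x powr q\<^sub>0 \<le> Q * B" using False by simp
      then have "(x powr q\<^sub>0) powr (2 / q\<^sub>0) \<le> (Q * B) powr (2 / q\<^sub>0)"
        using assms(1) by (intro powr_mono2) auto
      then show ?thesis using assms(1) True by (simp add: powr_powr)
    next
      case False
      then have "x\<^sup>2 \<le> 1" by (simp add: x_def abs_square_le_1)
      then show ?thesis by (simp add: add_increasing2)
    qed
    also have "\<dots> \<le> (2 * Q + 1 + (Q * B) powr (2 / q\<^sub>0)) * 1"
      using Q by simp
    also have "\<dots> \<le> (2 * Q + 1 + (Q * B) powr (2 / q\<^sub>0)) * (1 + energy 1)"
      using E Q by (intro mult_left_mono) auto
    finally show ?thesis .
  qed
  then show ?thesis by (simp add: x_def Q_def)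
qed

text \<open>This breaks the circularity. With \<open>M = sqrt (K * (1 + energy 1))\<close> every
  term is at most a constant times \<open>1 + energy 1\<close>, so \<open>energy 1\<close> is at
  most \<open>c * L * (1 + energy 1)\<close> and half of it can be absorbed. In \<open>L\<close>,
  the mixed terms of the \<open>N\<close> domains and of the last piece make up
  \<open>2 * N + 1\<close> copies of \<open>sqrt (2 * K)\<close>.\<close>

lemma energy_bootstrap:
  assumes count: "energy_count N" and K: "\<And>r. 0 \<le> r \<Longrightarrow> r \<le> 1 \<Longrightarrow> (w r)\<^sup>2 \<le> K * (1 + energy 1)" and "b \<le> B"
    and "G_max \<le> \<Gamma>" and L: "L = 2 * real N * \<Gamma> + (2 * real N + 1) * sqrt (2 * K) + sqrt B * K / 2"
    and small: "c * L \<le> 1 / 2"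
  shows "energy 1 \<le> 2 * c * L"
proof -
  let ?E = "energy 1" let ?M = "sqrt (K * (1 + ?E))"
  have E: "0 \<le> ?E" by (simp add: energy_nonneg)
  have "0 \<le> K * (1 + ?E)" using K[of 1] by (rule order_trans[rotated]) auto
  then have K0: "0 \<le> K" using E by (simp add: zero_le_mult_iff)
  have bound: "\<bar>w r\<bar> \<le> ?M" if "r \<in> {0..1}" for r
    using K[of r] that real_sqrt_le_mono[of "(w r)\<^sup>2"] by simp
  have sq: "sqrt (2 * ?E) * ?M \<le> sqrt (2 * K) * (1 + ?E)"
  proof -
    have "sqrt (2 * ?E) * ?M = sqrt (2 * K) * sqrt (?E * (1 + ?E))"
      by (simp add: real_sqrt_mult mult_ac)
    also have "sqrt (?E * (1 + ?E)) \<le> 1 + ?E"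
      using E by (intro real_le_lsqrt) (auto simp: power2_eq_square intro: mult_right_mono)
    finally show ?thesis using K0 by (simp add: mult_left_mono)
  qed
  have "0 \<le> G_max" using hom_area_mono[of q 0 "hom_peak q b" b] q_pos hom_peak_pos[of q b] b_pos by simp
  have "?E \<le> 2 * real N * c * (G_max + sqrt (2 * ?E) * ?M)
          + c * (sqrt b * (w 1)\<^sup>2 / 2 + sqrt (2 * ?E) * \<bar>w 1\<bar>)"
    using count bound unfolding energy_count_def by blast
  also have "\<dots> \<le> 2 * real N * c * (\<Gamma> * (1 + ?E) + sqrt (2 * K) * (1 + ?E))
          + c * (sqrt B * (K * (1 + ?E)) / 2 + sqrt (2 * K) * (1 + ?E))"
  proof -
    have 1: "G_max \<le> \<Gamma> * (1 + ?E)"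
      using \<open>0 \<le> G_max\<close> assms(4) E mult_left_mono[of 1 "1 + ?E" \<Gamma>] by simp
    have 2: "sqrt (2 * ?E) * \<bar>w 1\<bar> \<le> sqrt (2 * K) * (1 + ?E)"
      using bound[of 1] E by (intro order_trans[OF mult_left_mono sq]) auto
    have 3: "sqrt b * (w 1)\<^sup>2 / 2 \<le> sqrt B * (K * (1 + ?E)) / 2"
      using K[of 1] assms(3) b_pos by (intro divide_right_mono mult_mono) auto
    show ?thesis
      by (intro add_mono[OF mult_left_mono mult_left_mono] add_mono 1 2 3 sq) (use c_pos in auto)
  qed
  also have "\<dots> = c * L * (1 + ?E)"
    by (simp add: L algebra_simps)
  finally have "?E \<le> c * L + c * L * ?E" by (simp add: algebra_simps)
  also have "c * L * ?E \<le> 1 / 2 * ?E" using small E by (rule mult_right_mono)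
  finally show ?thesis by simp
qed

text \<open>A Gronwall estimate in \<open>log r\<close>, run inwards from \<open>r = 1\<close>. In
  the derivative of \<open>w^2 + z^2\<close> the anti-damping term has the favourable sign; what
  remains is \<open>2 * w * z * k\<close> with \<open>|k|\<close> at most \<open>C\<close>, and the
  weight \<open>r powr C\<close> compensates it.\<close>

lemma backward_growth:
  assumes X: "\<And>r. 0 < r \<Longrightarrow> r < 1 \<Longrightarrow> \<bar>w r\<bar> powr q \<le> X" and C: "1 + b + X \<le> C" and r: "0 < r" "r \<le> 1"
  shows "(w r)\<^sup>2 + (z r)\<^sup>2 \<le> r powr (- C) * ((w 1)\<^sup>2 + (z 1)\<^sup>2)"
proof -
  have "r powr C * ((w r)\<^sup>2 + (z r)\<^sup>2) \<le> 1 powr C * ((w 1)\<^sup>2 + (z 1)\<^sup>2)"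
  proof (cases "r = 1")
    case False
    show ?thesis
    proof (rule DERIV_nonneg_imp_increasing_open[where f = "\<lambda>r. r powr C * ((w r)\<^sup>2 + (z r)\<^sup>2)"])
      show "continuous_on {r..1} (\<lambda>r. r powr C * ((w r)\<^sup>2 + (z r)\<^sup>2))"
        using r by (intro continuous_intros continuous_on_subset[OF w_cont] continuous_on_subset[OF z_cont]) auto
      fix x assume x: "r < x" "x < 1"
      then have x0: "0 < x" using r by simp
      define k where "k = 1 + b - \<bar>w x\<bar> powr q"
      let ?d = "x powr C / x * (C * ((w x)\<^sup>2 + (z x)\<^sup>2) + 2 * (w x * z x * k) + 2 * (c * (z x)\<^sup>2))"
      have D: "((\<lambda>r. r powr C * ((w r)\<^sup>2 + (z r)\<^sup>2)) has_real_derivative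
         C * x powr (C - 1) * ((w x)\<^sup>2 + (z x)\<^sup>2)
          + (2 * (w x * (z x / x)) + 2 * (z x * ((c * z x + b * w x - \<bar>w x\<bar> powr q * w x) / x))) * x powr C) (at x)"
        by (intro DERIV_mult DERIV_add has_real_derivative_powr x0
            DERIV_cong[OF DERIV_power[OF w_deriv]] DERIV_cong[OF DERIV_power[OF z_deriv]] x) auto
      have eq: "C * x powr (C - 1) * ((w x)\<^sup>2 + (z x)\<^sup>2)
          + (2 * (w x * (z x / x)) + 2 * (z x * ((c * z x + b * w x - \<bar>w x\<bar> powr q * w x) / x))) * x powr C = ?d"
        using x0 unfolding k_def by (simp add: powr_diff) (simp add: field_simps power2_eq_square)
      have "0 \<le> ?d"
      proof -
        have "\<bar>k\<bar> \<le> C" using X[OF x0 x(2)] C b_pos powr_ge_zero[of "\<bar>w x\<bar>" q]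
          unfolding k_def abs_le_iff by linarith
        have "2 * \<bar>w x * z x\<bar> \<le> (w x)\<^sup>2 + (z x)\<^sup>2"
          using sum_squares_bound[of "\<bar>w x\<bar>" "\<bar>z x\<bar>"] by (simp add: abs_mult)
        then have "\<bar>k\<bar> * (2 * \<bar>w x * z x\<bar>) \<le> C * ((w x)\<^sup>2 + (z x)\<^sup>2)"
          using \<open>\<bar>k\<bar> \<le> C\<close> by (intro mult_mono) auto
        then have "0 \<le> C * ((w x)\<^sup>2 + (z x)\<^sup>2) + 2 * (w x * z x * k)"
          using abs_ge_minus_self[of "w x * z x * k"] by (simp add: abs_mult mult_ac)
        then have "0 \<le> C * ((w x)\<^sup>2 + (z x)\<^sup>2) + 2 * (w x * z x * k) + 2 * (c * (z x)\<^sup>2)"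
          using c_pos by simp
        then show ?thesis using x0 by simp
      qed
      then show "\<exists>y. ((\<lambda>r. r powr C * ((w r)\<^sup>2 + (z r)\<^sup>2)) has_real_derivative y) (at x) \<and> 0 \<le> y"
        using D[unfolded eq] by blast
    qed (use r False in simp)
  qed simp
  then show ?thesis
    using r by (simp add: powr_minus divide_simps mult.commute)
qed

end

section \<open>Radial profiles\<close>

lemma partial_deriv_eq:
  assumes "(f has_derivative D) (at x)"
  shows "partial_deriv b f x = D b"
  using frechet_derivative_at[OF assms] by (simp add: partial_deriv_def)

lemma DERIV_along_line:
  fixes f :: "'a::euclidean_space \<Rightarrow> real"
  assumes "f differentiable (at (x + t *\<^sub>R d))"
  shows "((\<lambda>s. f (x + s *\<^sub>R d)) has_real_derivative partial_deriv d f (x + t *\<^sub>R d)) (at t)"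
proof -
  have D: "(f has_derivative frechet_derivative f (at (x + t *\<^sub>R d))) (at (x + t *\<^sub>R d))"
    using assms by (simp add: frechet_derivative_works)
  have "((\<lambda>s. x + s *\<^sub>R d) has_derivative (\<lambda>h. h *\<^sub>R d)) (at t)"
    by (auto intro!: derivative_eq_intros)
  from has_derivative_compose[OF this D]
  have "((\<lambda>s. f (x + s *\<^sub>R d)) has_derivative (\<lambda>h. frechet_derivative f (at (x + t *\<^sub>R d)) (h *\<^sub>R d))) (at t)" .
  moreover have "(\<lambda>h. frechet_derivative f (at (x + t *\<^sub>R d)) (h *\<^sub>R d)) = (*) (partial_deriv d f (x + t *\<^sub>R d))"
    using linear_cmul[OF has_derivative_linear[OF D]] by (auto simp: partial_deriv_def)
  ultimately show ?thesis
    by (simp add: has_field_derivative_def)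
qed

text \<open>Continuity of the factor \<open>k\<close> suffices. In its application \<open>k\<close>
  involves the radial derivative, whose differentiability is still to be shown.\<close>

lemma DERIV_0_mult_isCont:
  fixes f k :: "real \<Rightarrow> real"
  assumes "\<forall>\<^sub>F s in nhds 0. f s = s * k s" "isCont k 0"
  shows "(f has_real_derivative k 0) (at 0)"
proof -
  have "((\<lambda>s. s * k s) has_real_derivative k 0) (at 0)"
    unfolding CARAT_DERIV using assms(2) by (intro exI[of _ k]) (auto simp: mult.commute)
  then show ?thesis
    by (subst DERIV_cong_ev[OF refl assms(1) refl])
qed

lemma partial_deriv_radial:
  fixes u :: "'a::euclidean_space \<Rightarrow> real"
  assumes u: "\<And>x. x \<in> ball 0 1 \<Longrightarrow> u x = U (norm x)"
    and U: "(U has_real_derivative d) (at (norm x))" and x: "x \<in> ball 0 1" "x \<noteq> 0"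
  shows "partial_deriv b u x = d * ((x \<bullet> b) / norm x)"
proof -
  have "(norm has_derivative (\<lambda>h. h \<bullet> sgn x)) (at x)"
    using has_derivative_norm[OF x(2)] by simp
  then have "((\<lambda>y. U (norm y)) has_derivative (\<lambda>h. d * (h \<bullet> sgn x))) (at x)"
    using has_derivative_compose[of norm "\<lambda>h. h \<bullet> sgn x" x UNIV U "\<lambda>h. d * h"] U
    by (simp add: has_field_derivative_def)
  then have "(u has_derivative (\<lambda>h. d * (h \<bullet> sgn x))) (at x)"
    by (rule has_derivative_transform_within_open[OF _ open_ball x(1)]) (simp add: u)
  from partial_deriv_eq[OF this] show ?thesis
    by (simp add: sgn_div_norm inner_commute divide_inverse mult_ac)
qed

text \<open>Everything is evaluated on the axis through \<open>e\<close>. The second derivative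
  along \<open>e\<close> is the derivative of \<open>V\<close>, and its existence comes from that of
  \<open>partial_deriv e u\<close>. For another basis vector \<open>b\<close>,
  \<open>partial_deriv b u\<close> along the line \<open>r *\<^sub>R e + s *\<^sub>R b\<close> has
  the form \<open>s * k s\<close> with \<open>k\<close> continuous, which gives
  \<open>k 0 = V r / r\<close>.\<close>

lemma laplacian_radial:
  fixes u :: "'a::euclidean_space \<Rightarrow> real"
  assumes C2: "C2_on (ball 0 1) u" and u: "\<And>x. x \<in> ball 0 1 \<Longrightarrow> u x = U (norm x)"
    and U: "\<And>r. 0 < r \<Longrightarrow> r < 1 \<Longrightarrow> (U has_real_derivative V r) (at r)"
    and V: "continuous_on {0<..<1} V"
    and e: "e \<in> Basis" and r: "0 < r" "r < 1"
    and Ve: "\<And>r. 0 < r \<Longrightarrow> r < 1 \<Longrightarrow> V r = partial_deriv e u (r *\<^sub>R e)"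
  shows "(V has_real_derivative laplacian u (r *\<^sub>R e) - (DIM('a) - 1) / r * V r) (at r)"
proof -
  have ne: "norm e = 1" using e by simp
  have diff: "partial_deriv b u differentiable (at (r *\<^sub>R e))" if "b \<in> Basis" for b
    using C2 that r ne by (auto simp: C2_on_def C1_on_def)
  have other: "partial_deriv b (partial_deriv b u) (r *\<^sub>R e) = V r / r" if b: "b \<in> Basis" "b \<noteq> e" for b
  proof -
    have eb: "e \<bullet> b = 0" using e b by (simp add: inner_not_same_Basis)
    let ?x = "\<lambda>s. r *\<^sub>R e + s *\<^sub>R b"
    define k where "k s = V (norm (?x s)) / norm (?x s)" for s
    have 1: "((\<lambda>s. partial_deriv b u (?x s)) has_real_derivative partial_deriv b (partial_deriv b u) (r *\<^sub>R e)) (at 0)"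
      using DERIV_along_line[of "partial_deriv b u" "r *\<^sub>R e" 0 b] diff b by simp
    have lim: "((\<lambda>s. norm (?x s)) \<longlongrightarrow> r) (at 0 within UNIV)"
      using r ne by (auto intro!: tendsto_eq_intros)
    have lim': "((\<lambda>s. norm (?x s)) \<longlongrightarrow> r) (nhds 0)"
      using lim r ne by (auto simp: tendsto_nhds_iff)
    have ev: "\<forall>\<^sub>F s in nhds 0. norm (?x s) \<in> {0<..<1}"
      using topological_tendstoD[OF lim', of "{0<..<1}"] r by auto
    have "\<forall>\<^sub>F s in nhds 0. partial_deriv b u (?x s) = s * k s"
      using ev
    proof eventually_elim
      case (elim s)
      have "partial_deriv b u (?x s) = V (norm (?x s)) * ((?x s \<bullet> b) / norm (?x s))"
        using elim by (intro partial_deriv_radial[OF u U]) auto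
      then show ?case
        using b eb by (simp add: k_def inner_add_left)
    qed
    moreover have "isCont k 0"
    proof -
      have "isCont V r" using V r by (auto simp: continuous_on_eq_continuous_at)
      then have "((\<lambda>s. V (norm (?x s))) \<longlongrightarrow> V r) (at 0)"
        by (rule isCont_tendsto_compose) (use lim in simp)
      then have "((\<lambda>s. V (norm (?x s)) / norm (?x s)) \<longlongrightarrow> V r / r) (at 0)"
        using lim r by (intro tendsto_divide) auto
      then show ?thesis using r ne by (simp add: isCont_def k_def[abs_def])
    qed
    ultimately have "((\<lambda>s. partial_deriv b u (?x s)) has_real_derivative k 0) (at 0)"
      by (rule DERIV_0_mult_isCont)
    from DERIV_unique[OF 1 this] show ?thesis
      using r ne by (simp add: k_def)
  qed
  have "((\<lambda>s. partial_deriv e u (s *\<^sub>R e)) has_real_derivative partial_deriv e (partial_deriv e u) (r *\<^sub>R e)) (at r)"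
    using DERIV_along_line[of "partial_deriv e u" 0 r e] diff e by simp
  then have "(V has_real_derivative partial_deriv e (partial_deriv e u) (r *\<^sub>R e)) (at r)"
    by (rule has_field_derivative_transform_within_open[of _ _ _ "{0<..<1}"]) (use r Ve in auto)
  moreover have "laplacian u (r *\<^sub>R e) = partial_deriv e (partial_deriv e u) (r *\<^sub>R e) + (DIM('a) - 1) * (V r / r)"
    unfolding laplacian_def using e
    by (subst sum.remove[OF _ e]) (simp_all add: other card_Diff_singleton)
  ultimately show ?thesis
    using DIM_positive[where 'a = 'a] by (simp add: of_nat_diff)
qed

text \<open>The solution is only continuous up to the sphere; the point is to extend its radial
  derivative continuously to \<open>r = 1\<close>. The flux \<open>r ^ k * W r\<close> equals a
  constant minus the integral of a function continuous up to \<open>1\<close>, hence has a limit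
  there.\<close>

lemma radial_classical_solution_ode:
  fixes u :: "'a::euclidean_space \<Rightarrow> real"
  assumes q: "0 < q" and sol: "classical_solution q u" and rad: "radial u"
  obtains U V where "\<And>x. x \<in> cball 0 1 \<Longrightarrow> u x = U (norm x)"
    "continuous_on {0..1} U" "continuous_on {0..1} V"
    "\<And>r. 0 < r \<Longrightarrow> r < 1 \<Longrightarrow> (U has_real_derivative V r) (at r)"
    "\<And>r. 0 < r \<Longrightarrow> r < 1 \<Longrightarrow>
      (V has_real_derivative - ((DIM('a) - 1) / r * V r) - \<bar>U r\<bar> powr q * U r) (at r)"
proof -
  define e :: 'a where "e = (SOME b. b \<in> Basis)"
  have e: "e \<in> Basis" unfolding e_def by (rule someI_ex) (use nonempty_Basis in blast)
  then have ne [simp]: "norm e = 1" by simp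
  define U where "U r = u (r *\<^sub>R e)" for r
  define W where "W r = partial_deriv e u (r *\<^sub>R e)" for r
  obtain U' where U': "\<And>x. x \<in> cball 0 1 \<Longrightarrow> u x = U' (norm x)"
    using rad by (auto simp: radial_def radial_profile_def)
  have u: "u x = U (norm x)" if "x \<in> cball 0 1" for x
    using U'[OF that] U'[of "norm x *\<^sub>R e"] that by (simp add: U_def)
  have C2: "C2_on (ball 0 1) u" and contu: "continuous_on (cball 0 1) u"
    and eq: "\<And>x. x \<in> ball 0 1 \<Longrightarrow> - laplacian u x = \<bar>u x\<bar> powr q * u x"
    using sol by (auto simp: classical_solution_def)
  have contU: "continuous_on {0..1} U"
    unfolding U_def by (intro continuous_on_compose2[OF contu] continuous_intros) auto
  have contW: "continuous_on {0..<1} W"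
  proof -
    have "continuous_on (ball 0 1) (partial_deriv e u)"
      using C2 e by (simp add: C2_on_def C1_on_def)
    then show ?thesis
      unfolding W_def by (rule continuous_on_compose2) (auto intro!: continuous_intros)
  qed
  have dU: "(U has_real_derivative W r) (at r)" if "0 < r" "r < 1" for r
    unfolding U_def W_def using DERIV_along_line[of u 0 r e] C2 that by (auto simp: C2_on_def C1_on_def)
  define f where "f r = \<bar>U r\<bar> powr q * U r" for r
  have contf: "continuous_on {0..1} f"
    unfolding f_def using q by (intro continuous_intros contU continuous_on_powr') auto
  have dW: "(W has_real_derivative - ((DIM('a) - 1) / r * W r) - f r) (at r)" if "0 < r" "r < 1" for r
  proof -
    have "(W has_real_derivative laplacian u (r *\<^sub>R e) - (DIM('a) - 1) / r * W r) (at r)"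
      using that by (intro laplacian_radial[OF C2 _ dU _ e])
        (auto intro!: u continuous_on_subset[OF contW, unfolded W_def[abs_def]] simp: W_def[abs_def])
    moreover have "laplacian u (r *\<^sub>R e) = - f r"
      using eq[of "r *\<^sub>R e"] that by (simp add: f_def U_def)
    ultimately show ?thesis
      by (elim DERIV_cong) linarith
  qed
  define k where "k = DIM('a) - 1"
  have k: "real DIM('a) - 1 = real k"
    using DIM_positive[where 'a = 'a] by (simp add: k_def of_nat_diff Suc_leI)
  \<comment> \<open>The base point \<open>1/2\<close> keeps the later division by
    \<open>r ^ k\<close> away from \<open>0\<close>.\<close>
  define F where "F r = integral {1/2..r} (\<lambda>s. s ^ k * f s)" for r
  have contg: "continuous_on {1/2..1} (\<lambda>s. s ^ k * f s)"
    by (intro continuous_intros continuous_on_subset[OF contf]) auto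
  have dF': "(F has_real_derivative r ^ k * f r) (at r within {1/2..1})" if "r \<in> {1/2..1}" for r
    unfolding F_def by (rule integral_has_real_derivative[OF contg that])
  have dF: "(F has_real_derivative r ^ k * f r) (at r)" if "1/2 < r" "r < 1" for r
    using dF'[of r] that by (simp add: at_within_Icc_at)
  have contF: "continuous_on {1/2..1} F"
    using dF' by (rule DERIV_continuous_on)
  define P where "P = (1/2) ^ k * W (1/2)"
  have const: "r ^ k * W r + F r = P" if r: "1/2 \<le> r" "r < 1" for r
  proof (cases "r = 1/2")
    case True
    show ?thesis unfolding True by (simp add: P_def F_def)
  next
    case False
    have "r ^ k * W r + F r = (1/2) ^ k * W (1/2) + F (1/2)"
    proof (rule DERIV_isconst2[of "1/2" r "\<lambda>r. r ^ k * W r + F r"])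
      show "continuous_on {1/2..r} (\<lambda>r. r ^ k * W r + F r)"
        using r by (intro continuous_intros continuous_on_subset[OF contW] continuous_on_subset[OF contF]) auto
      fix x assume x: "1/2 < x" "x < r"
      have "((\<lambda>r. r ^ k * W r + F r) has_real_derivative
          (real k * x ^ (k - 1) * W x + (- ((DIM('a) - 1) / x * W x) - f x) * x ^ k) + x ^ k * f x) (at x)"
        using x r by (intro DERIV_add DERIV_mult dW dF) (auto intro!: derivative_eq_intros)
      moreover have "real k * x ^ (k - 1) = real k / x * x ^ k"
        using x by (cases k) auto
      ultimately show "DERIV (\<lambda>r. r ^ k * W r + F r) x :> 0"
        by (elim DERIV_cong) (simp add: k algebra_simps)
    qed (use r False in auto)
    then show ?thesis by (simp add: P_def F_def)
  qed
  \<comment> \<open>\<open>P - F 1\<close> is the limit of \<open>W r\<close> at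
    \<open>r = 1\<close>, since \<open>r ^ k\<close> tends to \<open>1\<close>.\<close>
  define V where "V r = (if r < 1 then W r else P - F 1)" for r
  have V: "V r = (P - F r) / r ^ k" if "1/2 \<le> r" "r \<le> 1" for r
    using const[of r] that by (auto simp: V_def field_simps)
  have "continuous_on {1/2..1} (\<lambda>r. (P - F r) / r ^ k)"
    by (intro continuous_intros contF) auto
  then have "continuous_on {1/2..1} V"
    by (rule continuous_on_eq) (simp add: V)
  moreover have "continuous_on {0..1/2} V"
    by (rule continuous_on_eq[OF continuous_on_subset[OF contW]]) (auto simp: V_def)
  ultimately have "continuous_on ({0..1/2} \<union> {1/2..1}) V"
    by (intro continuous_on_closed_Un) auto
  moreover have "{0..1/2} \<union> {1/2..1} = {0..1::real}" by auto
  ultimately have contV: "continuous_on {0..1} V" by simp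
  have dV: "(V has_real_derivative - ((DIM('a) - 1) / r * V r) - \<bar>U r\<bar> powr q * U r) (at r)"
    if "0 < r" "r < 1" for r
  proof -
    have "(V has_real_derivative - ((DIM('a) - 1) / r * W r) - f r) (at r)"
      by (rule has_field_derivative_transform_within_open[OF dW, of _ "{0<..<1}"]) (use that in \<open>auto simp: V_def\<close>)
    then show ?thesis using that by (simp add: V_def f_def)
  qed
  show thesis
    by (rule that[of U V]) (use u contU contV dU dV in \<open>auto simp: V_def\<close>)
qed

text \<open>\<open>V 1\<close> is a limit of derivatives at interior points, \<open>d\<close> a
  limit of difference quotients at the boundary. Continuity of \<open>V\<close> up to
  \<open>1\<close> identifies them by the fundamental theorem of calculus.\<close>

lemma radial_normal_derivative:
  fixes u :: "'a::euclidean_space \<Rightarrow> real"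
  assumes u: "\<And>x. x \<in> cball 0 1 \<Longrightarrow> u x = U (norm x)"
    and contU: "continuous_on {0..1} U" and contV: "continuous_on {0..1} V"
    and dU: "\<And>r. 0 < r \<Longrightarrow> r < 1 \<Longrightarrow> (U has_real_derivative V r) (at r)"
    and x: "x \<in> sphere 0 1" and d: "has_normal_derivative u d x"
  shows "V 1 = d"
proof -
  have FTC: "(V has_integral (U r - U (1/2))) {1/2..r}" if "1/2 \<le> r" "r \<le> 1" for r
    using that dU
    by (intro fundamental_theorem_of_calculus_interior continuous_on_subset[OF contU])
       (auto simp flip: has_real_derivative_iff_has_vector_derivative)
  have "((\<lambda>r. U (1/2) + integral {1/2..r} V) has_real_derivative 0 + V 1) (at 1 within {1/2..1})"
    by (intro DERIV_add DERIV_const integral_has_real_derivative continuous_on_subset[OF contV]) auto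
  then have "(U has_real_derivative V 1) (at 1 within {1/2..1})"
    by (rule has_field_derivative_transform_within[where d = 1, OF DERIV_cong])
       (auto simp: integral_unique[OF FTC])
  then have "((\<lambda>t. U (1 + t)) has_real_derivative V 1) (at 0 within {-1/2..0})"
    using DERIV_at_within_shift[of U "V 1" 1 0 "{-1/2..0}"] by simp
  moreover have "((\<lambda>t. U (1 + t)) has_real_derivative d) (at 0 within {-1/2..0})"
  proof -
    have "((\<lambda>t. u (x + t *\<^sub>R x)) has_real_derivative d) (at 0 within {-1/2..0})"
      using d unfolding has_normal_derivative_def by (simp add: at_within_Icc_at_left)
    moreover have "u (x + t *\<^sub>R x) = U (1 + t)" if "t \<in> {-1/2..0}" for t
    proof -
      have "norm (x + t *\<^sub>R x) = 1 + t"
        using x that norm_scaleR[of "1 + t" x] by (simp add: scaleR_left_distrib)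
      then show ?thesis using u[of "x + t *\<^sub>R x"] that by simp
    qed
    ultimately show ?thesis
      by (elim has_field_derivative_transform_within[where d = 1]) auto
  qed
  moreover have "at 0 within {-1/2..0::real} \<noteq> bot"
    by (simp add: at_within_Icc_at_left)
  ultimately show ?thesis
    by (rule has_field_derivative_unique)
qed

section \<open>Emden-Fowler variables and the region away from the origin\<close>

lemma abs_diff_le_of_DERIV:
  fixes f :: "real \<Rightarrow> real"
  assumes "a \<le> b" "continuous_on {a..b} f"
    and deriv: "\<And>x. a < x \<Longrightarrow> x < b \<Longrightarrow> (f has_real_derivative f' x) (at x)"
    and bound: "\<And>x. a < x \<Longrightarrow> x < b \<Longrightarrow> \<bar>f' x\<bar> \<le> B"
  shows "\<bar>f b - f a\<bar> \<le> B * (b - a)"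
proof (cases "a = b")
  case False
  then have "a < b" using assms(1) by simp
  moreover have "f differentiable (at x)" if "a < x" "x < b" for x
    using deriv[OF that] real_differentiable_def by blast
  ultimately obtain l x where x: "a < x" "x < b" "(f has_real_derivative l) (at x)" "f b - f a = (b - a) * l"
    using MVT[of a b f] assms(2) by blast
  then have "l = f' x" using deriv DERIV_unique by blast
  then have "\<bar>f b - f a\<bar> = (b - a) * \<bar>f' x\<bar>" using x \<open>a < b\<close> by (simp add: abs_mult)
  also have "\<dots> \<le> (b - a) * B" using bound x \<open>a < b\<close> by (intro mult_left_mono) auto
  finally show ?thesis by (simp add: mult.commute)
qed simp

text \<open>The window for \<open>q\<close> is dictated by the transformed system: the upper bound
  makes its anti-damping positive, the lower bound its stiffness. It amounts to
  \<open>0 < \<epsilon> < 2 / (n - 2)\<close>, which is enough for a limit at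
  \<open>0\<close>.\<close>

locale radial_ode =
  fixes n :: nat and q :: real and U V :: "real \<Rightarrow> real"
  assumes n_ge: "3 \<le> n" and q_gt: "2 / (real n - 2) < q" and q_lt: "q < 4 / (real n - 2)"
    and U_cont: "continuous_on {0..1} U" and V_cont: "continuous_on {0..1} V"
    and U_deriv: "\<And>r. 0 < r \<Longrightarrow> r < 1 \<Longrightarrow> (U has_real_derivative V r) (at r)"
    and V_deriv: "\<And>r. 0 < r \<Longrightarrow> r < 1 \<Longrightarrow>
      (V has_real_derivative - ((real n - 1) / r * V r) - \<bar>U r\<bar> powr q * U r) (at r)"
begin

text \<open>Emden--Fowler variables: \<open>z = r w'\<close>, so in terms of \<open>log r\<close> the system for \<open>(w, z)\<close> is
  autonomous, with anti-damping \<open>4 / q - (n - 2)\<close> proportional to \<open>\<epsilon>\<close>.\<close>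

definition w :: "real \<Rightarrow> real" where "w r = r powr (2 / q) * U r"
definition z :: "real \<Rightarrow> real" where "z r = 2 / q * w r + r powr (2 / q + 1) * V r"

lemma n2_pos: "0 < real n - 2" using n_ge by linarith

lemma q_gt_0: "0 < q"
  using q_gt n2_pos divide_pos_pos[of 2 "real n - 2"] by linarith

lemma damping_pos: "0 < 4 / q - (real n - 2)"
  using q_lt q_gt_0 n2_pos by (simp add: field_simps)

lemma stiffness_pos: "0 < 2 / q * (real n - 2 - 2 / q)"
  using q_gt q_gt_0 n2_pos by (intro mult_pos_pos) (simp_all add: field_simps)

sublocale emden_system q "4 / q - (real n - 2)" "2 / q * (real n - 2 - 2 / q)" w z
proof
  show "continuous_on {0..1} w"
    unfolding w_def using q_gt_0 by (intro continuous_intros continuous_on_powr' U_cont) auto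
  then show "continuous_on {0..1} z"
    unfolding z_def using q_gt_0
    by (intro continuous_intros continuous_on_powr' V_cont) (auto simp: add_pos_pos)
  fix r :: real assume r: "0 < r" "r < 1"
  have "(w has_real_derivative (2 / q * r powr (2 / q - 1)) * U r + V r * r powr (2 / q)) (at r)"
    unfolding w_def by (intro DERIV_mult has_real_derivative_powr r U_deriv)
  moreover have "(2 / q * r powr (2 / q - 1)) * U r + V r * r powr (2 / q) = z r / r"
    using r by (simp add: z_def w_def powr_diff powr_add add_divide_distrib)
  ultimately show w': "(w has_real_derivative z r / r) (at r)" by simp
  have "(z has_real_derivative 2 / q * (z r / r) + (((2 / q + 1) * r powr (2 / q + 1 - 1)) * V r
      + (- ((real n - 1) / r * V r) - \<bar>U r\<bar> powr q * U r) * r powr (2 / q + 1))) (at r)"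
    unfolding z_def[abs_def]
    by (intro DERIV_add DERIV_cmult w'[unfolded z_def] DERIV_mult has_real_derivative_powr r V_deriv)
  moreover have "2 / q * (z r / r) + (((2 / q + 1) * r powr (2 / q + 1 - 1)) * V r
      + (- ((real n - 1) / r * V r) - \<bar>U r\<bar> powr q * U r) * r powr (2 / q + 1))
    = ((4 / q - (real n - 2)) * z r + 2 / q * (real n - 2 - 2 / q) * w r - \<bar>w r\<bar> powr q * w r) / r"
  proof -
    define B where "B = 2 / q"
    define v where "v = r powr (B + 1) * V r"
    have v: "v = z r - B * w r" by (simp add: v_def z_def B_def)
    \<comment> \<open>The exponent \<open>B = 2 / q\<close> is chosen so that
      \<open>B * (q + 1) = B + 2\<close>; this is what makes all explicit powers of \<open>r\<close>
      disappear.\<close>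
    have "\<bar>w r\<bar> powr q * w r = r\<^sup>2 * (\<bar>U r\<bar> powr q * U r * r powr B)"
      using r q_gt_0 by (simp add: w_def B_def abs_mult powr_mult powr_powr mult_ac)
    then have nl: "\<bar>U r\<bar> powr q * U r * r powr (B + 1) = \<bar>w r\<bar> powr q * w r / r"
      using r by (simp add: powr_add power2_eq_square)
    have v': "r powr (B + 1 - 1) * V r = v / r"
      using r by (simp add: v_def powr_add)
    have "(- ((real n - 1) / r * V r) - \<bar>U r\<bar> powr q * U r) * r powr (B + 1)
      = - ((real n - 1) * (v / r)) - \<bar>w r\<bar> powr q * w r / r"
    proof -
      have "(real n - 1) / r * V r * r powr (B + 1) = (real n - 1) * (v / r)"
        by (simp only: v_def times_divide_eq_left times_divide_eq_right mult_ac)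
      then show ?thesis
        using nl by (simp only: left_diff_distrib minus_mult_left[symmetric])
    qed
    then have "B * (z r / r) + (((B + 1) * r powr (B + 1 - 1)) * V r
      + (- ((real n - 1) / r * V r) - \<bar>U r\<bar> powr q * U r) * r powr (B + 1))
      = B * (z r / r) + (B + 1) * (v / r) - (real n - 1) * (v / r) - \<bar>w r\<bar> powr q * w r / r"
      unfolding mult.assoc[of "B + 1"] v' by simp
    also have "\<dots> = (B * z r + (B + 1) * v - (real n - 1) * v - \<bar>w r\<bar> powr q * w r) / r"
      by (simp add: add_divide_distrib diff_divide_distrib)
    also have "B * z r + (B + 1) * v - (real n - 1) * v
      = (2 * B - (real n - 2)) * z r + B * (real n - 2 - B) * w r"
      unfolding v by (simp add: algebra_simps)
    also have "2 * B = 4 / q" by (simp add: B_def)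
    finally show ?thesis unfolding B_def .
  qed
  ultimately show "(z has_real_derivative ((4 / q - (real n - 2)) * z r
      + 2 / q * (real n - 2 - 2 / q) * w r - \<bar>w r\<bar> powr q * w r) / r) (at r)"
    by simp
qed (use q_gt_0 damping_pos stiffness_pos in \<open>auto simp: w_def z_def\<close>)

lemma zeros_w: "{r \<in> {0<..<1}. w r = 0} = {r \<in> {0<..<1}. U r = 0}"
  by (auto simp: w_def)

lemma w_1: "w 1 = U 1" and z_1: "z 1 = 2 / q * U 1 + V 1"
  by (simp_all add: w_def z_def)

text \<open>The squares of \<open>U 1\<close> from \<open>z 1\<close> and from the stiffness nearly
  cancel: with \<open>B = 2 / q\<close> there remains \<open>B / 2 * (2 * B - (n - 2))\<close>, a
  multiple of the anti-damping. This lets the power of \<open>|U 1|\<close> dominate when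
  \<open>V 1 = 0\<close>.\<close>

lemma energy_1:
  "energy 1 = (4 / q - (real n - 2)) * (U 1)\<^sup>2 / q + 2 / q * U 1 * V 1 + (V 1)\<^sup>2 / 2
    + \<bar>U 1\<bar> powr (q + 2) / (q + 2)"
proof -
  define B where "B = 2 / q"
  have "energy 1 = (B * U 1 + V 1)\<^sup>2 / 2 - B * (real n - 2 - B) / 2 * (U 1)\<^sup>2 + \<bar>U 1\<bar> powr (q + 2) / (q + 2)"
    unfolding energy_def w_1 z_1 B_def ..
  also have "\<dots> = (2 * B - (real n - 2)) * (U 1)\<^sup>2 * (B / 2) + B * U 1 * V 1 + (V 1)\<^sup>2 / 2
    + \<bar>U 1\<bar> powr (q + 2) / (q + 2)"
    by (simp add: field_simps power2_eq_square)
  finally show ?thesis by (simp add: B_def)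
qed

text \<open>The comparison function is the harmonic function with the boundary data \<open>U 1\<close>, \<open>V 1\<close>.\<close>

lemma outer_approx:
  assumes \<rho>: "0 < \<rho>" "\<rho> \<le> r" "r \<le> 1" and A: "\<And>s. \<rho> \<le> s \<Longrightarrow> s \<le> 1 \<Longrightarrow> \<bar>U s\<bar> \<le> A"
  shows "\<bar>U r - (U 1 - V 1 * (r powr (2 - real n) - 1) / (real n - 2))\<bar> \<le> \<rho> powr (1 - real n) * A powr (q + 1)"
proof -
  have A0: "0 \<le> A" using A[of 1] \<rho> by linarith
  have nl: "\<bar>\<bar>U s\<bar> powr q * U s\<bar> \<le> A powr (q + 1)" if "\<rho> \<le> s" "s \<le> 1" for s
  proof -
    have "\<bar>\<bar>U s\<bar> powr q * U s\<bar> = \<bar>U s\<bar> powr (q + 1)"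
      by (cases "U s = 0") (simp_all add: abs_mult powr_add)
    also have "\<dots> \<le> A powr (q + 1)" using A[OF that] q_gt_0 by (intro powr_mono2) auto
    finally show ?thesis .
  qed
  \<comment> \<open>In flux form the first-order term disappears and only the nonlinear term, of
    size \<open>A powr (q + 1)\<close>, has to be integrated.\<close>
  have P: "\<bar>V 1 - s powr (real n - 1) * V s\<bar> \<le> A powr (q + 1)" if s: "\<rho> \<le> s" "s \<le> 1" for s
  proof -
    have "\<bar>1 powr (real n - 1) * V 1 - s powr (real n - 1) * V s\<bar> \<le> A powr (q + 1) * (1 - s)"
    proof (rule abs_diff_le_of_DERIV[where f = "\<lambda>s. s powr (real n - 1) * V s"])
      show "continuous_on {s..1} (\<lambda>s. s powr (real n - 1) * V s)"
        using s \<rho> by (intro continuous_intros continuous_on_subset[OF V_cont]) auto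
      fix x assume x: "s < x" "x < 1"
      then have x0: "0 < x" using s \<rho> by linarith
      have "((\<lambda>s. s powr (real n - 1) * V s) has_real_derivative
         ((real n - 1) * x powr (real n - 1 - 1)) * V x + (- ((real n - 1) / x * V x) - \<bar>U x\<bar> powr q * U x) * x powr (real n - 1)) (at x)"
        by (intro DERIV_mult has_real_derivative_powr x x0 V_deriv)
      moreover have "((real n - 1) * x powr (real n - 1 - 1)) * V x + (- ((real n - 1) / x * V x) - \<bar>U x\<bar> powr q * U x) * x powr (real n - 1)
        = - (x powr (real n - 1) * (\<bar>U x\<bar> powr q * U x))"
      proof -
        have "x powr (real n - 1 - 1) = x powr (real n - 1) / x"
          using x0 powr_diff[of x "real n - 1" 1] by simp
        then show ?thesis by (simp add: algebra_simps)
      qed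
      ultimately show "((\<lambda>s. s powr (real n - 1) * V s) has_real_derivative - (x powr (real n - 1) * (\<bar>U x\<bar> powr q * U x))) (at x)"
        by simp
      have "x powr (real n - 1) * \<bar>\<bar>U x\<bar> powr q * U x\<bar> \<le> 1 * A powr (q + 1)"
        using x x0 n2_pos s by (intro mult_mono nl powr_le1) auto
      then show "\<bar>- (x powr (real n - 1) * (\<bar>U x\<bar> powr q * U x))\<bar> \<le> A powr (q + 1)"
        by (simp add: abs_mult)
    qed (use s in simp)
    also have "\<dots> \<le> A powr (q + 1) * 1" using s \<rho> by (intro mult_left_mono) auto
    finally show ?thesis by simp
  qed
  define \<phi> where "\<phi> s = U 1 - V 1 * (s powr (2 - real n) - 1) / (real n - 2)" for s
  have "\<bar>(U 1 - \<phi> 1) - (U r - \<phi> r)\<bar> \<le> \<rho> powr (1 - real n) * A powr (q + 1) * (1 - r)"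
  proof (rule abs_diff_le_of_DERIV[where f = "\<lambda>s. U s - \<phi> s"])
    show "continuous_on {r..1} (\<lambda>s. U s - \<phi> s)"
      unfolding \<phi>_def using \<rho> n2_pos by (intro continuous_intros continuous_on_subset[OF U_cont]) auto
    fix x assume x: "r < x" "x < 1"
    then have x0: "0 < x" using \<rho> by linarith
    have "(\<phi> has_real_derivative 0 - V 1 * ((2 - real n) * x powr (2 - real n - 1) - 0) / (real n - 2)) (at x)"
      unfolding \<phi>_def
      by (intro DERIV_diff DERIV_const DERIV_cdivide DERIV_cmult has_real_derivative_powr x0)
    moreover have "0 - V 1 * ((2 - real n) * x powr (2 - real n - 1) - 0) / (real n - 2) = V 1 * x powr (1 - real n)"
      using n2_pos by (simp add: field_simps)
    ultimately have "(\<phi> has_real_derivative V 1 * x powr (1 - real n)) (at x)" by simp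
    then have "((\<lambda>s. U s - \<phi> s) has_real_derivative V x - V 1 * x powr (1 - real n)) (at x)"
      by (intro DERIV_diff U_deriv x x0)
    moreover have "V x - V 1 * x powr (1 - real n) = x powr (1 - real n) * (x powr (real n - 1) * V x - V 1)"
    proof -
      have "x powr (1 - real n) * x powr (real n - 1) = 1"
        using x0 by (simp flip: powr_add)
      then have "x powr (1 - real n) * (x powr (real n - 1) * V x) = V x"
        by (simp only: mult.assoc[symmetric] mult_1_left)
      then show ?thesis by (simp only: right_diff_distrib mult.commute[of "V 1"])
    qed
    ultimately show "((\<lambda>s. U s - \<phi> s) has_real_derivative x powr (1 - real n) * (x powr (real n - 1) * V x - V 1)) (at x)"
      by simp
    have "x powr (1 - real n) * \<bar>x powr (real n - 1) * V x - V 1\<bar> \<le> \<rho> powr (1 - real n) * A powr (q + 1)"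
      using P[of x] x \<rho> n2_pos by (intro mult_mono powr_mono2') (auto simp: abs_minus_commute)
    then show "\<bar>x powr (1 - real n) * (x powr (real n - 1) * V x - V 1)\<bar> \<le> \<rho> powr (1 - real n) * A powr (q + 1)"
      by (simp add: abs_mult)
  qed (use \<rho> in simp)
  also have "\<dots> \<le> \<rho> powr (1 - real n) * A powr (q + 1) * 1"
    using \<rho> by (intro mult_left_mono) auto
  finally have "\<bar>U r - \<phi> r\<bar> \<le> \<rho> powr (1 - real n) * A powr (q + 1)"
    by (simp add: \<phi>_def)
  then show ?thesis unfolding \<phi>_def .
qed

text \<open>\<open>backward_growth\<close> bounds \<open>|U|\<close> on \<open>{\<rho>..1}\<close>
  by the boundary data, and \<open>outer_approx\<close> turns this into an error of higher order
  \<open>q + 1\<close>. The root is the norm of \<open>(w 1, z 1)\<close>; the summand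
  \<open>4 / q\<close> in \<open>C\<close> pays for the passage from \<open>w\<close> back to
  \<open>U\<close>.\<close>

lemma outer_estimate:
  assumes X: "\<And>r. 0 < r \<Longrightarrow> r < 1 \<Longrightarrow> \<bar>w r\<bar> powr q \<le> X"
    and C: "1 + 2 / q * (real n - 2 - 2 / q) + X + 4 / q \<le> C" and \<rho>: "0 < \<rho>" "\<rho> \<le> r" "r \<le> 1"
  shows "\<bar>U r - (U 1 - V 1 * (r powr (2 - real n) - 1) / (real n - 2))\<bar>
    \<le> \<rho> powr (1 - real n) * (\<rho> powr (- C / 2) * sqrt ((U 1)\<^sup>2 + (2 / q * U 1 + V 1)\<^sup>2)) powr (q + 1)"
proof (rule outer_approx[OF \<rho>])
  fix s assume s: "\<rho> \<le> s" "s \<le> 1"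
  then have s0: "0 < s" using \<rho> by linarith
  let ?D = "(U 1)\<^sup>2 + (2 / q * U 1 + V 1)\<^sup>2"
  have "(s powr (2 / q) * U s)\<^sup>2 \<le> s powr (- (C - 4 / q)) * ?D"
    using backward_growth[OF X, where C = "C - 4 / q" and r = s] C s0 s zero_le_power2[of "z s"]
    unfolding w_1 z_1 w_def[of s, symmetric] by linarith
  also have "(s powr (2 / q) * U s)\<^sup>2 = s powr (4 / q) * (U s)\<^sup>2"
    using s0 by (simp add: power_mult_distrib powr_power)
  finally have "s powr (- (4 / q)) * (s powr (4 / q) * (U s)\<^sup>2) \<le> s powr (- (4 / q)) * (s powr (- (C - 4 / q)) * ?D)"
    by (rule mult_left_mono) simp
  then have "(U s)\<^sup>2 \<le> s powr (- C) * ?D"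
    using s0 by (simp flip: powr_add mult.assoc)
  also have "\<dots> \<le> \<rho> powr (- C) * ?D"
  proof (intro mult_right_mono powr_mono2')
    have "0 \<le> X" using X[of "1/2"] by (rule order_trans[rotated]) auto
    then show "- C \<le> 0" using C stiffness_pos q_gt_0 divide_pos_pos[of 4 q] by linarith
  qed (use s \<rho> in auto)
  also have "\<dots> = (\<rho> powr (- C / 2) * sqrt ?D)\<^sup>2"
    using \<rho> by (simp add: power_mult_distrib powr_power)
  finally have "\<bar>U s\<bar> \<le> \<bar>\<rho> powr (- C / 2) * sqrt ?D\<bar>"
    by (simp only: abs_le_square_iff)
  then show "\<bar>U s\<bar> \<le> \<rho> powr (- C / 2) * sqrt ?D"
    by (simp add: abs_mult)
qed

end

section \<open>Asymptotics\<close>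

text \<open>The constant of \<open>amplitude_bound\<close> for the whole window of \<open>q\<close>,
  hence free of \<epsilon>.\<close>

definition amplitude_const :: "nat \<Rightarrow> real" where
  "amplitude_const n = 2 * (4 / (real n - 2) + 2) + 1
     + ((4 / (real n - 2) + 2) * ((real n - 2) / 2)\<^sup>2) powr (2 / (2 / (real n - 2)))"

definition limit_area :: "nat \<Rightarrow> real" where
  "limit_area n = (real n * (real n - 2)) powr ((real n - 2) / 2) * kappa n"

text \<open>The \<open>L\<close> of \<open>energy_bootstrap\<close>, with
  \<open>limit_area n + 1\<close> as a bound for the area that holds near the limit.\<close>

definition energy_const :: "nat \<Rightarrow> nat \<Rightarrow> real" where
  "energy_const n N = 2 * real N * (limit_area n + 1) + (2 * real N + 1) * sqrt (2 * amplitude_const n)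
     + sqrt (((real n - 2) / 2)\<^sup>2) * amplitude_const n / 2"

text \<open>An admissible \<open>C\<close> for \<open>outer_estimate\<close>: the last three
  summands dominate the stiffness, \<open>|w| powr q\<close> and \<open>4 / q\<close>.\<close>

definition growth_const :: "nat \<Rightarrow> real" where
  "growth_const n = 1 + ((real n - 2) / 2)\<^sup>2 + (1 + 2 * amplitude_const n) powr (4 / (real n - 2)) + 2 * (real n - 2)"

locale counted_ode = radial_ode +
  fixes N :: nat
  assumes count: "energy_count N"
begin

lemma stiffness_le: "2 / q * (real n - 2 - 2 / q) \<le> ((real n - 2) / 2)\<^sup>2"
proof -
  define x B where "x = (real n - 2) / 2" and "B = 2 / q"
  have "0 \<le> (x - B)\<^sup>2" by simp
  then have "B * (2 * x - B) \<le> x\<^sup>2" by (simp add: power2_eq_square algebra_simps)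
  moreover have "2 * x = real n - 2" by (simp add: x_def)
  ultimately show ?thesis by (simp only: x_def B_def)
qed

lemma amplitude: "0 \<le> r \<Longrightarrow> r \<le> 1 \<Longrightarrow> (w r)\<^sup>2 \<le> amplitude_const n * (1 + energy 1)"
  unfolding amplitude_const_def using n2_pos q_gt q_lt stiffness_le
  by (intro amplitude_bound) auto

lemma amplitude_const_ge_1: "1 \<le> amplitude_const n"
  using n2_pos by (simp add: amplitude_const_def)

text \<open>Both assumptions hold for all small \<epsilon>, as the area converges to
  \<open>limit_area n\<close> and the anti-damping to \<open>0\<close>.\<close>

context
  assumes area: "G_max \<le> limit_area n + 1"
    and small: "(4 / q - (real n - 2)) * energy_const n N \<le> 1 / 2"
begin

lemma energy_le: "energy 1 \<le> 2 * (4 / q - (real n - 2)) * energy_const n N"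
  using energy_bootstrap[OF count amplitude stiffness_le area energy_const_def small] .

lemma w_square_le: "0 \<le> r \<Longrightarrow> r \<le> 1 \<Longrightarrow> (w r)\<^sup>2 \<le> 2 * amplitude_const n"
proof -
  assume r: "0 \<le> r" "r \<le> 1"
  have "energy 1 \<le> 1" using energy_le small unfolding mult.assoc by linarith
  then have "amplitude_const n * (1 + energy 1) \<le> amplitude_const n * 2"
    using amplitude_const_ge_1 by (intro mult_left_mono) auto
  then show ?thesis using amplitude[OF r] by simp
qed

lemma energy_upper:
  "energy 1 \<le> 2 * real N * (4 / q - (real n - 2)) * (G_max + sqrt (2 * energy 1) * sqrt (2 * amplitude_const n))
    + (4 / q - (real n - 2)) * ((real n - 2) / 2 * (U 1)\<^sup>2 / 2 + sqrt (2 * energy 1) * \<bar>U 1\<bar>)"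
proof -
  have "\<bar>w r\<bar> \<le> sqrt (2 * amplitude_const n)" if "r \<in> {0..1}" for r
    using real_sqrt_le_mono[OF w_square_le[of r]] that by simp
  then have "energy 1 \<le> 2 * real N * (4 / q - (real n - 2)) * (G_max + sqrt (2 * energy 1) * sqrt (2 * amplitude_const n))
    + (4 / q - (real n - 2)) * (sqrt (2 / q * (real n - 2 - 2 / q)) * (U 1)\<^sup>2 / 2 + sqrt (2 * energy 1) * \<bar>U 1\<bar>)"
    using count unfolding energy_count_def w_1 by blast
  also have "sqrt (2 / q * (real n - 2 - 2 / q)) \<le> (real n - 2) / 2"
    using real_sqrt_le_mono[OF stiffness_le] n2_pos by simp
  finally show ?thesis
    using damping_pos by (simp add: mult_left_mono mult_right_mono)
qed

lemma energy_lower: "2 * real N * (4 / q - (real n - 2)) * G_max \<le> energy 1"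
  using count unfolding energy_count_def by blast

lemma outer_uniform:
  assumes \<rho>: "0 < \<rho>" "\<rho> \<le> r" "r \<le> 1"
  shows "\<bar>U r - (U 1 - V 1 * (r powr (2 - real n) - 1) / (real n - 2))\<bar>
    \<le> \<rho> powr (1 - real n) * (\<rho> powr (- growth_const n / 2) * sqrt ((U 1)\<^sup>2 + (2 / q * U 1 + V 1)\<^sup>2)) powr (q + 1)"
proof (rule outer_estimate[OF _ _ \<rho>])
  fix r :: real assume r: "0 < r" "r < 1"
  \<comment> \<open>The base \<open>1 + 2 * amplitude_const n\<close> is at least \<open>1\<close>,
    so its power is monotone in the exponent and \<open>q\<close> can be replaced by the critical
    value.\<close>
  have "(w r)\<^sup>2 \<le> (1 + 2 * amplitude_const n)\<^sup>2"
    using w_square_le[of r] r amplitude_const_ge_1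
    by (intro order_trans[OF w_square_le]) (auto simp: power2_eq_square algebra_simps)
  then have "\<bar>w r\<bar> \<le> 1 + 2 * amplitude_const n"
    using amplitude_const_ge_1 by (simp add: abs_le_square_iff[symmetric])
  then have "\<bar>w r\<bar> powr q \<le> (1 + 2 * amplitude_const n) powr q"
    using q_gt_0 by (intro powr_mono2) auto
  also have "\<dots> \<le> (1 + 2 * amplitude_const n) powr (4 / (real n - 2))"
    using q_lt amplitude_const_ge_1 by (intro powr_mono) auto
  finally show "\<bar>w r\<bar> powr q \<le> (1 + 2 * amplitude_const n) powr (4 / (real n - 2))" .
next
  have "4 / q \<le> 2 * (real n - 2)"
    using q_gt q_gt_0 n2_pos by (simp add: field_simps)
  then show "1 + 2 / q * (real n - 2 - 2 / q) + (1 + 2 * amplitude_const n) powr (4 / (real n - 2)) + 4 / q \<le> growth_const n"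
    using stiffness_le by (simp add: growth_const_def)
qed

end

end

section \<open>Uniform limits on compact sets away from the origin\<close>

lemma uniform_limit_of_bound:
  fixes f :: "'b \<Rightarrow> 'a \<Rightarrow> 'c::metric_space"
  assumes "\<forall>\<^sub>F \<epsilon> in F. \<forall>x\<in>K. dist (f \<epsilon> x) (l x) \<le> h \<epsilon>" "(h \<longlongrightarrow> 0) F"
  shows "uniform_limit K f l F"
proof (rule uniform_limitI)
  fix e :: real assume "0 < e"
  then have "\<forall>\<^sub>F \<epsilon> in F. h \<epsilon> < e" using order_tendstoD(2)[OF assms(2)] by simp
  with assms(1) show "\<forall>\<^sub>F \<epsilon> in F. \<forall>x\<in>K. dist (f \<epsilon> x) (l x) < e"
    by eventually_elim force
qed

lemma compact_norm_lower_bound: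
  fixes K :: "'a::real_normed_vector set"
  assumes "compact K" "K \<subseteq> cball 0 1 - {0}"
  obtains \<rho> where "0 < \<rho>" "\<rho> \<le> 1" "\<And>x. x \<in> K \<Longrightarrow> \<rho> \<le> norm x \<and> norm x \<le> 1"
proof (cases "K = {}")
  case True
  then show ?thesis using that[of 1] by simp
next
  case False
  then obtain x0 where x0: "x0 \<in> K" "\<And>x. x \<in> K \<Longrightarrow> norm x0 \<le> norm x"
    using continuous_attains_inf[OF assms(1), of norm] by (auto intro: continuous_intros)
  show ?thesis
    by (rule that[of "norm x0"]) (use x0 assms(2) in auto)
qed

text \<open>The common end of both boundary conditions: \<open>Y\<close> is the size of the boundary
  datum, \<open>h\<close> the limit shape, \<open>s\<close> the normalising factor. Since
  \<open>s\<close> may blow up, the error is grouped as \<open>Y powr q\<close> times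
  \<open>Y * s\<close>; the first factor tends to \<open>0\<close> and the second converges.\<close>

lemma uniform_limit_of_outer_approx:
  fixes u :: "real \<Rightarrow> 'a::real_normed_vector \<Rightarrow> real"
  assumes K: "compact K" "K \<subseteq> cball 0 1 - {0}"
    and u: "\<forall>\<^sub>F \<epsilon> in F. \<forall>x\<in>cball 0 1. u \<epsilon> x = U \<epsilon> (norm x)"
    and outer: "\<And>\<rho>. 0 < \<rho> \<Longrightarrow> \<rho> \<le> 1 \<Longrightarrow>
      \<exists>R. \<forall>\<^sub>F \<epsilon> in F. \<forall>r\<in>{\<rho>..1}. \<bar>\<bar>U \<epsilon> r\<bar> - Y \<epsilon> * h r\<bar> \<le> R * Y \<epsilon> powr (q \<epsilon> + 1)"
    and h: "\<And>\<rho> r. 0 < \<rho> \<Longrightarrow> \<rho> \<le> r \<Longrightarrow> r \<le> 1 \<Longrightarrow> 0 \<le> h r \<and> h r \<le> h \<rho>"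
    and Y: "\<And>\<epsilon>. 0 \<le> Y \<epsilon>" "(Y \<longlongrightarrow> 0) F" and q: "(q \<longlongrightarrow> q0) F" "0 < q0"
    and s: "\<forall>\<^sub>F \<epsilon> in F. 0 \<le> s \<epsilon>" "((\<lambda>\<epsilon>. Y \<epsilon> * s \<epsilon>) \<longlongrightarrow> A) F"
  shows "uniform_limit K (\<lambda>\<epsilon> x. \<bar>u \<epsilon> x\<bar> * s \<epsilon>) (\<lambda>x. A * h (norm x)) F" "uniform_limit K u (\<lambda>x. 0) F"
proof -
  obtain \<rho> where \<rho>: "0 < \<rho>" "\<rho> \<le> 1" "\<And>x. x \<in> K \<Longrightarrow> \<rho> \<le> norm x \<and> norm x \<le> 1"
    using compact_norm_lower_bound[OF K] by metis
  obtain R where R: "\<forall>\<^sub>F \<epsilon> in F. \<forall>r\<in>{\<rho>..1}. \<bar>\<bar>U \<epsilon> r\<bar> - Y \<epsilon> * h r\<bar> \<le> R * Y \<epsilon> powr (q \<epsilon> + 1)"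
    using outer[OF \<rho>(1,2)] by blast
  have Yq: "((\<lambda>\<epsilon>. Y \<epsilon> powr q \<epsilon>) \<longlongrightarrow> 0) F"
    using tendsto_powr'[OF Y(2) q(1)] q(2) Y(1) by simp
  have Yq1: "Y \<epsilon> powr (q \<epsilon> + 1) = Y \<epsilon> powr q \<epsilon> * Y \<epsilon>" for \<epsilon>
    using Y(1)[of \<epsilon>] by (cases "Y \<epsilon> = 0") (simp_all add: powr_add)
  have bound: "\<forall>\<^sub>F \<epsilon> in F. \<forall>x\<in>K. \<bar>\<bar>u \<epsilon> x\<bar> - Y \<epsilon> * h (norm x)\<bar> \<le> R * (Y \<epsilon> powr q \<epsilon> * Y \<epsilon>)"
    using u R
  proof eventually_elim
    case (elim \<epsilon>)
    show ?case
    proof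
      fix x assume "x \<in> K"
      with K \<rho>(3) have "u \<epsilon> x = U \<epsilon> (norm x)" "norm x \<in> {\<rho>..1}" using elim(1) by auto
      with elim(2) show "\<bar>\<bar>u \<epsilon> x\<bar> - Y \<epsilon> * h (norm x)\<bar> \<le> R * (Y \<epsilon> powr q \<epsilon> * Y \<epsilon>)"
        unfolding Yq1[symmetric] by simp
    qed
  qed
  have hK: "0 \<le> h (norm x) \<and> h (norm x) \<le> h \<rho>" if "x \<in> K" for x
    using h[OF \<rho>(1)] \<rho>(3)[OF that] by blast
  show "uniform_limit K (\<lambda>\<epsilon> x. \<bar>u \<epsilon> x\<bar> * s \<epsilon>) (\<lambda>x. A * h (norm x)) F"
  proof (rule uniform_limit_of_bound)
    show "\<forall>\<^sub>F \<epsilon> in F. \<forall>x\<in>K. dist (\<bar>u \<epsilon> x\<bar> * s \<epsilon>) (A * h (norm x))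
        \<le> R * (Y \<epsilon> powr q \<epsilon> * (Y \<epsilon> * s \<epsilon>)) + \<bar>Y \<epsilon> * s \<epsilon> - A\<bar> * h \<rho>"
      using bound s(1)
    proof eventually_elim
      case (elim \<epsilon>)
      show ?case
      proof
        fix x assume x: "x \<in> K"
        have "dist (\<bar>u \<epsilon> x\<bar> * s \<epsilon>) (A * h (norm x))
          = \<bar>(\<bar>u \<epsilon> x\<bar> - Y \<epsilon> * h (norm x)) * s \<epsilon> + (Y \<epsilon> * s \<epsilon> - A) * h (norm x)\<bar>"
          by (simp add: dist_real_def algebra_simps)
        also have "\<dots> \<le> \<bar>\<bar>u \<epsilon> x\<bar> - Y \<epsilon> * h (norm x)\<bar> * s \<epsilon> + \<bar>Y \<epsilon> * s \<epsilon> - A\<bar> * h (norm x)"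
          using elim(2) hK[OF x] by (intro order_trans[OF abs_triangle_ineq]) (simp add: abs_mult)
        also have "\<dots> \<le> R * (Y \<epsilon> powr q \<epsilon> * Y \<epsilon>) * s \<epsilon> + \<bar>Y \<epsilon> * s \<epsilon> - A\<bar> * h \<rho>"
          using elim x hK[OF x] by (intro add_mono mult_right_mono mult_left_mono) auto
        finally show "dist (\<bar>u \<epsilon> x\<bar> * s \<epsilon>) (A * h (norm x))
          \<le> R * (Y \<epsilon> powr q \<epsilon> * (Y \<epsilon> * s \<epsilon>)) + \<bar>Y \<epsilon> * s \<epsilon> - A\<bar> * h \<rho>"
          by (simp add: mult.assoc)
      qed
    qed
    have "((\<lambda>\<epsilon>. R * (Y \<epsilon> powr q \<epsilon> * (Y \<epsilon> * s \<epsilon>)) + \<bar>Y \<epsilon> * s \<epsilon> - A\<bar> * h \<rho>) \<longlongrightarrow> R * (0 * A) + \<bar>A - A\<bar> * h \<rho>) F"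
      by (intro tendsto_intros Yq s)
    then show "((\<lambda>\<epsilon>. R * (Y \<epsilon> powr q \<epsilon> * (Y \<epsilon> * s \<epsilon>)) + \<bar>Y \<epsilon> * s \<epsilon> - A\<bar> * h \<rho>) \<longlongrightarrow> 0) F"
      by simp
  qed
  show "uniform_limit K u (\<lambda>x. 0) F"
  proof (rule uniform_limit_of_bound)
    show "\<forall>\<^sub>F \<epsilon> in F. \<forall>x\<in>K. dist (u \<epsilon> x) 0 \<le> R * (Y \<epsilon> powr q \<epsilon> * Y \<epsilon>) + Y \<epsilon> * h \<rho>"
      using bound
    proof eventually_elim
      case (elim \<epsilon>)
      show ?case
      proof
        fix x assume x: "x \<in> K"
        have "\<bar>u \<epsilon> x\<bar> \<le> R * (Y \<epsilon> powr q \<epsilon> * Y \<epsilon>) + Y \<epsilon> * h (norm x)"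
          using bspec[OF elim x] by linarith
        also have "\<dots> \<le> R * (Y \<epsilon> powr q \<epsilon> * Y \<epsilon>) + Y \<epsilon> * h \<rho>"
          using hK[OF x] Y(1) by (simp add: mult_left_mono)
        finally show "dist (u \<epsilon> x) 0 \<le> R * (Y \<epsilon> powr q \<epsilon> * Y \<epsilon>) + Y \<epsilon> * h \<rho>"
          by (simp add: dist_real_def)
      qed
    qed
    have "((\<lambda>\<epsilon>. R * (Y \<epsilon> powr q \<epsilon> * Y \<epsilon>) + Y \<epsilon> * h \<rho>) \<longlongrightarrow> R * (0 * 0) + 0 * h \<rho>) F"
      by (intro tendsto_intros Yq Y)
    then show "((\<lambda>\<epsilon>. R * (Y \<epsilon> powr q \<epsilon> * Y \<epsilon>) + Y \<epsilon> * h \<rho>) \<longlongrightarrow> 0) F"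
      by simp
  qed
qed

section \<open>Families of solutions as \<epsilon> tends to zero\<close>

locale bubble_family =
  fixes n N :: nat and U V :: "real \<Rightarrow> real \<Rightarrow> real"
  assumes n_ge: "3 \<le> n" and N_pos: "0 < N"
    and ode: "\<And>\<epsilon>. 0 < \<epsilon> \<Longrightarrow> \<epsilon> < 2 / (real n - 2) \<Longrightarrow> counted_ode n (4 / (real n - 2) - \<epsilon>) (U \<epsilon>) (V \<epsilon>) N"
begin

definition q :: "real \<Rightarrow> real" where "q \<epsilon> = 4 / (real n - 2) - \<epsilon>"
definition c :: "real \<Rightarrow> real" where "c \<epsilon> = 4 / q \<epsilon> - (real n - 2)"
definition b :: "real \<Rightarrow> real" where "b \<epsilon> = 2 / q \<epsilon> * (real n - 2 - 2 / q \<epsilon>)"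
definition area :: "real \<Rightarrow> real" where "area \<epsilon> = hom_area (q \<epsilon>) (b \<epsilon>) (hom_peak (q \<epsilon>) (b \<epsilon>))"
text \<open>The energy at \<open>r = 1\<close> written out as in \<open>energy_1\<close>, so that it
  is available as a function of \<epsilon> without fixing one system.\<close>

definition E :: "real \<Rightarrow> real" where
  "E \<epsilon> = c \<epsilon> * (U \<epsilon> 1)\<^sup>2 / q \<epsilon> + 2 / q \<epsilon> * U \<epsilon> 1 * V \<epsilon> 1 + (V \<epsilon> 1)\<^sup>2 / 2
    + \<bar>U \<epsilon> 1\<bar> powr (q \<epsilon> + 2) / (q \<epsilon> + 2)"

lemma n2_pos: "0 < real n - 2" using n_ge by linarith

lemma eventually_small: "0 < e \<Longrightarrow> \<forall>\<^sub>F \<epsilon> in at_right 0. 0 < \<epsilon> \<and> \<epsilon> < (e::real)"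
  using eventually_at_right_real[of 0 e] by (auto elim: eventually_mono)

lemma q_tendsto: "(q \<longlongrightarrow> 4 / (real n - 2)) (at_right 0)"
  unfolding q_def by (auto intro!: tendsto_eq_intros)

lemma q_crit_pos: "0 < 4 / (real n - 2)" using n2_pos by simp

lemma c_tendsto: "(c \<longlongrightarrow> 0) (at_right 0)"
proof -
  have "(c \<longlongrightarrow> 4 / (4 / (real n - 2)) - (real n - 2)) (at_right 0)"
    unfolding c_def using n2_pos by (intro tendsto_intros q_tendsto) auto
  moreover have "4 / (4 / (real n - 2)) - (real n - 2) = 0"
    using n2_pos by (simp add: field_simps)
  ultimately show ?thesis by (simp only:)
qed

text \<open>For small positive \<epsilon> the quotient is exactly
  \<open>(n - 2) / q \<epsilon>\<close>.\<close>

lemma c_over_eps_tendsto: "((\<lambda>\<epsilon>. c \<epsilon> / \<epsilon>) \<longlongrightarrow> (real n - 2)\<^sup>2 / 4) (at_right 0)"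
proof -
  have "((\<lambda>\<epsilon>. (real n - 2) / q \<epsilon>) \<longlongrightarrow> (real n - 2) / (4 / (real n - 2))) (at_right 0)"
    using n2_pos by (intro tendsto_intros q_tendsto) auto
  moreover have "\<forall>\<^sub>F \<epsilon> in at_right 0. (real n - 2) / q \<epsilon> = c \<epsilon> / \<epsilon>"
    using eventually_small[OF q_crit_pos]
  proof eventually_elim
    case (elim \<epsilon>)
    then have "0 < q \<epsilon>" by (simp add: q_def)
    moreover have "4 - (real n - 2) * q \<epsilon> = (real n - 2) * \<epsilon>"
      using n2_pos by (simp add: q_def field_simps)
    ultimately show ?case
      using elim by (simp add: c_def divide_simps)
  qed
  ultimately show ?thesis
    by (simp add: tendsto_cong power2_eq_square)
qed

lemma b_tendsto: "(b \<longlongrightarrow> ((real n - 2) / 2)\<^sup>2) (at_right 0)"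
proof -
  have "(b \<longlongrightarrow> 2 / (4 / (real n - 2)) * (real n - 2 - 2 / (4 / (real n - 2)))) (at_right 0)"
    unfolding b_def using n2_pos by (intro tendsto_intros q_tendsto) auto
  also have "2 / (4 / (real n - 2)) * (real n - 2 - 2 / (4 / (real n - 2))) = ((real n - 2) / 2)\<^sup>2"
    using n2_pos by (simp add: power2_eq_square field_simps)
  finally show ?thesis .
qed

lemma area_tendsto: "(area \<longlongrightarrow> limit_area n) (at_right 0)"
proof -
  have "(area \<longlongrightarrow> hom_area (4 / (real n - 2)) (((real n - 2) / 2)\<^sup>2)
      (hom_peak (4 / (real n - 2)) (((real n - 2) / 2)\<^sup>2))) (at_right 0)"
    unfolding area_def using n2_pos by (intro tendsto_hom_area_peak q_tendsto b_tendsto) auto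
  then show ?thesis
    using n_ge by (simp only: hom_area_critical limit_area_def)
qed

lemma eventually_estimates:
  "\<forall>\<^sub>F \<epsilon> in at_right 0. 0 < c \<epsilon> \<and> 0 \<le> E \<epsilon> \<and> E \<epsilon> \<le> 2 * c \<epsilon> * energy_const n N
    \<and> 2 * real N * c \<epsilon> * area \<epsilon> \<le> E \<epsilon>
    \<and> E \<epsilon> \<le> 2 * real N * c \<epsilon> * (area \<epsilon> + sqrt (2 * E \<epsilon>) * sqrt (2 * amplitude_const n))
      + c \<epsilon> * ((real n - 2) / 2 * (U \<epsilon> 1)\<^sup>2 / 2 + sqrt (2 * E \<epsilon>) * \<bar>U \<epsilon> 1\<bar>)
    \<and> (\<forall>\<rho> r. 0 < \<rho> \<longrightarrow> \<rho> \<le> r \<longrightarrow> r \<le> 1 \<longrightarrow>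
      \<bar>U \<epsilon> r - (U \<epsilon> 1 - V \<epsilon> 1 * (r powr (2 - real n) - 1) / (real n - 2))\<bar>
        \<le> \<rho> powr (1 - real n)
          * (\<rho> powr (- growth_const n / 2) * sqrt ((U \<epsilon> 1)\<^sup>2 + (2 / q \<epsilon> * U \<epsilon> 1 + V \<epsilon> 1)\<^sup>2)) powr (q \<epsilon> + 1))"
proof -
  have "0 < 2 / (real n - 2)" using n2_pos by simp
  note eventually_small[OF this]
  moreover have "\<forall>\<^sub>F \<epsilon> in at_right 0. area \<epsilon> < limit_area n + 1"
    by (rule order_tendstoD(2)[OF area_tendsto]) simp
  moreover have "\<forall>\<^sub>F \<epsilon> in at_right 0. c \<epsilon> * energy_const n N < 1 / 2"
  proof -
    have "((\<lambda>\<epsilon>. c \<epsilon> * energy_const n N) \<longlongrightarrow> 0 * energy_const n N) (at_right 0)"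
      by (intro tendsto_intros c_tendsto)
    then show ?thesis by (rule order_tendstoD) simp
  qed
  ultimately show ?thesis
  proof eventually_elim
    case (elim \<epsilon>)
    interpret counted_ode n "q \<epsilon>" "U \<epsilon>" "V \<epsilon>" N
      unfolding q_def using ode elim by simp
    have E: "energy 1 = E \<epsilon>"
      unfolding energy_1 E_def c_def ..
    have a: "hom_area (q \<epsilon>) (2 / q \<epsilon> * (real n - 2 - 2 / q \<epsilon>))
        (hom_peak (q \<epsilon>) (2 / q \<epsilon> * (real n - 2 - 2 / q \<epsilon>))) \<le> limit_area n + 1"
      using elim unfolding area_def b_def by simp
    have sm: "(4 / q \<epsilon> - (real n - 2)) * energy_const n N \<le> 1 / 2"
      using elim unfolding c_def by simp
    show ?case
      using damping_pos energy_nonneg[of 1] energy_le[OF a sm] energy_lower[OF a sm] energy_upper[OF a sm] outer_uniform[OF a sm]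
      unfolding E area_def b_def c_def by simp
  qed
qed

lemma E_tendsto: "(E \<longlongrightarrow> 0) (at_right 0)"
proof (rule tendsto_sandwich)
  show "\<forall>\<^sub>F \<epsilon> in at_right 0. 0 \<le> E \<epsilon>" "\<forall>\<^sub>F \<epsilon> in at_right 0. E \<epsilon> \<le> 2 * c \<epsilon> * energy_const n N"
    using eventually_estimates by (auto elim: eventually_mono)
  have "((\<lambda>\<epsilon>. 2 * c \<epsilon> * energy_const n N) \<longlongrightarrow> 2 * 0 * energy_const n N) (at_right 0)"
    by (intro tendsto_intros c_tendsto)
  then show "((\<lambda>\<epsilon>. 2 * c \<epsilon> * energy_const n N) \<longlongrightarrow> 0) (at_right 0)" by simp
qed simp

text \<open>After division by \<open>c\<close> every error term contains \<open>sqrt E\<close> or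
  \<open>U 1\<close>, so lower and upper bounds have the same limit. That \<open>U 1\<close>
  vanishes in the limit is an assumption here because its proof depends on the boundary
  condition.\<close>

lemma E_over_c_tendsto:
  assumes U1: "((\<lambda>\<epsilon>. U \<epsilon> 1) \<longlongrightarrow> 0) (at_right 0)"
  shows "((\<lambda>\<epsilon>. E \<epsilon> / c \<epsilon>) \<longlongrightarrow> 2 * real N * limit_area n) (at_right 0)"
proof (rule tendsto_sandwich)
  let ?up = "\<lambda>\<epsilon>. 2 * real N * (area \<epsilon> + sqrt (2 * E \<epsilon>) * sqrt (2 * amplitude_const n))
      + ((real n - 2) / 2 * (U \<epsilon> 1)\<^sup>2 / 2 + sqrt (2 * E \<epsilon>) * \<bar>U \<epsilon> 1\<bar>)"
  show "\<forall>\<^sub>F \<epsilon> in at_right 0. 2 * real N * area \<epsilon> \<le> E \<epsilon> / c \<epsilon>"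
    using eventually_estimates by eventually_elim (simp add: pos_le_divide_eq mult_ac)
  show "\<forall>\<^sub>F \<epsilon> in at_right 0. E \<epsilon> / c \<epsilon> \<le> ?up \<epsilon>"
    using eventually_estimates
  proof eventually_elim
    case (elim \<epsilon>)
    have "?up \<epsilon> * c \<epsilon> = 2 * real N * c \<epsilon> * (area \<epsilon> + sqrt (2 * E \<epsilon>) * sqrt (2 * amplitude_const n))
      + c \<epsilon> * ((real n - 2) / 2 * (U \<epsilon> 1)\<^sup>2 / 2 + sqrt (2 * E \<epsilon>) * \<bar>U \<epsilon> 1\<bar>)"
      by (simp add: algebra_simps)
    with elim have "E \<epsilon> \<le> ?up \<epsilon> * c \<epsilon>" by (simp only:)
    then show ?case using elim by (simp only: pos_divide_le_eq)
  qed
  show "((\<lambda>\<epsilon>. 2 * real N * area \<epsilon>) \<longlongrightarrow> 2 * real N * limit_area n) (at_right 0)"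
    by (intro tendsto_intros area_tendsto)
  have "(?up \<longlongrightarrow> 2 * real N * (limit_area n + sqrt (2 * 0) * sqrt (2 * amplitude_const n))
      + ((real n - 2) / 2 * 0\<^sup>2 / 2 + sqrt (2 * 0) * \<bar>0\<bar>)) (at_right 0)"
    by (intro tendsto_intros area_tendsto E_tendsto U1) auto
  then show "(?up \<longlongrightarrow> 2 * real N * limit_area n) (at_right 0)" by simp
qed

lemma kappa_pos: "0 < kappa n"
proof -
  have G: "0 < Gamma (real n / 2)" "0 < Gamma (real n)"
    using n2_pos by (auto intro!: Gamma_real_pos)
  show ?thesis
    unfolding kappa_def by (intro mult_pos_pos divide_pos_pos zero_less_power G) (use n2_pos in auto)
qed

text \<open>Dividing by \<open>kappa n\<close> cancels the Gamma factors of
  \<open>limit_area n\<close>; only elementary powers survive.\<close>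

lemma E_over_kappa_eps_tendsto:
  assumes U1: "((\<lambda>\<epsilon>. U \<epsilon> 1) \<longlongrightarrow> 0) (at_right 0)"
  shows "((\<lambda>\<epsilon>. E \<epsilon> / (kappa n * \<epsilon>)) \<longlongrightarrow>
    2 * real N * (real n * (real n - 2)) powr ((real n - 2) / 2) * ((real n - 2)\<^sup>2 / 4)) (at_right 0)"
proof -
  have "((\<lambda>\<epsilon>. E \<epsilon> / c \<epsilon> * (c \<epsilon> / \<epsilon>) / kappa n) \<longlongrightarrow>
    2 * real N * limit_area n * ((real n - 2)\<^sup>2 / 4) / kappa n) (at_right 0)"
    using kappa_pos by (intro tendsto_intros E_over_c_tendsto c_over_eps_tendsto U1) auto
  moreover have "\<forall>\<^sub>F \<epsilon> in at_right 0. E \<epsilon> / c \<epsilon> * (c \<epsilon> / \<epsilon>) / kappa n = E \<epsilon> / (kappa n * \<epsilon>)"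
    using eventually_estimates by eventually_elim (simp add: mult.commute)
  ultimately show ?thesis
    using kappa_pos by (simp add: tendsto_cong limit_area_def mult_ac)
qed

end

section \<open>Boundary conditions and the number of complete nodal domains\<close>

context radial_ode
begin

lemma G_max_pos: "0 < G_max"
proof -
  have "0 < Beta (2 / q) (3 / 2)"
    using q_gt_0 by (auto simp: Beta_def intro!: mult_pos_pos divide_pos_pos Gamma_real_pos add_pos_pos)
  then show ?thesis
    using q_gt_0 stiffness_pos hom_peak_pos[OF q_gt_0 stiffness_pos] unfolding hom_area_peak_eq_Beta[OF q_gt_0 stiffness_pos]
    by (intro mult_pos_pos divide_pos_pos) auto
qed

lemma counted_ode_dirichlet:
  assumes "U 1 = 0" and fin: "finite {r \<in> {0<..<1}. U r = 0}" and card: "card {r \<in> {0<..<1}. U r = 0} = k"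
  shows "counted_ode n q U V (Suc k)"
proof
  show "energy_count (Suc k)"
    by (rule energy_count_dirichlet) (use assms in \<open>simp_all only: w_1 zeros_w\<close>)
qed

lemma counted_ode_neumann:
  assumes V1: "V 1 = 0" and fin: "finite {r \<in> {0<..<1}. U r = 0}" and card: "card {r \<in> {0<..<1}. U r = 0} = Suc k"
  shows "counted_ode n q U V (Suc k)"
proof
  \<comment> \<open>If both data vanished, the Dirichlet count would make the energy at
    \<open>1\<close> positive, although \<open>energy_1\<close> gives \<open>0\<close>. This
    replaces an appeal to uniqueness for the differential equation.\<close>
  have "U 1 \<noteq> 0"
  proof
    assume U1: "U 1 = 0"
    interpret counted_ode n q U V "Suc (Suc k)"
      by (rule counted_ode_dirichlet[OF U1 fin card])
    have "0 < 2 * real (Suc (Suc k)) * (4 / q - (real n - 2)) * G_max"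
      by (intro mult_pos_pos G_max_pos damping_pos) auto
    also have "\<dots> \<le> energy 1"
      using count unfolding energy_count_def by blast
    also have "energy 1 = 0"
      unfolding energy_1 U1 V1 by simp
    finally show False by simp
  qed
  then have "0 < w 1 * z 1"
    unfolding w_1 z_1 V1 using q_gt_0 by (auto simp: zero_less_mult_iff zero_less_divide_iff neq_iff)
  then show "energy_count (Suc k)"
    by (rule energy_count_neumann) (use assms in \<open>simp_all only: zeros_w\<close>)
qed

end

lemma tendsto_mult_ln_0: "((\<lambda>x::real. x * ln x) \<longlongrightarrow> 0) (at_right 0)"
proof -
  have "((\<lambda>x::real. - (ln (inverse x) / inverse x)) \<longlongrightarrow> - 0) (at_right 0)"
    by (intro tendsto_minus filterlim_compose[OF ln_x_over_x_tendsto_0 filterlim_inverse_at_top_right])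
  moreover have "\<forall>\<^sub>F x in at_right (0::real). - (ln (inverse x) / inverse x) = x * ln x"
    using eventually_at_right_less[of "0::real"] by eventually_elim (simp add: ln_inverse divide_inverse)
  ultimately show ?thesis by (simp add: tendsto_cong)
qed

context bubble_family
begin

text \<open>The point is that \<open>R\<close> does not depend on \<epsilon>: the exponent
  \<open>q \<epsilon> + 1\<close> varies, but as \<open>g * k\<close> is at least \<open>1\<close>
  its power is bounded by the one at the critical exponent.\<close>

lemma eventually_outer:
  assumes \<rho>: "0 < \<rho>" "\<rho> \<le> 1" and k: "1 \<le> k"
    and D: "\<forall>\<^sub>F \<epsilon> in at_right 0. sqrt ((U \<epsilon> 1)\<^sup>2 + (2 / q \<epsilon> * U \<epsilon> 1 + V \<epsilon> 1)\<^sup>2) \<le> k * Y \<epsilon>"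
    and Y: "\<And>\<epsilon>. 0 \<le> Y \<epsilon>"
  shows "\<exists>R. \<forall>\<^sub>F \<epsilon> in at_right 0. \<forall>r\<in>{\<rho>..1}.
    \<bar>U \<epsilon> r - (U \<epsilon> 1 - V \<epsilon> 1 * (r powr (2 - real n) - 1) / (real n - 2))\<bar> \<le> R * Y \<epsilon> powr (q \<epsilon> + 1)"
proof (intro exI)
  define g where "g = \<rho> powr (- growth_const n / 2)"
  have "0 \<le> growth_const n" unfolding growth_const_def using n2_pos by (intro add_nonneg_nonneg) auto
  then have "1 \<le> g"
    unfolding g_def using \<rho> powr_mono2'[of "- growth_const n / 2" \<rho> 1] by simp
  then have gk: "1 \<le> g * k" using k mult_mono[of 1 g 1 k] by simp
  show "\<forall>\<^sub>F \<epsilon> in at_right 0. \<forall>r\<in>{\<rho>..1}.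
    \<bar>U \<epsilon> r - (U \<epsilon> 1 - V \<epsilon> 1 * (r powr (2 - real n) - 1) / (real n - 2))\<bar>
      \<le> \<rho> powr (1 - real n) * (g * k) powr (4 / (real n - 2) + 1) * Y \<epsilon> powr (q \<epsilon> + 1)"
    using eventually_estimates D eventually_small[OF q_crit_pos]
  proof eventually_elim
    case (elim \<epsilon>)
    then have q: "0 < q \<epsilon>" "q \<epsilon> \<le> 4 / (real n - 2)" by (auto simp: q_def)
    let ?D = "sqrt ((U \<epsilon> 1)\<^sup>2 + (2 / q \<epsilon> * U \<epsilon> 1 + V \<epsilon> 1)\<^sup>2)"
    have D: "?D \<le> k * Y \<epsilon>" using elim by blast
    show ?case
    proof
      fix r assume r: "r \<in> {\<rho>..1}"
      have "\<bar>U \<epsilon> r - (U \<epsilon> 1 - V \<epsilon> 1 * (r powr (2 - real n) - 1) / (real n - 2))\<bar>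
        \<le> \<rho> powr (1 - real n) * (g * ?D) powr (q \<epsilon> + 1)"
        using elim(1) r \<rho> unfolding g_def by simp
      also have "\<dots> \<le> \<rho> powr (1 - real n) * ((g * k) * Y \<epsilon>) powr (q \<epsilon> + 1)"
        using q \<open>1 \<le> g\<close> D by (intro mult_left_mono powr_mono2) (auto simp: mult.assoc)
      also have "\<dots> = \<rho> powr (1 - real n) * ((g * k) powr (q \<epsilon> + 1) * Y \<epsilon> powr (q \<epsilon> + 1))"
        using gk Y by (subst powr_mult) auto
      also have "\<dots> \<le> \<rho> powr (1 - real n) * ((g * k) powr (4 / (real n - 2) + 1) * Y \<epsilon> powr (q \<epsilon> + 1))"
        using q gk by (intro mult_left_mono mult_right_mono powr_mono) auto
      finally show "\<bar>U \<epsilon> r - (U \<epsilon> 1 - V \<epsilon> 1 * (r powr (2 - real n) - 1) / (real n - 2))\<bar>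
        \<le> \<rho> powr (1 - real n) * (g * k) powr (4 / (real n - 2) + 1) * Y \<epsilon> powr (q \<epsilon> + 1)"
        by (simp add: mult.assoc)
    qed
  qed
qed

text \<open>With \<open>U 1 = 0\<close> the energy is \<open>V 1\<close> squared over two, so
  \<open>|V 1| = sqrt (2 * E)\<close> is known to leading order and serves as
  \<open>Y\<close>.\<close>

lemma dirichlet_limit:
  fixes u :: "real \<Rightarrow> 'a::real_normed_vector \<Rightarrow> real"
  assumes U1: "\<forall>\<^sub>F \<epsilon> in at_right 0. U \<epsilon> 1 = 0"
    and u: "\<forall>\<^sub>F \<epsilon> in at_right 0. \<forall>x\<in>cball 0 1. u \<epsilon> x = U \<epsilon> (norm x)"
    and K: "compact K" "K \<subseteq> cball 0 1 - {0}"
  shows "uniform_limit K (\<lambda>\<epsilon> x. \<bar>u \<epsilon> x\<bar> * (kappa n * \<epsilon>) powr (- 1 / 2))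
      (\<lambda>x. (real n * (real n - 2)) powr ((real n - 2) / 4) * real N powr (1 / 2) * (norm x powr (2 - real n) - 1)) (at_right 0)"
    and "uniform_limit K u (\<lambda>x. 0) (at_right 0)"
proof -
  let ?Y = "\<lambda>\<epsilon>. \<bar>V \<epsilon> 1\<bar>" and ?h = "\<lambda>r. (r powr (2 - real n) - 1) / (real n - 2)"
  let ?a = "(real n - 2) / 2" and ?s = "\<lambda>\<epsilon>. (kappa n * \<epsilon>) powr (- 1 / 2)"
  \<comment> \<open>The factor \<open>n - 2\<close> that the root extracts from the limit of
    \<open>c / \<epsilon>\<close> will cancel the denominator of \<open>?h\<close>.\<close>
  define A where "A = sqrt (2 * (2 * real N * (real n * (real n - 2)) powr ?a * ((real n - 2)\<^sup>2 / 4)))"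
  have U1': "((\<lambda>\<epsilon>. U \<epsilon> 1) \<longlongrightarrow> 0) (at_right 0)"
    using U1 by (rule tendsto_eventually)
  have Y: "\<forall>\<^sub>F \<epsilon> in at_right 0. ?Y \<epsilon> = sqrt (2 * E \<epsilon>)"
    using U1 by eventually_elim (simp add: E_def)
  have Y0: "(?Y \<longlongrightarrow> 0) (at_right 0)"
  proof -
    have "((\<lambda>\<epsilon>. sqrt (2 * E \<epsilon>)) \<longlongrightarrow> sqrt (2 * 0)) (at_right 0)"
      by (intro tendsto_intros E_tendsto)
    then show ?thesis using Y by (simp add: tendsto_cong)
  qed
  have YA: "((\<lambda>\<epsilon>. ?Y \<epsilon> * ?s \<epsilon>) \<longlongrightarrow> A) (at_right 0)"
  proof -
    have "((\<lambda>\<epsilon>. sqrt (2 * (E \<epsilon> / (kappa n * \<epsilon>)))) \<longlongrightarrow> A) (at_right 0)"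
      unfolding A_def by (intro tendsto_intros E_over_kappa_eps_tendsto U1')
    moreover have "\<forall>\<^sub>F \<epsilon> in at_right 0. sqrt (2 * (E \<epsilon> / (kappa n * \<epsilon>))) = ?Y \<epsilon> * ?s \<epsilon>"
      using Y eventually_small[OF q_crit_pos]
    proof eventually_elim
      case (elim \<epsilon>)
      then have "0 < kappa n * \<epsilon>" using kappa_pos by simp
      then have "?s \<epsilon> = 1 / sqrt (kappa n * \<epsilon>)"
        by (simp add: powr_minus_divide powr_half_sqrt)
      then show ?case using elim(1) by (simp add: real_sqrt_divide)
    qed
    ultimately show ?thesis by (simp add: tendsto_cong)
  qed
  have "A = sqrt (real N * (real n * (real n - 2)) powr ?a * (real n - 2)\<^sup>2)"
    by (simp add: A_def)
  also have "\<dots> = sqrt (real N) * sqrt ((real n * (real n - 2)) powr ?a) * (real n - 2)"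
    using n2_pos by (simp add: real_sqrt_mult)
  also have "sqrt ((real n * (real n - 2)) powr ?a) = (real n * (real n - 2)) powr ((real n - 2) / 4)"
    by (simp add: powr_powr flip: powr_half_sqrt)
  finally have A: "A = real N powr (1 / 2) * (real n * (real n - 2)) powr ((real n - 2) / 4) * (real n - 2)"
    by (simp add: powr_half_sqrt)
  have outer: "\<exists>R. \<forall>\<^sub>F \<epsilon> in at_right 0. \<forall>r\<in>{\<rho>..1}. \<bar>\<bar>U \<epsilon> r\<bar> - ?Y \<epsilon> * ?h r\<bar> \<le> R * ?Y \<epsilon> powr (q \<epsilon> + 1)"
    if \<rho>: "0 < \<rho>" "\<rho> \<le> 1" for \<rho>
  proof -
    have "\<forall>\<^sub>F \<epsilon> in at_right 0. sqrt ((U \<epsilon> 1)\<^sup>2 + (2 / q \<epsilon> * U \<epsilon> 1 + V \<epsilon> 1)\<^sup>2) \<le> 1 * ?Y \<epsilon>"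
      using U1 by eventually_elim simp
    from eventually_outer[OF \<rho> order_refl this] obtain R where
      "\<forall>\<^sub>F \<epsilon> in at_right 0. \<forall>r\<in>{\<rho>..1}.
        \<bar>U \<epsilon> r - (U \<epsilon> 1 - V \<epsilon> 1 * (r powr (2 - real n) - 1) / (real n - 2))\<bar> \<le> R * ?Y \<epsilon> powr (q \<epsilon> + 1)"
      by auto
    then have "\<forall>\<^sub>F \<epsilon> in at_right 0. \<forall>r\<in>{\<rho>..1}. \<bar>\<bar>U \<epsilon> r\<bar> - ?Y \<epsilon> * ?h r\<bar> \<le> R * ?Y \<epsilon> powr (q \<epsilon> + 1)"
      using U1
    proof eventually_elim
      case (elim \<epsilon>)
      show ?case
      proof
        fix r assume r: "r \<in> {\<rho>..1}"
        have "1 \<le> r powr (2 - real n)"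
          using r \<rho> n2_pos powr_mono2'[of "2 - real n" r 1] by simp
        then have "?Y \<epsilon> * ?h r = \<bar>V \<epsilon> 1 * ?h r\<bar>"
          using n2_pos by (simp add: abs_mult)
        then have "\<bar>\<bar>U \<epsilon> r\<bar> - ?Y \<epsilon> * ?h r\<bar> \<le> \<bar>U \<epsilon> r - (- (V \<epsilon> 1 * ?h r))\<bar>"
          using abs_triangle_ineq3[of "U \<epsilon> r" "- (V \<epsilon> 1 * ?h r)"] by simp
        also have "\<dots> = \<bar>U \<epsilon> r - (U \<epsilon> 1 - V \<epsilon> 1 * (r powr (2 - real n) - 1) / (real n - 2))\<bar>"
          using elim(2) by simp
        also have "\<dots> \<le> R * ?Y \<epsilon> powr (q \<epsilon> + 1)" using elim(1) r by blast
        finally show "\<bar>\<bar>U \<epsilon> r\<bar> - ?Y \<epsilon> * ?h r\<bar> \<le> R * ?Y \<epsilon> powr (q \<epsilon> + 1)" .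
      qed
    qed
    then show ?thesis by blast
  qed
  have h: "0 \<le> ?h r \<and> ?h r \<le> ?h \<rho>" if "0 < \<rho>" "\<rho> \<le> r" "r \<le> 1" for \<rho> r
    using that n2_pos powr_mono2'[of "2 - real n" r 1] powr_mono2'[of "2 - real n" \<rho> r]
    by (auto intro: divide_right_mono)
  have s: "\<forall>\<^sub>F \<epsilon> in at_right 0. 0 \<le> ?s \<epsilon>" by simp
  note limits = uniform_limit_of_outer_approx[OF K u outer h abs_ge_zero Y0 q_tendsto q_crit_pos s YA]
  show "uniform_limit K u (\<lambda>x. 0) (at_right 0)" by (rule limits(2))
  have "A * ?h (norm x) = (real n * (real n - 2)) powr ((real n - 2) / 4) * real N powr (1 / 2)
      * (norm x powr (2 - real n) - 1)" for x :: 'a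
    using n2_pos by (simp add: A)
  then show "uniform_limit K (\<lambda>\<epsilon> x. \<bar>u \<epsilon> x\<bar> * (kappa n * \<epsilon>) powr (- 1 / 2))
      (\<lambda>x. (real n * (real n - 2)) powr ((real n - 2) / 4) * real N powr (1 / 2) * (norm x powr (2 - real n) - 1)) (at_right 0)"
    using limits(1) by simp
qed

text \<open>The energy determines \<open>|U 1|\<close> through the exponent
  \<open>1 / (q + 2)\<close>, which depends on \<epsilon>, whereas the normalisation uses its limit
  \<open>?p\<close>. The two differ by a multiple of \<epsilon> with bounded factor, and
  \<open>\<epsilon> * ln \<epsilon>\<close> tends to \<open>0\<close>, so the mismatch only costs a
  factor tending to \<open>1\<close>.\<close>

lemma neumann_limit:
  fixes u :: "real \<Rightarrow> 'a::real_normed_vector \<Rightarrow> real"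
  assumes V1: "\<forall>\<^sub>F \<epsilon> in at_right 0. V \<epsilon> 1 = 0"
    and u: "\<forall>\<^sub>F \<epsilon> in at_right 0. \<forall>x\<in>cball 0 1. u \<epsilon> x = U \<epsilon> (norm x)"
    and K: "compact K" "K \<subseteq> cball 0 1 - {0}"
  shows "uniform_limit K (\<lambda>\<epsilon> x. \<bar>u \<epsilon> x\<bar> * (kappa n * \<epsilon>) powr (- (real n - 2) / (2 * real n)))
      (\<lambda>x. (real n * (real n - 2)) powr ((real n - 2) / 4) * real N powr ((real n - 2) / (2 * real n))) (at_right 0)"
    and "uniform_limit K u (\<lambda>x. 0) (at_right 0)"
proof -
  let ?Y = "\<lambda>\<epsilon>. \<bar>U \<epsilon> 1\<bar>" and ?a = "(real n - 2) / 2" and ?p = "(real n - 2) / (2 * real n)"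
  let ?s = "\<lambda>\<epsilon>. (kappa n * \<epsilon>) powr (- (real n - 2) / (2 * real n))" and ?q0 = "4 / (real n - 2)"
  have n0: "0 < real n" using n_ge by simp
  have p: "1 / (?q0 + 2) = ?p" using n2_pos by (simp add: field_simps)
  have E: "\<forall>\<^sub>F \<epsilon> in at_right 0. 0 < \<epsilon> \<and> 0 < q \<epsilon> \<and> q \<epsilon> \<le> ?q0 \<and> 0 < c \<epsilon> \<and> 0 \<le> E \<epsilon>
      \<and> E \<epsilon> = c \<epsilon> * (?Y \<epsilon>)\<^sup>2 / q \<epsilon> + ?Y \<epsilon> powr (q \<epsilon> + 2) / (q \<epsilon> + 2)"
    using V1 eventually_estimates eventually_small[OF q_crit_pos]
    by eventually_elim (simp add: E_def q_def)
  have q2: "((\<lambda>\<epsilon>. 1 / (q \<epsilon> + 2)) \<longlongrightarrow> ?p) (at_right 0)"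
  proof -
    have "((\<lambda>\<epsilon>. 1 / (q \<epsilon> + 2)) \<longlongrightarrow> 1 / (?q0 + 2)) (at_right 0)"
      by (intro tendsto_intros q_tendsto) (use q_crit_pos in linarith)
    then show ?thesis unfolding p .
  qed
  have p_pos: "0 < ?p" using n2_pos n0 by simp
  \<comment> \<open>Dropping the nonnegative \<open>c\<close> term bounds \<open>|U 1|\<close> by a
    power of \<open>E\<close>, which already tends to \<open>0\<close>. This supplies the assumption
    of \<open>E_over_kappa_eps_tendsto\<close>.\<close>
  have Y0: "(?Y \<longlongrightarrow> 0) (at_right 0)"
  proof (rule tendsto_sandwich[where f = "\<lambda>_. 0" and h = "\<lambda>\<epsilon>. ((?q0 + 2) * E \<epsilon>) powr (1 / (q \<epsilon> + 2))"])
    show "\<forall>\<^sub>F \<epsilon> in at_right 0. ?Y \<epsilon> \<le> ((?q0 + 2) * E \<epsilon>) powr (1 / (q \<epsilon> + 2))"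
      using E
    proof eventually_elim
      case (elim \<epsilon>)
      then have pos: "0 < q \<epsilon>" "q \<epsilon> \<le> ?q0" "0 \<le> E \<epsilon>" and "0 \<le> c \<epsilon> * (?Y \<epsilon>)\<^sup>2 / q \<epsilon>" by auto
      with elim have "?Y \<epsilon> powr (q \<epsilon> + 2) / (q \<epsilon> + 2) \<le> E \<epsilon>" by linarith
      then have "?Y \<epsilon> powr (q \<epsilon> + 2) \<le> (q \<epsilon> + 2) * E \<epsilon>"
        using pos by (simp add: pos_divide_le_eq mult.commute)
      also have "\<dots> \<le> (?q0 + 2) * E \<epsilon>"
        using pos by (intro mult_right_mono) auto
      finally have "(?Y \<epsilon> powr (q \<epsilon> + 2)) powr (1 / (q \<epsilon> + 2)) \<le> ((?q0 + 2) * E \<epsilon>) powr (1 / (q \<epsilon> + 2))"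
        using pos by (intro powr_mono2) auto
      then show ?case using pos by (simp add: powr_powr)
    qed
    have "((\<lambda>\<epsilon>. ((?q0 + 2) * E \<epsilon>) powr (1 / (q \<epsilon> + 2))) \<longlongrightarrow> ((?q0 + 2) * 0) powr ?p) (at_right 0)"
    proof (intro tendsto_powr'[OF tendsto_mult[OF tendsto_const E_tendsto] q2] disjI2 conjI)
      show "\<forall>\<^sub>F \<epsilon> in at_right 0. 0 \<le> (?q0 + 2) * E \<epsilon>"
        using E by eventually_elim (use q_crit_pos in auto)
    qed (rule p_pos)
    then show "((\<lambda>\<epsilon>. ((?q0 + 2) * E \<epsilon>) powr (1 / (q \<epsilon> + 2))) \<longlongrightarrow> 0) (at_right 0)"
      by simp
  qed auto
  have U1: "((\<lambda>\<epsilon>. U \<epsilon> 1) \<longlongrightarrow> 0) (at_right 0)"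
    using Y0 by (rule tendsto_rabs_zero_cancel)
  \<comment> \<open>\<open>T\<close> isolates the power term of the energy: after division by
    \<epsilon> the \<open>c\<close> term is a bounded factor times the square of \<open>?Y\<close>,
    hence negligible.\<close>
  define T where "T \<epsilon> = ?Y \<epsilon> powr (q \<epsilon> + 2) / (kappa n * \<epsilon>)" for \<epsilon>
  define T0 where "T0 = real N * (real n * (real n - 2)) powr (real n / 2)"
  have T: "(T \<longlongrightarrow> T0) (at_right 0)"
  proof -
    let ?L = "2 * real N * (real n * (real n - 2)) powr ?a * ((real n - 2)\<^sup>2 / 4)"
    have "((\<lambda>\<epsilon>. (q \<epsilon> + 2) * (E \<epsilon> / (kappa n * \<epsilon>) - c \<epsilon> / \<epsilon> * (?Y \<epsilon>)\<^sup>2 / (q \<epsilon> * kappa n))) \<longlongrightarrow>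
      (?q0 + 2) * (?L - (real n - 2)\<^sup>2 / 4 * 0\<^sup>2 / (?q0 * kappa n))) (at_right 0)"
      by (intro tendsto_mult[OF tendsto_add[OF q_tendsto tendsto_const] tendsto_diff[OF E_over_kappa_eps_tendsto[OF U1]
            tendsto_divide[OF tendsto_mult[OF c_over_eps_tendsto tendsto_power[OF Y0]] tendsto_mult[OF q_tendsto tendsto_const]]]])
        (use n2_pos kappa_pos in auto)
    moreover have "\<forall>\<^sub>F \<epsilon> in at_right 0.
      (q \<epsilon> + 2) * (E \<epsilon> / (kappa n * \<epsilon>) - c \<epsilon> / \<epsilon> * (?Y \<epsilon>)\<^sup>2 / (q \<epsilon> * kappa n)) = T \<epsilon>"
      using E
    proof eventually_elim
      case (elim \<epsilon>)
      then have "E \<epsilon> / (kappa n * \<epsilon>) - c \<epsilon> / \<epsilon> * (?Y \<epsilon>)\<^sup>2 / (q \<epsilon> * kappa n)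
        = ?Y \<epsilon> powr (q \<epsilon> + 2) / (q \<epsilon> + 2) / (kappa n * \<epsilon>)"
        by (simp add: add_divide_distrib mult_ac)
      then show ?case using elim by (simp add: T_def)
    qed
    moreover have "(?q0 + 2) * (?L - (real n - 2)\<^sup>2 / 4 * 0\<^sup>2 / (?q0 * kappa n)) = T0"
    proof -
      \<comment> \<open>Here \<open>?q0 + 2 = 2 * n / (n - 2)\<close>. The resulting factor
        \<open>n * (n - 2)\<close> raises the exponent from \<open>(n - 2) / 2\<close> to
        \<open>n / 2\<close>.\<close>
      have q0: "(?q0 + 2) * ((real n - 2)\<^sup>2 / 4) * 2 = real n * (real n - 2)"
        using n2_pos by (simp add: field_simps power2_eq_square)
      have "(?q0 + 2) * ?L = real N * ((real n * (real n - 2)) powr ?a * ((?q0 + 2) * ((real n - 2)\<^sup>2 / 4) * 2))"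
        by (simp only: mult_ac)
      also note q0
      also have "(real n * (real n - 2)) powr ?a * (real n * (real n - 2)) = (real n * (real n - 2)) powr (?a + 1)"
        using n2_pos n0 by (simp add: powr_add)
      also have "?a + 1 = real n / 2" by (simp add: field_simps)
      finally show ?thesis by (simp add: T0_def)
    qed
    ultimately show ?thesis by (simp add: tendsto_cong)
  qed
  have T0: "0 < T0"
    unfolding T0_def using N_pos n2_pos n0 by simp
  have YA: "((\<lambda>\<epsilon>. ?Y \<epsilon> * ?s \<epsilon>) \<longlongrightarrow> T0 powr ?p * exp (?p / (?q0 + 2) * 0)) (at_right 0)"
  proof -
    have x_ln: "((\<lambda>\<epsilon>. \<epsilon> * ln (kappa n * \<epsilon>)) \<longlongrightarrow> 0) (at_right 0)"
    proof -
      have "((\<lambda>\<epsilon>. \<epsilon> * ln (kappa n) + \<epsilon> * ln \<epsilon>) \<longlongrightarrow> 0 * ln (kappa n) + 0) (at_right 0)"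
        by (intro tendsto_intros tendsto_mult_ln_0)
      moreover have "\<forall>\<^sub>F \<epsilon> in at_right 0. \<epsilon> * ln (kappa n) + \<epsilon> * ln \<epsilon> = \<epsilon> * ln (kappa n * \<epsilon>)"
        using eventually_small[OF q_crit_pos]
        by eventually_elim (use kappa_pos in \<open>simp add: ln_mult distrib_left\<close>)
      ultimately show ?thesis by (simp add: tendsto_cong)
    qed
    \<comment> \<open>The exponential is
      \<open>(kappa n * \<epsilon>) powr (1 / (q \<epsilon> + 2) - ?p)\<close>, rewritten by means
      of \<open>1 / (q \<epsilon> + 2) - 1 / (?q0 + 2) = \<epsilon> / ((q \<epsilon> + 2) * (?q0 +
      2))\<close>.\<close>
    have "((\<lambda>\<epsilon>. T \<epsilon> powr (1 / (q \<epsilon> + 2)) * exp (1 / (q \<epsilon> + 2) / (?q0 + 2) * (\<epsilon> * ln (kappa n * \<epsilon>))))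
      \<longlongrightarrow> T0 powr ?p * exp (?p / (?q0 + 2) * 0)) (at_right 0)"
      using T0 q_crit_pos
      by (intro tendsto_mult[OF tendsto_powr[OF T q2] tendsto_exp[OF tendsto_mult[OF tendsto_divide[OF q2 tendsto_const] x_ln]]])
        linarith+
    moreover have "\<forall>\<^sub>F \<epsilon> in at_right 0.
      T \<epsilon> powr (1 / (q \<epsilon> + 2)) * exp (1 / (q \<epsilon> + 2) / (?q0 + 2) * (\<epsilon> * ln (kappa n * \<epsilon>))) = ?Y \<epsilon> * ?s \<epsilon>"
      using E
    proof eventually_elim
      case (elim \<epsilon>)
      then have k: "0 < kappa n * \<epsilon>" "kappa n \<noteq> 0" "\<epsilon> \<noteq> 0" using kappa_pos by auto
      have gap: "?q0 + 2 - (q \<epsilon> + 2) = \<epsilon>"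
        by (simp add: q_def)
      have "1 / a / d * (d - a) = 1 / a - 1 / d" if "0 < a" "0 < d" for a d :: real
        using that by (simp add: field_simps)
      from this[of "q \<epsilon> + 2" "?q0 + 2"]
      have "1 / (q \<epsilon> + 2) / (?q0 + 2) * \<epsilon> = 1 / (q \<epsilon> + 2) - 1 / (?q0 + 2)"
        unfolding gap using elim q_crit_pos by linarith
      then have "exp (1 / (q \<epsilon> + 2) / (?q0 + 2) * (\<epsilon> * ln (kappa n * \<epsilon>))) = (kappa n * \<epsilon>) powr (1 / (q \<epsilon> + 2) - ?p)"
        using k unfolding p by (simp add: powr_def mult.assoc[symmetric])
      also have "\<dots> = (kappa n * \<epsilon>) powr (1 / (q \<epsilon> + 2)) * ?s \<epsilon>"
        unfolding diff_conv_add_uminus minus_divide_left powr_add ..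
      finally have "T \<epsilon> powr (1 / (q \<epsilon> + 2)) * exp (1 / (q \<epsilon> + 2) / (?q0 + 2) * (\<epsilon> * ln (kappa n * \<epsilon>)))
        = (T \<epsilon> * (kappa n * \<epsilon>)) powr (1 / (q \<epsilon> + 2)) * ?s \<epsilon>"
        using powr_mult[of "T \<epsilon>" "kappa n * \<epsilon>"] k(1) by (simp add: T_def)
      also have "T \<epsilon> * (kappa n * \<epsilon>) = ?Y \<epsilon> powr (q \<epsilon> + 2)"
        using k by (simp add: T_def)
      finally show ?case using elim by (simp add: powr_powr)
    qed
    ultimately show ?thesis by (simp add: tendsto_cong)
  qed
  have "T0 powr ?p = real N powr ?p * ((real n * (real n - 2)) powr (real n / 2)) powr ?p"
    by (simp add: T0_def powr_mult)
  also have "((real n * (real n - 2)) powr (real n / 2)) powr ?p = (real n * (real n - 2)) powr ((real n - 2) / 4)"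
    using n0 by (simp add: powr_powr)
  finally have T0p: "T0 powr ?p * exp (?p / (?q0 + 2) * 0) = (real n * (real n - 2)) powr ((real n - 2) / 4) * real N powr ?p"
    by simp
  have outer: "\<exists>R. \<forall>\<^sub>F \<epsilon> in at_right 0. \<forall>r\<in>{\<rho>..1}. \<bar>\<bar>U \<epsilon> r\<bar> - ?Y \<epsilon> * 1\<bar> \<le> R * ?Y \<epsilon> powr (q \<epsilon> + 1)"
    if \<rho>: "0 < \<rho>" "\<rho> \<le> 1" for \<rho>
  proof -
    have "0 < 2 / (real n - 2)" using n2_pos by simp
    \<comment> \<open>The factor \<open>n - 1\<close> bounds \<open>1 + 2 / q \<epsilon>\<close>, by
      the lower end of the window for \<open>q\<close>.\<close>
    from V1 eventually_small[OF this]
    have "\<forall>\<^sub>F \<epsilon> in at_right 0. sqrt ((U \<epsilon> 1)\<^sup>2 + (2 / q \<epsilon> * U \<epsilon> 1 + V \<epsilon> 1)\<^sup>2) \<le> (real n - 1) * ?Y \<epsilon>"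
    proof eventually_elim
      case (elim \<epsilon>)
      have "4 / (real n - 2) = 2 * (2 / (real n - 2))" by simp
      then have q: "2 / (real n - 2) < q \<epsilon>" using elim unfolding q_def by linarith
      then have q': "0 < q \<epsilon>" using n2_pos divide_pos_pos[of 2 "real n - 2"] by linarith
      have "2 / q \<epsilon> \<le> real n - 2" using q q' n2_pos by (simp add: field_simps)
      have "sqrt ((U \<epsilon> 1)\<^sup>2 + (2 / q \<epsilon> * U \<epsilon> 1 + V \<epsilon> 1)\<^sup>2) \<le> ?Y \<epsilon> + \<bar>2 / q \<epsilon> * U \<epsilon> 1\<bar>"
        using sqrt_sum_squares_le_sum_abs[of "U \<epsilon> 1" "2 / q \<epsilon> * U \<epsilon> 1"] elim(1) by simp
      also have "\<bar>2 / q \<epsilon> * U \<epsilon> 1\<bar> = 2 / q \<epsilon> * ?Y \<epsilon>" using q' by (simp add: abs_mult)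
      also have "\<dots> \<le> (real n - 2) * ?Y \<epsilon>"
        using \<open>2 / q \<epsilon> \<le> real n - 2\<close> by (rule mult_right_mono) simp
      finally show ?case by (simp add: algebra_simps)
    qed
    moreover have "1 \<le> real n - 1" using n_ge by simp
    ultimately obtain R where
      "\<forall>\<^sub>F \<epsilon> in at_right 0. \<forall>r\<in>{\<rho>..1}.
        \<bar>U \<epsilon> r - (U \<epsilon> 1 - V \<epsilon> 1 * (r powr (2 - real n) - 1) / (real n - 2))\<bar> \<le> R * ?Y \<epsilon> powr (q \<epsilon> + 1)"
      using eventually_outer[OF \<rho>, of "real n - 1" ?Y] by auto
    then have "\<forall>\<^sub>F \<epsilon> in at_right 0. \<forall>r\<in>{\<rho>..1}. \<bar>\<bar>U \<epsilon> r\<bar> - ?Y \<epsilon> * 1\<bar> \<le> R * ?Y \<epsilon> powr (q \<epsilon> + 1)"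
      using V1
    proof eventually_elim
      case (elim \<epsilon>)
      show ?case
      proof
        fix r assume r: "r \<in> {\<rho>..1}"
        have "\<bar>\<bar>U \<epsilon> r\<bar> - ?Y \<epsilon> * 1\<bar> \<le> \<bar>U \<epsilon> r - U \<epsilon> 1\<bar>"
          using abs_triangle_ineq3[of "U \<epsilon> r" "U \<epsilon> 1"] by simp
        also have "\<dots> \<le> R * ?Y \<epsilon> powr (q \<epsilon> + 1)" using bspec[OF elim(1) r] elim(2) by simp
        finally show "\<bar>\<bar>U \<epsilon> r\<bar> - ?Y \<epsilon> * 1\<bar> \<le> R * ?Y \<epsilon> powr (q \<epsilon> + 1)" .
      qed
    qed
    then show ?thesis by blast
  qed
  have s: "\<forall>\<^sub>F \<epsilon> in at_right 0. 0 \<le> ?s \<epsilon>" by simp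
  have h: "0 \<le> (1::real) \<and> (1::real) \<le> 1" if "0 < \<rho>" "\<rho> \<le> r" "r \<le> 1" for \<rho> r :: real
    by simp
  note limits = uniform_limit_of_outer_approx[where h = "\<lambda>_. 1", OF K u outer h abs_ge_zero Y0 q_tendsto q_crit_pos s YA]
  show "uniform_limit K u (\<lambda>x. 0) (at_right 0)" by (rule limits(2))
  show "uniform_limit K (\<lambda>\<epsilon> x. \<bar>u \<epsilon> x\<bar> * ?s \<epsilon>)
      (\<lambda>x. (real n * (real n - 2)) powr ((real n - 2) / 4) * real N powr ?p) (at_right 0)"
    using limits(1) unfolding T0p by simp
qed

end

section \<open>From radial solutions to their profiles, and the conclusion\<close>

lemma radial_solution_profile:
  fixes u :: "'a::euclidean_space \<Rightarrow> real"
  assumes n: "n = DIM('a)" "3 \<le> n" and \<epsilon>: "0 < \<epsilon>" "\<epsilon> < 2 / (real n - 2)"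
    and rad: "radial u" and sol: "classical_solution (4 / (real n - 2) - \<epsilon>) u" and zeros: "has_interior_zeros u k"
  shows "\<exists>U V. (\<forall>x\<in>cball 0 1. u x = U (norm x)) \<and> radial_ode n (4 / (real n - 2) - \<epsilon>) U V
    \<and> finite {r \<in> {0<..<1}. U r = 0} \<and> card {r \<in> {0<..<1}. U r = 0} = k"
proof -
  let ?q = "4 / (real n - 2) - \<epsilon>"
  have n2: "0 < real n - 2" using n by simp
  have "4 / (real n - 2) = 2 * (2 / (real n - 2))" by simp
  then have q: "2 / (real n - 2) < ?q" using \<epsilon> by linarith
  then have q0: "0 < ?q" using n2 divide_pos_pos[of 2 "real n - 2"] by linarith
  obtain U V where u: "\<And>x. x \<in> cball 0 1 \<Longrightarrow> u x = U (norm x)" and UV: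
    "continuous_on {0..1} U" "continuous_on {0..1} V"
    "\<And>r. 0 < r \<Longrightarrow> r < 1 \<Longrightarrow> (U has_real_derivative V r) (at r)"
    "\<And>r. 0 < r \<Longrightarrow> r < 1 \<Longrightarrow>
      (V has_real_derivative - ((DIM('a) - 1) / r * V r) - \<bar>U r\<bar> powr ?q * U r) (at r)"
    using radial_classical_solution_ode[OF q0 sol rad] by blast
  have ode: "radial_ode n ?q U V"
    by unfold_locales (use n \<epsilon> q UV in auto)
  obtain U' where U': "radial_profile u U'" "finite {r \<in> {0<..<1}. U' r = 0}" "card {r \<in> {0<..<1}. U' r = 0} = k"
    using zeros by (auto simp: has_interior_zeros_def)
  \<comment> \<open>The zeros are counted on some profile \<open>U'\<close>; on the open interval it
    must agree with the one that solves the equation.\<close>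
  have "U' r = U r" if "r \<in> {0<..<1}" for r
  proof -
    obtain b :: 'a where "b \<in> Basis" using nonempty_Basis by blast
    then have "norm (r *\<^sub>R b) = r" using that by simp
    then show ?thesis
      using U'(1) u[of "r *\<^sub>R b"] that unfolding radial_profile_def by fastforce
  qed
  then have eq: "{r \<in> {0<..<1}. U' r = 0} = {r \<in> {0<..<1}. U r = 0}" by auto
  show ?thesis
    using u ode U'(2,3) unfolding eq by blast
qed

theorem theorem1p3:
  fixes u :: "real \<Rightarrow> real ^ 'n \<Rightarrow> real" and m n :: nat
  assumes n_def: "n = CARD('n)" and n_ge: "n \<ge> 3"
    and sol: "\<And>\<epsilon>. \<epsilon> \<in> {0<..<4 / (real n - 2)} \<Longrightarrow>
                 radial (u \<epsilon>) \<and>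
                 classical_solution (4 / (real n - 2) - \<epsilon>) (u \<epsilon>) \<and>
                 has_interior_zeros (u \<epsilon>) (m - 1)"
  shows "((\<forall>\<epsilon>\<in>{0<..<4 / (real n - 2)}. dirichlet_bc (u \<epsilon>)) \<and> m \<ge> 1 \<longrightarrow>
           (\<forall>K. compact K \<and> K \<subseteq> cball 0 1 - {0} \<longrightarrow>
              uniform_limit K
                (\<lambda>\<epsilon> x. \<bar>u \<epsilon> x\<bar> * (kappa n * \<epsilon>) powr (- 1 / 2))
                (\<lambda>x. (real n * (real n - 2)) powr ((real n - 2) / 4) * real m powr (1 / 2)
                      * (norm x powr (2 - real n) - 1))
                (at_right 0) \<and>
              uniform_limit K u (\<lambda>x. 0) (at_right 0)))
       \<and> ((\<forall>\<epsilon>\<in>{0<..<4 / (real n - 2)}. neumann_bc (u \<epsilon>)) \<and> m \<ge> 2 \<longrightarrow>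
           (\<forall>K. compact K \<and> K \<subseteq> cball 0 1 - {0} \<longrightarrow>
              uniform_limit K
                (\<lambda>\<epsilon> x. \<bar>u \<epsilon> x\<bar> * (kappa n * \<epsilon>) powr (- (real n - 2) / (2 * real n)))
                (\<lambda>x. (real n * (real n - 2)) powr ((real n - 2) / 4)
                      * (real m - 1) powr ((real n - 2) / (2 * real n)))
                (at_right 0) \<and>
              uniform_limit K u (\<lambda>x. 0) (at_right 0)))"
proof -
  have n2: "0 < real n - 2" using n_ge by simp
  let ?e0 = "2 / (real n - 2)"
  have e0: "0 < ?e0" "?e0 < 4 / (real n - 2)" using n2 by (simp_all add: divide_strict_right_mono)
  define P where "P \<epsilon> U V \<longleftrightarrow> (\<forall>x\<in>cball 0 1. u \<epsilon> x = U (norm x)) \<and> radial_ode n (4 / (real n - 2) - \<epsilon>) U V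
    \<and> finite {r \<in> {0<..<1}. U r = 0} \<and> card {r \<in> {0<..<1}. U r = 0} = m - 1" for \<epsilon> U V
  have "\<exists>U V. P \<epsilon> U V" if "\<epsilon> \<in> {0<..<?e0}" for \<epsilon>
  proof -
    have "\<epsilon> \<in> {0<..<4 / (real n - 2)}" using that e0 by auto
    from sol[OF this] that show ?thesis
      unfolding P_def using n_def n_ge by (intro radial_solution_profile) auto
  qed
  then obtain U V where "\<And>\<epsilon>. \<epsilon> \<in> {0<..<?e0} \<Longrightarrow> P \<epsilon> (U \<epsilon>) (V \<epsilon>)"
    by metis
  note UV = this[unfolded P_def]
  have ev: "\<forall>\<^sub>F \<epsilon> in at_right 0. \<epsilon> \<in> {0<..<?e0}"
    using eventually_at_right_real[OF e0(1)] .
  have u: "\<forall>\<^sub>F \<epsilon> in at_right 0. \<forall>x\<in>cball 0 1. u \<epsilon> x = U \<epsilon> (norm x)"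
    using ev by eventually_elim (use UV in blast)
  \<comment> \<open>By radial symmetry one boundary point is enough to read off the boundary
    condition.\<close>
  obtain x0 :: "real ^ 'n" where x0: "norm x0 = 1"
    using norm_axis_1 by blast
  show ?thesis
  proof (intro conjI impI allI)
    fix K :: "(real ^ 'n) set"
    assume bc: "(\<forall>\<epsilon>\<in>{0<..<4 / (real n - 2)}. dirichlet_bc (u \<epsilon>)) \<and> 1 \<le> m"
      and K: "compact K \<and> K \<subseteq> cball 0 1 - {0}"
    have U1: "U \<epsilon> 1 = 0" if "\<epsilon> \<in> {0<..<?e0}" for \<epsilon>
    proof -
      have "u \<epsilon> x0 = 0" using bc that e0 x0 by (auto simp: dirichlet_bc_def)
      then show ?thesis using UV[OF that] x0 by auto
    qed
    interpret bubble_family n m U V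
    proof (rule bubble_family.intro)
      fix \<epsilon> assume "0 < \<epsilon>" "\<epsilon> < ?e0"
      then have \<epsilon>: "\<epsilon> \<in> {0<..<?e0}" by simp
      \<comment> \<open>The zero at \<open>r = 1\<close> closes one more domain than there are
        interior zeros; \<open>Suc (m - 1) = m\<close> uses \<open>1 \<le> m\<close>.\<close>
      have "counted_ode n (4 / (real n - 2) - \<epsilon>) (U \<epsilon>) (V \<epsilon>) (Suc (m - 1))"
        using UV[OF \<epsilon>] U1[OF \<epsilon>] by (intro radial_ode.counted_ode_dirichlet) auto
      then show "counted_ode n (4 / (real n - 2) - \<epsilon>) (U \<epsilon>) (V \<epsilon>) m"
        using bc by simp
    qed (use n_ge bc in auto)
    have "\<forall>\<^sub>F \<epsilon> in at_right 0. U \<epsilon> 1 = 0"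
      using ev by eventually_elim (rule U1)
    from dirichlet_limit[OF this u] K
    show "uniform_limit K (\<lambda>\<epsilon> x. \<bar>u \<epsilon> x\<bar> * (kappa n * \<epsilon>) powr (- 1 / 2))
        (\<lambda>x. (real n * (real n - 2)) powr ((real n - 2) / 4) * real m powr (1 / 2)
              * (norm x powr (2 - real n) - 1)) (at_right 0)"
      and "uniform_limit K u (\<lambda>x. 0) (at_right 0)"
      by blast+
  next
    fix K :: "(real ^ 'n) set"
    assume bc: "(\<forall>\<epsilon>\<in>{0<..<4 / (real n - 2)}. neumann_bc (u \<epsilon>)) \<and> 2 \<le> m"
      and K: "compact K \<and> K \<subseteq> cball 0 1 - {0}"
    have V1: "V \<epsilon> 1 = 0" if "\<epsilon> \<in> {0<..<?e0}" for \<epsilon>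
    proof -
      interpret radial_ode n "4 / (real n - 2) - \<epsilon>" "U \<epsilon>" "V \<epsilon>"
        using UV[OF that] by blast
      have "has_normal_derivative (u \<epsilon>) 0 x0" using bc that e0 x0 by (auto simp: neumann_bc_def)
      then show ?thesis
        using UV[OF that] x0 U_deriv by (intro radial_normal_derivative[OF _ U_cont V_cont]) auto
    qed
    interpret bubble_family n "m - 1" U V
    proof (rule bubble_family.intro)
      fix \<epsilon> assume "0 < \<epsilon>" "\<epsilon> < ?e0"
      then have \<epsilon>: "\<epsilon> \<in> {0<..<?e0}" by simp
      \<comment> \<open>The domain after the last zero is incomplete, so \<open>m - 1\<close>
        interior zeros give \<open>m - 1\<close> domains. With truncated subtraction
        \<open>Suc (m - 2) = m - 1\<close> relies on \<open>2 \<le> m\<close>.\<close>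
      have "counted_ode n (4 / (real n - 2) - \<epsilon>) (U \<epsilon>) (V \<epsilon>) (Suc (m - 2))"
        using UV[OF \<epsilon>] V1[OF \<epsilon>] bc by (intro radial_ode.counted_ode_neumann) auto
      moreover have "Suc (m - 2) = m - 1" using conjunct2[OF bc] by arith
      ultimately show "counted_ode n (4 / (real n - 2) - \<epsilon>) (U \<epsilon>) (V \<epsilon>) (m - 1)" by simp
    qed (use n_ge bc in auto)
    have "\<forall>\<^sub>F \<epsilon> in at_right 0. V \<epsilon> 1 = 0"
      using ev by eventually_elim (rule V1)
    moreover have "real (m - 1) = real m - 1" using conjunct2[OF bc] by (simp add: of_nat_diff)
    ultimately show "uniform_limit K (\<lambda>\<epsilon> x. \<bar>u \<epsilon> x\<bar> * (kappa n * \<epsilon>) powr (- (real n - 2) / (2 * real n)))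
        (\<lambda>x. (real n * (real n - 2)) powr ((real n - 2) / 4)
              * (real m - 1) powr ((real n - 2) / (2 * real n))) (at_right 0)"
      and "uniform_limit K u (\<lambda>x. 0) (at_right 0)"
      using neumann_limit[of u K] u K by simp_all
  qed
qed

end
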